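(* Let $g(x)=bx+\int_0^\infty(1-e^{-sx})\,\nu(ds)$, $b\ge 0$, be a Bernstein function whose Lévy measure $\nu$ has tail $w(s)=\nu((s,\infty))$ that is absolutely continuous on $(0,\infty)$ with $w(0+)=+\infty$. Let $\mathcal E_g$ be the inverse of the subordinator with Laplace exponent $g$, and let $W_t^g$ be the complex integral operator defined in the context. (i) Let $f\in A(D)$, $f(z)=\sum_{k=0}^\infty a_kz^k$ for $z\in D$. For every $t>0$, $W_t^g$ maps $A(D)$ into $A(D)$; that is, $W_t^gf$ is analytic in $D$, with $$W_t^gf(z)=\sum_{k=0}^\infty a_kz^kd_k(t),\qquad z\in D,\qquad d_k(t):=\mathbb E\big[e^{-\frac{k^2}{2}\mathcal E_g(t)}\big],$$ and, $f$ being continuous on $\overline D$, $W_t^gf$ is continuous on $\overline D$ as well. Furthermore, for $\theta>0$ and $z\in D$, $$\int_0^\infty e^{-\theta t}W_t^gf(z)\,dt=\sum_{k=0}^\infty a_kz^k\,\tilde d_k(\theta),\qquad \tilde d_k(\theta):=\frac{g(\theta)/\theta}{g(\theta)+\frac{k^2}{2}}.$$ (ii) Moreover, $u(z,t)=W_t^gf(z)$ is the unique solution, belonging to $A(D)$ (as a function of $z$) for any $t\ge 0$, of the Cauchy problem $$\Big(\mathfrak D_t^g+b\frac{\partial}{\partial t}\Big)u(z,t)=\frac12\frac{\partial^2u}{\partial\varphi^2}(z,t),\qquad (t,z)\in(0,\infty)\times (D\setminus\{0\}),\quad z=re^{i\varphi},$$ $$u(z,0)=f(z),\qquad f\in A(D),\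 z\in\overline D.$$
   Context: $D=\{z\in\mathbb C:|z|<1\}$, and $A(D)$ is the Banach space of functions $f:\overline D\to\mathbb C$ that are analytic on $D$ and continuous on $\overline D$, with the uniform norm. A Lévy measure here is a non-negative measure $\nu$ on $(0,\infty)$ with $\int_0^\infty(z\wedge1)\,\nu(dz)<\infty$. $\mathcal H_g=\{\mathcal H_g(t)\}_{t\ge0}$ is the subordinator with drift $b$ and Lévy measure $\nu$, i.e. $\mathbb E e^{-\theta\mathcal H_g(t)}=e^{-tg(\theta)}$ for $\theta\ge 0$. Its inverse is $\mathcal E_g(t)=\inf\{s>0:\mathcal H_g(s)>t\}$, and $m_g(s,t)$ denotes the density of $\mathcal E_g(t)$ in $s$. The generalized (regularized Caputo-type) derivative is $$\mathfrak D_t^gu(t):=\frac{d}{dt}\int_0^tw(t-s)\,(u(s)-u(0))\,ds,$$ acting on the time variable. Let $B$ be a standard real Brownian motion independent of $\mathcal E_g$. For $t>0$, $B(\mathcal E_g(t))$ has density $\ell_g(x,t)=\int_0^\infty\frac{e^{-x^2/(2y)}}{\sqrt{2\pi y}}\,m_g(y,t)\,dy$. For $z\in\overline D$, $$W_t^gf(z):=\int_{\mathbb R}f(ze^{-iu})\,\ell_g(u,t)\,du=\mathbb E f\big(ze^{-iB(\mathcal E_g(t))}\big)\quad(t>0),\qquad W_0^gf=f.$$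
   Formalization: In (ii), a solution u(z,t) is also required to be jointly continuous on D×[0,∞); without continuity at t=0 uniqueness fails, e.g. z^k t^{α-1}E_{α,α}(-k²t^α/2), set to 0 at t=0, for b=0 and stable w. *)

theory Defs
  imports "HOL-Probability.Probability"
begin

definition disk_algebra :: "(complex \<Rightarrow> complex) set" where
  "disk_algebra = {f. f holomorphic_on ball 0 1 \<and> continuous_on (cball 0 1) f}"

definition absolutely_continuous_function_on :: "real set \<Rightarrow> (real \<Rightarrow> real) \<Rightarrow> bool" where
  "absolutely_continuous_function_on S F \<longleftrightarrow>
     (\<forall>\<epsilon>>0. \<exists>\<delta>>0. \<forall>(n::nat) (l::nat \<Rightarrow> real) (r::nat \<Rightarrow> real).
        (\<forall>i<n. l i \<le> r i \<and> {l i..r i} \<subseteq> S) \<and>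
        disjoint_family_on (\<lambda>i. {l i<..<r i}) {..<n} \<and>
        (\<Sum>i<n. r i - l i) < \<delta> \<longrightarrow> (\<Sum>i<n. \<bar>F (r i) - F (l i)\<bar>) < \<epsilon>)"

text \<open>
  On a non-compact interval absolute continuity is meant locally. A function that satisfies the
  \<open>\<epsilon>\<close>-\<open>\<delta>\<close> condition on all of \<open>(0,\<infinity>)\<close> is uniformly continuous there, which is incompatible with
  \<open>w(0+) = \<infinity>\<close>.
\<close>

definition locally_absolutely_continuous_on :: "real set \<Rightarrow> (real \<Rightarrow> real) \<Rightarrow> bool" where
  "locally_absolutely_continuous_on S F \<longleftrightarrow>
     (\<forall>c d. c \<le> d \<and> {c..d} \<subseteq> S \<longrightarrow> absolutely_continuous_function_on {c..d} F)"

definition levy_measure :: "real measure \<Rightarrow> bool" where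
  "levy_measure \<nu> \<longleftrightarrow>
     sets \<nu> = sets (restrict_space borel {0<..}) \<and> (\<integral>\<^sup>+ z. ennreal (min z 1) \<partial>\<nu>) < \<infinity>"

text \<open>Only the values at \<open>s > 0\<close>, where the tail is finite, are meaningful.\<close>

definition levy_tail :: "real measure \<Rightarrow> real \<Rightarrow> real" where
  "levy_tail \<nu> s = measure \<nu> {s<..}"

definition bernstein :: "real \<Rightarrow> real measure \<Rightarrow> real \<Rightarrow> real" where
  "bernstein b \<nu> x = b * x + (\<integral>s. (1 - exp (- s * x)) \<partial>\<nu>)"

text \<open>
  Left limits of the paths need not be required, since the paths are nondecreasing.
\<close>

definition subordinator :: "'a measure \<Rightarrow> (real \<Rightarrow> real) \<Rightarrow> (real \<Rightarrow> 'a \<Rightarrow> real) \<Rightarrow> bool" where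
  "subordinator M g H \<longleftrightarrow>
     (\<forall>t\<ge>0. H t \<in> borel_measurable M) \<and>
     (AE \<omega> in M. H 0 \<omega> = 0) \<and>
     (\<forall>(n::nat) (\<tau>::nat \<Rightarrow> real). 0 \<le> \<tau> 0 \<and> mono \<tau> \<longrightarrow>
        prob_space.indep_vars M (\<lambda>_. borel) (\<lambda>i \<omega>. H (\<tau> (Suc i)) \<omega> - H (\<tau> i) \<omega>) {..<n}) \<and>
     (\<forall>s\<ge>0. \<forall>t\<ge>0. distr M borel (\<lambda>\<omega>. H (s + t) \<omega> - H s \<omega>) = distr M borel (H t)) \<and>
     (AE \<omega> in M. mono_on {0..} (\<lambda>t. H t \<omega>) \<and>
        (\<forall>t\<ge>0. continuous (at_right t) (\<lambda>s. H s \<omega>))) \<and>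
     (\<forall>t\<ge>0. \<forall>\<theta>\<ge>0. (\<integral>\<omega>. exp (- \<theta> * H t \<omega>) \<partial>M) = exp (- t * g \<theta>))"

definition inverse_subordinator :: "(real \<Rightarrow> 'a \<Rightarrow> real) \<Rightarrow> real \<Rightarrow> 'a \<Rightarrow> real" where
  "inverse_subordinator H t \<omega> = Inf {s. s > 0 \<and> H s \<omega> > t}"

text \<open>
  \<open>subordinated_density m x t\<close> is \<open>\<ell>(x,t)\<close>, the density of Brownian motion at the independent
  time \<open>\<E>(t)\<close>, where \<open>m s t\<close> is the density of \<open>\<E>(t)\<close> at \<open>s\<close>.
\<close>

definition subordinated_density :: "(real \<Rightarrow> real \<Rightarrow> real) \<Rightarrow> real \<Rightarrow> real \<Rightarrow> real" where
  "subordinated_density m x t =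
     (LINT y:{0<..}|lborel. exp (- x\<^sup>2 / (2 * y)) / sqrt (2 * pi * y) * m y t)"

definition W_op ::
    "(real \<Rightarrow> real \<Rightarrow> real) \<Rightarrow> real \<Rightarrow> (complex \<Rightarrow> complex) \<Rightarrow> complex \<Rightarrow> complex" where
  "W_op m t f z =
     (if t = 0 then f z
      else (LINT u|lborel. subordinated_density m u t *\<^sub>R f (z * exp (- \<i> * of_real u))))"

definition d_coeff :: "'a measure \<Rightarrow> (real \<Rightarrow> 'a \<Rightarrow> real) \<Rightarrow> nat \<Rightarrow> real \<Rightarrow> real" where
  "d_coeff M H k t = (\<integral>\<omega>. exp (- ((real k)\<^sup>2 / 2) * inverse_subordinator H t \<omega>) \<partial>M)"

definition d_laplace :: "(real \<Rightarrow> real) \<Rightarrow> nat \<Rightarrow> real \<Rightarrow> real" where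
  "d_laplace g k \<theta> = (g \<theta> / \<theta>) / (g \<theta> + (real k)\<^sup>2 / 2)"

definition memory_integral :: "(real \<Rightarrow> real) \<Rightarrow> (real \<Rightarrow> complex) \<Rightarrow> real \<Rightarrow> complex" where
  "memory_integral w v t = (LINT s:{0..t}|lborel. w (t - s) *\<^sub>R (v s - v 0))"

definition gen_derivative :: "(real \<Rightarrow> real) \<Rightarrow> (real \<Rightarrow> complex) \<Rightarrow> real \<Rightarrow> complex" where
  "gen_derivative w v t = vector_derivative (memory_integral w v) (at t)"

text \<open>
  The second derivative in \<open>\<phi>\<close> of \<open>v (r e\<^sup>i\<^sup>\<phi>)\<close>. It exists whenever \<open>v\<close> is holomorphic on the
  open unit disk and \<open>0 < r < 1\<close>.
\<close>

definition angular_derivative2 :: "(complex \<Rightarrow> complex) \<Rightarrow> real \<Rightarrow> real \<Rightarrow> complex" where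
  "angular_derivative2 v r \<phi> =
     vector_derivative (\<lambda>\<alpha>. vector_derivative (\<lambda>\<beta>. v (rcis r \<beta>)) (at \<alpha>)) (at \<phi>)"

text \<open>
  Continuity on \<open>D \<times> [0,\<infinity>)\<close> is the usual requirement that a solution attains its initial value.
  Without continuity at \<open>t = 0\<close> uniqueness fails: for \<open>b = 0\<close> and \<open>w(s) = s\<^sup>-\<^sup>\<alpha> / \<Gamma>(1-\<alpha>)\<close>, the function
  \<open>z\<^sup>k t\<^sup>\<alpha>\<^sup>-\<^sup>1 E\<^sub>\<alpha>\<^sub>,\<^sub>\<alpha>(-k\<^sup>2 t\<^sup>\<alpha> / 2)\<close>, set to \<open>0\<close> at \<open>t = 0\<close>, would be a second solution with initial value
  \<open>0\<close>. Continuity also makes the memory integral converge, as \<open>w\<close> is integrable near \<open>0\<close>.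
  For \<open>b = 0\<close> the term \<open>b \<partial>/\<partial>t\<close> is absent, and no differentiability in \<open>t\<close> is asked for.
\<close>

definition cauchy_solution ::
    "real \<Rightarrow> (real \<Rightarrow> real) \<Rightarrow> (complex \<Rightarrow> complex) \<Rightarrow> (complex \<Rightarrow> real \<Rightarrow> complex) \<Rightarrow> bool" where
  "cauchy_solution b w f u \<longleftrightarrow>
     (\<forall>t\<ge>0. (\<lambda>z. u z t) \<in> disk_algebra) \<and>
     continuous_on (ball 0 1 \<times> {0..}) (\<lambda>(z, t). u z t) \<and>
     (\<forall>z\<in>cball 0 1. u z 0 = f z) \<and>
     (\<forall>t>0. \<forall>r\<in>{0<..<1}. \<forall>\<phi>.
        memory_integral w (u (rcis r \<phi>)) differentiable (at t) \<and>
        (b \<noteq> 0 \<longrightarrow> u (rcis r \<phi>) differentiable (at t)) \<and>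
        gen_derivative w (u (rcis r \<phi>)) t + b *\<^sub>R vector_derivative (u (rcis r \<phi>)) (at t) =
          (1 / 2) *\<^sub>R angular_derivative2 (\<lambda>z. u z t) r \<phi>)"

end

theory Submission
  imports Defs "HOL-Complex_Analysis.Complex_Analysis" "HOL-Real_Asymp.Real_Asymp"
begin

text \<open>
  Write \<open>w\<close> for the Levy tail, \<open>E t\<close> for the inverse subordinator and \<open>D \<mu> t\<close> for the expectation of
  \<open>exp (-\<mu> * E t)\<close>. Since \<open>E t\<close> has a density, \<open>E t \<le> s\<close> and \<open>t < H s\<close> are equally likely; hence
  \<open>D \<mu> t = (\<integral>s. \<mu> * exp (-\<mu> * s) * P (t < H s))\<close>, which yields continuity in \<open>t\<close> and the Laplace
  transform \<open>g \<theta> / (\<theta> * (g \<theta> + \<mu>))\<close>. As \<open>w\<close> has Laplace transform \<open>g \<theta> / \<theta> - b\<close>, uniqueness of Laplace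
  transforms gives the relaxation equation \<open>w * (1 - D \<mu>) + b (1 - D \<mu>) = \<mu> (1 * D \<mu>)\<close> (with convolutions
  on the half-line). Averaging over the Gaussian density turns \<open>W_op\<close> into the multiplier \<open>D (k\<^sup>2/2)\<close> on
  the coefficient of \<open>z\<^sup>k\<close>, so the time-integrated Cauchy problem holds coefficientwise. For \<open>b > 0\<close>
  differentiability in time comes from solving a Volterra equation of the second kind for the derivative.

  For uniqueness no growth in \<open>t\<close> is assumed, so Laplace transforms are not available. Instead, a
  solution \<open>c\<close> of \<open>w * c + b c = - \<lambda> (1 * c)\<close> is convolved with \<open>1 - D \<mu>\<close>; the relaxation equation
  then eliminates \<open>w\<close> and leaves \<open>\<lambda> ((1 - D \<mu>) * c) + \<mu> (D \<mu> * c) = 0\<close>. Taking \<open>\<mu> = \<lambda>\<close>, or letting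
  \<open>\<mu>\<close> tend to \<open>0\<close> if \<open>\<lambda> = 0\<close>, gives \<open>1 * c = 0\<close>.
\<close>

section \<open>Convolution on the half-line and Volterra equations\<close>

text \<open>The equation is treated in time-integrated form throughout. The kernel \<open>w\<close>
  is singular at 0, and for \<open>b = 0\<close> a solution need not be differentiable in time; the
  integrated equation contains only convolutions of continuous functions with locally integrable
  kernels, which can be summed over coefficients and rearranged by associativity. The factor
  \<open>1 - D \<mu>\<close> is chosen because \<open>w\<close> itself is not explicit: its
  convolution with this one continuous function is known, up to a multiple of the function, as a
  primitive. Moving \<open>w\<close> from the unknown onto that factor therefore removes it. The
  blow-up of \<open>w\<close> at 0 acts through the paths. It makes \<open>g\<close> unbounded,
  hence \<open>H d > 0\<close> almost surely for every \<open>d > 0\<close>; a driftless compound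
  Poisson process, whose paths rest at 0 for a while, is thereby excluded, and
  \<open>D \<mu>\<close> starts at 1. Laplace transforms are harmless for \<open>D \<mu>\<close>
  because it is bounded by 1.\<close>

definition vconv :: "(real \<Rightarrow> real) \<Rightarrow> (real \<Rightarrow> 'b) \<Rightarrow> real \<Rightarrow> 'b::{banach,second_countable_topology}" where
  "vconv w v t = (LINT s:{0..t}|lborel. w (t - s) *\<^sub>R v s)"

lemma vconv_reflect:
  "vconv w v t = (LINT s:{0..t}|lborel. w s *\<^sub>R v (t - s))"
proof -
  have "vconv w v t = (\<integral>x. indicator {0..t} x *\<^sub>R (w (t - x) *\<^sub>R v x) \<partial>lborel)"
    unfolding vconv_def set_lebesgue_integral_def ..
  also have "\<dots> = \<bar>-1\<bar> *\<^sub>R (\<integral>x. indicator {0..t} (t + (-1) * x) *\<^sub>R (w (t - (t + (-1) * x)) *\<^sub>R v (t + (-1) * x)) \<partial>lborel)"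
    by (rule lborel_integral_real_affine) simp
  also have "\<dots> = (\<integral>x. indicator {0..t} x *\<^sub>R (w x *\<^sub>R v (t - x)) \<partial>lborel)"
    by (auto intro!: Bochner_Integration.integral_cong simp: indicator_def)
  finally show ?thesis unfolding set_lebesgue_integral_def .
qed

lemma vconv_commute: "vconv (w::real \<Rightarrow> real) v t = vconv v w t"
  by (subst vconv_reflect) (simp add: vconv_def mult.commute)

lemma vconv_cong:
  assumes "\<And>s. 0 \<le> s \<Longrightarrow> s \<le> t \<Longrightarrow> w s = w' s" "\<And>s. 0 \<le> s \<Longrightarrow> s \<le> t \<Longrightarrow> v s = v' s"
  shows "vconv w v t = vconv w' v' t"
  unfolding vconv_def set_lebesgue_integral_def
  by (rule Bochner_Integration.integral_cong) (auto simp: indicator_def assms)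

lemma vconv_0 [simp]: "vconv w v 0 = 0"
proof -
  have "AE x in lborel. indicator {0..0} x *\<^sub>R w (0 - x) *\<^sub>R v x = 0"
    using AE_lborel_singleton[of 0] by eventually_elim auto
  then show ?thesis
    unfolding vconv_def set_lebesgue_integral_def by (intro integral_eq_zero_AE)
qed

text \<open>Each factor is known to be measurable only after cutting off to \<open>A\<close>, so the
  cut-off is put on both; the two indicators multiply to one.\<close>

lemma set_integrable_bounded_scaleR:
  fixes v :: "real \<Rightarrow> 'b::{banach,second_countable_topology}"
  assumes w: "set_integrable lborel A (w::real \<Rightarrow> real)" and v: "set_borel_measurable lborel A v"
    and B: "\<And>s. s \<in> A \<Longrightarrow> norm (v s) \<le> B"
  shows "set_integrable lborel A (\<lambda>s. w s *\<^sub>R v s)"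
proof -
  have [measurable]: "(\<lambda>x. indicator A x *\<^sub>R w x) \<in> borel_measurable lborel"
    using w unfolding set_integrable_def by auto
  have [measurable]: "(\<lambda>x. indicator A x *\<^sub>R v x) \<in> borel_measurable lborel"
    using v unfolding set_borel_measurable_def by auto
  have "integrable lborel (\<lambda>x. (indicator A x *\<^sub>R w x) *\<^sub>R (indicator A x *\<^sub>R v x))"
  proof (rule Bochner_Integration.integrable_bound)
    show "integrable lborel (\<lambda>x. B * norm (indicator A x *\<^sub>R w x))"
      using w unfolding set_integrable_def by (intro integrable_mult_right integrable_norm)
    show "AE x in lborel. norm ((indicator A x *\<^sub>R w x) *\<^sub>R (indicator A x *\<^sub>R v x)) \<le> norm (B * norm (indicator A x *\<^sub>R w x))"
    proof (rule AE_I2)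
      fix x
      show "norm ((indicator A x *\<^sub>R w x) *\<^sub>R (indicator A x *\<^sub>R v x)) \<le> norm (B * norm (indicator A x *\<^sub>R w x))"
      proof (cases "x \<in> A")
        case True
        have "norm (v x) \<le> \<bar>B\<bar>" using B[OF True] by linarith
        then show ?thesis using True by (simp add: abs_mult mult.commute[of "\<bar>B\<bar>"] mult_left_mono)
      qed simp
    qed
  qed measurable
  moreover have "(\<lambda>x. (indicator A x *\<^sub>R w x) *\<^sub>R (indicator A x *\<^sub>R v x)) = (\<lambda>x. indicator A x *\<^sub>R w x *\<^sub>R v x)"
    by (auto simp: indicator_def)
  ultimately show ?thesis unfolding set_integrable_def by simp
qed

lemma set_integrable_reflect:
  fixes v :: "real \<Rightarrow> 'b::{banach,second_countable_topology}"
  assumes "set_integrable lborel {0..t} v"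
  shows "set_integrable lborel {0..t} (\<lambda>s. v (t - s))"
proof -
  have "integrable lborel (\<lambda>x. indicator {0..t} (t + (-1) * x) *\<^sub>R v (t + (-1) * x))"
    using assms unfolding set_integrable_def by (rule lborel_integrable_real_affine) simp
  moreover have "(\<lambda>x. indicator {0..t} (t + (-1) * x) *\<^sub>R v (t + (-1) * x)) = (\<lambda>x. indicator {0..t} x *\<^sub>R v (t - x))"
    by (auto simp: indicator_def)
  ultimately show ?thesis unfolding set_integrable_def by simp
qed

lemma continuous_on_imp_set_borel_measurable:
  fixes v :: "real \<Rightarrow> 'b::{banach,second_countable_topology}"
  assumes "continuous_on {0..t} v"
  shows "set_borel_measurable lborel {0..t} v"
  using borel_measurable_continuous_on_indicator[OF _ assms]
  unfolding set_borel_measurable_def by simp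

lemma set_integrable_continuous_interval:
  fixes v :: "real \<Rightarrow> 'b::{banach,second_countable_topology}"
  assumes "continuous_on {0..t} v"
  shows "set_integrable lborel {0..t} v"
  unfolding set_integrable_def using borel_integrable_compact[OF _ assms] by simp

lemma set_integrable_const_1: "set_integrable lborel {0..t::real} (\<lambda>_. 1::real)"
  by (rule set_integrable_continuous_interval[OF continuous_on_const])

lemma bounded_on_interval:
  fixes v :: "real \<Rightarrow> 'b::real_normed_vector"
  assumes "continuous_on {0..t} v"
  obtains B where "B \<ge> 0" "\<And>s. 0 \<le> s \<Longrightarrow> s \<le> t \<Longrightarrow> norm (v s) \<le> B"
proof -
  have "compact (v ` {0..t})" using assms compact_continuous_image by blast
  then obtain B where "\<And>x. x \<in> v ` {0..t} \<Longrightarrow> norm x \<le> B"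
    using compact_imp_bounded bounded_iff by metis
  then have "norm (v s) \<le> max B 0" if "0 \<le> s" "s \<le> t" for s using that by force
  then show ?thesis using that[of "max B 0"] by auto
qed

lemma set_integrable_vconv:
  fixes v :: "real \<Rightarrow> 'b::{banach,second_countable_topology}"
  assumes w: "set_integrable lborel {0..t} w" and v: "continuous_on {0..t} v"
  shows "set_integrable lborel {0..t} (\<lambda>s. w (t - s) *\<^sub>R v s)"
proof -
  obtain B where "\<And>s. 0 \<le> s \<Longrightarrow> s \<le> t \<Longrightarrow> norm (v s) \<le> B"
    using bounded_on_interval[OF v] by metis
  then show ?thesis
    by (intro set_integrable_bounded_scaleR[where B=B] set_integrable_reflect w
        continuous_on_imp_set_borel_measurable v) auto
qed

lemma vconv_add:
  fixes v :: "real \<Rightarrow> 'b::{banach,second_countable_topology}"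
  assumes "set_integrable lborel {0..t} w" and "continuous_on {0..t} v" "continuous_on {0..t} v'"
  shows "vconv w (\<lambda>s. v s + v' s) t = vconv w v t + vconv w v' t"
  unfolding vconv_def scaleR_add_right
  by (intro set_integral_add set_integrable_vconv assms)

lemma vconv_diff:
  fixes v :: "real \<Rightarrow> 'b::{banach,second_countable_topology}"
  assumes "set_integrable lborel {0..t} w" and "continuous_on {0..t} v" "continuous_on {0..t} v'"
  shows "vconv w (\<lambda>s. v s - v' s) t = vconv w v t - vconv w v' t"
  unfolding vconv_def scaleR_diff_right
  by (intro set_integral_diff set_integrable_vconv assms)

lemma vconv_linear:
  fixes v :: "real \<Rightarrow> 'b::{banach,second_countable_topology}"
  assumes "bounded_linear L" "set_integrable lborel {0..t} w" and "continuous_on {0..t} v"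
  shows "vconv w (\<lambda>s. L (v s)) t = L (vconv w v t)"
proof -
  interpret bounded_linear L by fact
  have "vconv w (\<lambda>s. L (v s)) t = (\<integral>s. L (indicator {0..t} s *\<^sub>R (w (t - s) *\<^sub>R v s)) \<partial>lborel)"
    unfolding vconv_def set_lebesgue_integral_def by (simp add: scaleR)
  also have "\<dots> = L (vconv w v t)"
    unfolding vconv_def set_lebesgue_integral_def
    using set_integrable_vconv[OF assms(2,3)] unfolding set_integrable_def
    by (rule integral_bounded_linear[OF assms(1)])
  finally show ?thesis .
qed

text \<open>Sup norm of \<open>v\<close> times L1 norm of the kernel; the latter becomes the
  contraction constant for Volterra equations.\<close>

lemma vconv_norm_le:
  fixes v :: "real \<Rightarrow> 'b::{banach,second_countable_topology}"
  assumes "set_integrable lborel {0..t} w" and "continuous_on {0..t} v"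
    and B: "\<And>s. 0 \<le> s \<Longrightarrow> s \<le> t \<Longrightarrow> norm (v s) \<le> B"
  shows "norm (vconv w v t) \<le> B * (LINT s:{0..t}|lborel. \<bar>w s\<bar>)"
proof -
  have i1: "set_integrable lborel {0..t} (\<lambda>s. w (t - s) *\<^sub>R v s)"
    by (rule set_integrable_vconv) fact+
  have i2: "set_integrable lborel {0..t} (\<lambda>s. \<bar>w (t - s)\<bar>)"
    using set_integrable_reflect[OF assms(1)] by (rule set_integrable_abs)
  have "norm (vconv w v t) \<le> (LINT s:{0..t}|lborel. norm (w (t - s) *\<^sub>R v s))"
    unfolding vconv_def by (rule set_integral_norm_bound[OF i1])
  also have "\<dots> \<le> (LINT s:{0..t}|lborel. B * \<bar>w (t - s)\<bar>)"
    by (intro set_integral_mono set_integrable_norm i1 set_integrable_mult_right i2)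
       (auto simp: mult.commute[of B] intro!: mult_left_mono B)
  \<comment> \<open>Read in its two forms, the convolution with the constant 1 equates the integral
    of the reflected kernel with that of the kernel itself.\<close>
  also have "\<dots> = B * vconv (\<lambda>_. 1) (\<lambda>s. \<bar>w s\<bar>) t"
    unfolding vconv_reflect by simp
  finally show ?thesis unfolding vconv_def by simp
qed

text \<open>At \<open>s = l\<close> the limit may depend on the side from which \<open>t n\<close>
  approaches; this point is excluded, which costs nothing under an integral.\<close>

lemma tendsto_shift_indicator:
  fixes v :: "real \<Rightarrow> 'b::real_normed_vector"
  assumes v: "continuous_on {0..T} v" and t: "\<And>n. t n \<in> {0..T}" "t \<longlonglongrightarrow> l" "l \<in> {0..T}"
    and s: "s \<noteq> l" "0 \<le> s"
  shows "(\<lambda>n. indicator {0..t n} s *\<^sub>R v (t n - s)) \<longlonglongrightarrow> indicator {0..l} s *\<^sub>R v (l - s)"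
proof (cases "s < l")
  case True
  have ev: "\<forall>\<^sub>F n in sequentially. s < t n" using t(2) True by (rule order_tendstoD)
  \<comment> \<open>The \<open>max\<close> keeps the argument in \<open>{0..T}\<close> for the
    finitely many \<open>n\<close> with \<open>t n < s\<close>, where \<open>v\<close> is not
    controlled.\<close>
  have "(\<lambda>n. v (max 0 (t n - s))) \<longlonglongrightarrow> v (max 0 (l - s))"
  proof (rule continuous_on_tendsto_compose[OF v])
    show "(\<lambda>n. max 0 (t n - s)) \<longlonglongrightarrow> max 0 (l - s)"
      by (intro tendsto_intros t)
    have "t n - s \<le> T" "0 \<le> T" for n using t(1)[of n] s by auto
    then show "\<forall>\<^sub>F n in sequentially. max 0 (t n - s) \<in> {0..T}" by auto
    show "max 0 (l - s) \<in> {0..T}" using t(3) s by auto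
  qed
  then have "(\<lambda>n. indicator {0..t n} s *\<^sub>R v (t n - s)) \<longlonglongrightarrow> v (max 0 (l - s))"
    by (rule Lim_transform_eventually)
       (use ev in eventually_elim, use s in auto)
  then show ?thesis using True s by auto
next
  case False
  then have "l < s" using s by auto
  have "\<forall>\<^sub>F n in sequentially. t n < s" using t(2) \<open>l < s\<close> by (rule order_tendstoD)
  then have "\<forall>\<^sub>F n in sequentially. 0 = indicator {0..t n} s *\<^sub>R v (t n - s)"
    by eventually_elim auto
  then have "(\<lambda>n. indicator {0..t n} s *\<^sub>R v (t n - s)) \<longlonglongrightarrow> 0"
    by (rule Lim_transform_eventually[rotated]) auto
  then show ?thesis using \<open>l < s\<close> by auto
qed

text \<open>In reflected form the kernel stays fixed as \<open>t\<close> varies and only the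
  continuous factor is translated. Dominated convergence then works even if \<open>w\<close> is
  unbounded near 0.\<close>

lemma continuous_on_vconv:
  fixes v :: "real \<Rightarrow> 'b::{banach,second_countable_topology}"
  assumes w: "set_integrable lborel {0..T} w" and v: "continuous_on {0..T} v"
  shows "continuous_on {0..T} (vconv w v)"
proof (rule continuous_on_sequentiallyI)
  fix t l assume "\<forall>n. t n \<in> {0..T}" and l: "l \<in> {0..T}" and tl: "t \<longlonglongrightarrow> l"
  then have t: "t n \<in> {0..T}" for n by auto
  define W where "W s = indicator {0..T} s *\<^sub>R w s" for s
  have W: "integrable lborel W" using w unfolding W_def set_integrable_def by simp
  define S where "S t s = indicator {0..t} s *\<^sub>R v (t - s)" for t s
  obtain B where B: "B \<ge> 0" "\<And>s. 0 \<le> s \<Longrightarrow> s \<le> T \<Longrightarrow> norm (v s) \<le> B"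
    using bounded_on_interval[OF v] by metis
  have eq: "vconv w v t = (\<integral>s. W s *\<^sub>R S t s \<partial>lborel)" if "t \<in> {0..T}" for t
    unfolding vconv_reflect set_lebesgue_integral_def W_def S_def using that
    by (intro Bochner_Integration.integral_cong) (auto simp: indicator_def)
  have Sm: "S t \<in> borel_measurable lborel" if "t \<in> {0..T}" for t
  proof -
    have "continuous_on {0..t} (\<lambda>s. v (t - s))"
      using that by (intro continuous_on_compose2[OF v] continuous_intros) auto
    from continuous_on_imp_set_borel_measurable[OF this] show ?thesis
      unfolding S_def set_borel_measurable_def .
  qed
  have Sb: "norm (S t s) \<le> B" if "t \<in> {0..T}" for t s
    unfolding S_def using B that by (auto simp: indicator_def)
  have "(\<lambda>n. \<integral>s. W s *\<^sub>R S (t n) s \<partial>lborel) \<longlonglongrightarrow> (\<integral>s. W s *\<^sub>R S l s \<partial>lborel)"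
  proof (rule integral_dominated_convergence[where w="\<lambda>s. \<bar>W s\<bar> * B"])
    show "AE x in lborel. (\<lambda>n. W x *\<^sub>R S (t n) x) \<longlonglongrightarrow> W x *\<^sub>R S l x"
      using AE_lborel_singleton[of l]
    proof eventually_elim
      case (elim x)
      show ?case
      proof (cases "0 \<le> x")
        case True
        show ?thesis unfolding S_def
          by (intro tendsto_intros tendsto_shift_indicator[OF v t tl l elim True])
      qed (simp add: W_def)
    qed
    show "AE x in lborel. norm (W x *\<^sub>R S (t n) x) \<le> \<bar>W x\<bar> * B" for n
      by (auto intro!: mult_left_mono Sb t simp del: atLeastAtMost_iff)
    show "(\<lambda>s. W s *\<^sub>R S l s) \<in> borel_measurable lborel"
      using W Sm[OF l] by (intro borel_measurable_scaleR) auto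
    show "(\<lambda>s. W s *\<^sub>R S (t n) s) \<in> borel_measurable lborel" for n
      using W Sm[OF t] by (intro borel_measurable_scaleR) auto
    show "integrable lborel (\<lambda>s. \<bar>W s\<bar> * B)" using W by auto
  qed
  then show "(\<lambda>n. vconv w v (t n)) \<longlonglongrightarrow> vconv w v l" using eq t l by simp
qed

lemma continuous_on_halfline:
  fixes f :: "real \<Rightarrow> 'b::topological_space"
  assumes "\<And>T. continuous_on {0..T} f"
  shows "continuous_on {0..} f"
  unfolding continuous_on_eq_continuous_within
proof
  fix x :: real assume "x \<in> {0..}"
  then have "continuous (at x within {0..x + 1}) f"
    using assms[of "x + 1"] by (auto simp: continuous_on_eq_continuous_within)
  moreover have "at x within {0..x + 1} = at x within {0..}"
    by (rule at_within_nhd[where S="{..<x + 1}"]) (use \<open>x \<in> {0..}\<close> in auto)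
  ultimately show "continuous (at x within {0..}) f" by simp
qed

text \<open>Fubini for \<open>K\<close>, built from the functions extended by zero, so that their
  supports encode the triangle of integration. For two merely integrable kernels the product
  \<open>e (x - r) * w r\<close> is integrable only for almost every \<open>x\<close>;
  \<open>ew\<close> asks for it at every \<open>x\<close>, so that \<open>c\<close> can be pulled
  out of the inner integral.\<close>

lemma vconv_assoc:
  fixes c :: "real \<Rightarrow> 'b::{banach,second_countable_topology}"
  assumes e: "set_integrable lborel {0..t} e" and w: "set_integrable lborel {0..t} w" and c: "continuous_on {0..t} c"
    and ew: "\<And>x. 0 \<le> x \<Longrightarrow> x \<le> t \<Longrightarrow> set_integrable lborel {0..x} (\<lambda>r. e (x - r) * w r)"
  shows "vconv e (vconv w c) t = vconv (vconv e w) c t"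
proof -
  define e' where "e' x = indicator {0..t} x *\<^sub>R e x" for x
  define w' where "w' x = indicator {0..t} x *\<^sub>R w x" for x
  define c' where "c' x = indicator {0..t} x *\<^sub>R c x" for x
  have ie: "integrable lborel e'" using e unfolding e'_def set_integrable_def .
  have iw: "integrable lborel w'"
    using w unfolding w'_def set_integrable_def .
  have ic: "integrable lborel c'"
    using set_integrable_continuous_interval[OF c] unfolding c'_def set_integrable_def .
  have [measurable]: "e' \<in> borel_measurable borel" "w' \<in> borel_measurable borel" "c' \<in> borel_measurable borel"
    using ie iw ic by auto
  obtain B where B: "B \<ge> 0" "\<And>s. 0 \<le> s \<Longrightarrow> s \<le> t \<Longrightarrow> norm (c s) \<le> B"
    using bounded_on_interval[OF c] by metis
  have Bc: "norm (c' s) \<le> B" for s using B by (auto simp: c'_def indicator_def)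
  define K where "K r s = (e' (t - r) * w' (r - s)) *\<^sub>R c' s" for r s
  have [measurable]: "case_prod K \<in> borel_measurable (lborel \<Otimes>\<^sub>M lborel)"
    unfolding K_def by measurable
  have i1: "integrable lborel (\<lambda>x. e' (t - x))"
    using lborel_integrable_real_affine[OF ie, of "-1" t] by simp
  have i2': "integrable lborel (\<lambda>s. w' (r - s))" for r
    using lborel_integrable_real_affine[OF iw, of "-1" r] by simp
  have i2: "integrable lborel (\<lambda>s. w' (r - s) *\<^sub>R c' s)" for r
  proof (rule Bochner_Integration.integrable_bound)
    show "integrable lborel (\<lambda>s. B * norm (w' (r - s)))" using i2' by auto
    show "AE x in lborel. norm (w' (r - x) *\<^sub>R c' x) \<le> norm (B * norm (w' (r - x)))"
      using Bc B(1) by (auto simp: mult.commute[of B] intro!: mult_left_mono)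
  qed measurable
  have i3: "integrable lborel (K r)" for r
    using integrable_scaleR_right[OF i2[of r], of "e' (t - r)"] unfolding K_def by simp
  have iK: "integrable (lborel \<Otimes>\<^sub>M lborel) (case_prod K)"
  proof (rule lborel_pair.Fubini_integrable)
    show "AE x in lborel. integrable lborel (\<lambda>y. case (x, y) of (x, y) \<Rightarrow> K x y)" using i3 by simp
    show "integrable lborel (\<lambda>x. \<integral> y. norm (case (x, y) of (x, y) \<Rightarrow> K x y) \<partial>lborel)"
    proof (rule Bochner_Integration.integrable_bound)
      let ?I = "\<integral>y. norm (w' y) \<partial>lborel"
      have I: "(\<integral>s. norm (w' (r - s)) \<partial>lborel) = ?I" for r
        using lborel_integral_real_affine[of "-1" "\<lambda>y. norm (w' y)" r] by simp
      show "integrable lborel (\<lambda>x. \<bar>e' (t - x)\<bar> * (B * ?I))" using i1 by auto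
      show "AE x in lborel. norm (\<integral> y. norm (case (x, y) of (x, y) \<Rightarrow> K x y) \<partial>lborel) \<le> norm (\<bar>e' (t - x)\<bar> * (B * ?I))"
      proof (rule AE_I2)
        fix x
        have "(\<integral> y. norm (K x y) \<partial>lborel) \<le> (\<integral>y. (\<bar>e' (t - x)\<bar> * B) * norm (w' (x - y)) \<partial>lborel)"
          using i2'[of x] by (intro integral_mono integrable_norm i3 integrable_mult_right)
             (auto simp: K_def abs_mult mult.assoc mult.commute[of B] intro!: mult_left_mono Bc)
        then show "norm (\<integral> y. norm (case (x, y) of (x, y) \<Rightarrow> K x y) \<partial>lborel) \<le> norm (\<bar>e' (t - x)\<bar> * (B * ?I))"
          using B(1) I[of x] by (simp add: abs_mult mult.assoc)
      qed
    qed measurable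
  qed measurable
  have L: "vconv e (vconv w c) t = (\<integral>r. (\<integral>s. K r s \<partial>lborel) \<partial>lborel)"
    unfolding vconv_def[of e] set_lebesgue_integral_def
  proof (intro Bochner_Integration.integral_cong refl)
    fix r
    have "(\<integral>s. K r s \<partial>lborel) = e' (t - r) *\<^sub>R (\<integral>s. w' (r - s) *\<^sub>R c' s \<partial>lborel)"
      unfolding K_def scaleR_scaleR[symmetric] by (rule integral_scaleR_right)
    also have "\<dots> = indicator {0..t} r *\<^sub>R e (t - r) *\<^sub>R vconv w c r"
      unfolding vconv_def set_lebesgue_integral_def e'_def
      by (cases "r \<in> {0..t}")
         (auto simp: w'_def c'_def intro!: arg_cong[where f="(*\<^sub>R) (e (t-r))"] Bochner_Integration.integral_cong
            simp: indicator_def)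
    finally show "indicator {0..t} r *\<^sub>R e (t - r) *\<^sub>R vconv w c r = (\<integral>s. K r s \<partial>lborel)" ..
  qed
  have R: "vconv (vconv e w) c t = (\<integral>s. (\<integral>r. K r s \<partial>lborel) \<partial>lborel)"
    unfolding vconv_def[of "vconv e w"] set_lebesgue_integral_def
  proof (intro Bochner_Integration.integral_cong refl)
    fix s
    show "indicator {0..t} s *\<^sub>R vconv e w (t - s) *\<^sub>R c s = (\<integral>r. K r s \<partial>lborel)"
    proof (cases "s \<in> {0..t}")
      case True
      have eq: "(\<integral>r. e' (t - r) * w' (r - s) \<partial>lborel) = vconv e w (t - s)"
      proof -
        have "(\<integral>r. e' (t - r) * w' (r - s) \<partial>lborel) = \<bar>1\<bar> *\<^sub>R (\<integral>x. e' (t - (s + 1 * x)) * w' ((s + 1 * x) - s) \<partial>lborel)"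
          by (rule lborel_integral_real_affine) simp
        also have "\<dots> = vconv e w (t - s)"
          unfolding vconv_def set_lebesgue_integral_def using True
          by (auto simp: e'_def w'_def indicator_def algebra_simps intro!: Bochner_Integration.integral_cong)
        finally show ?thesis .
      qed
      have "integrable lborel (\<lambda>r. indicator {0..t - s} (-s + 1 * r) *\<^sub>R (e ((t - s) - (-s + 1 * r)) * w (-s + 1 * r)))"
        by (rule lborel_integrable_real_affine) (use ew[of "t - s"] True in \<open>auto simp: set_integrable_def\<close>)
      also have "(\<lambda>r. indicator {0..t - s} (-s + 1 * r) *\<^sub>R (e ((t - s) - (-s + 1 * r)) * w (-s + 1 * r)))
          = (\<lambda>r. e' (t - r) * w' (r - s))"
        using True by (auto simp: e'_def w'_def indicator_def fun_eq_iff)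
      finally have "integrable lborel (\<lambda>r. e' (t - r) * w' (r - s))" .
      then have "(\<integral>r. K r s \<partial>lborel) = (\<integral>r. e' (t - r) * w' (r - s) \<partial>lborel) *\<^sub>R c' s"
        unfolding K_def by (rule integral_scaleR_left)
      then show ?thesis using True eq by (simp add: c'_def)
    qed (auto simp: K_def c'_def)
  qed
  show ?thesis unfolding L R by (rule lborel_pair.Fubini_integral[OF iK, symmetric])
qed

text \<open>Both orders collapse to the same expression, which is how \<open>w\<close> is shifted
  from one function to another. Continuity of \<open>e\<close> provides the pointwise integrability
  that associativity asks for.\<close>

lemma vconv_left_commute:
  fixes c :: "real \<Rightarrow> 'b::{banach,second_countable_topology}"
  assumes w: "set_integrable lborel {0..t} w" and e: "continuous_on {0..t} e" and c: "continuous_on {0..t} c"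
  shows "vconv w (vconv e c) t = vconv (vconv w e) c t" "vconv e (vconv w c) t = vconv (vconv w e) c t"
proof -
  have i: "set_integrable lborel {0..x} (\<lambda>r. w (x - r) * e r)" if "0 \<le> x" "x \<le> t" for x
    using set_integrable_vconv[OF set_integrable_subset[OF w] continuous_on_subset[OF e], of x] that by simp
  show "vconv w (vconv e c) t = vconv (vconv w e) c t"
    by (rule vconv_assoc[OF w set_integrable_continuous_interval[OF e] c i])
  have "set_integrable lborel {0..x} (\<lambda>r. e (x - r) * w r)" if "0 \<le> x" "x \<le> t" for x
    using set_integrable_reflect[OF i[OF that]] by (simp add: mult.commute)
  then have "vconv e (vconv w c) t = vconv (vconv e w) c t"
    by (rule vconv_assoc[OF set_integrable_continuous_interval[OF e] w c])
  then show "vconv e (vconv w c) t = vconv (vconv w e) c t"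
    by (simp only: ext[of "vconv e w" "vconv w e", OF vconv_commute])
qed

lemma vconv_1:
  fixes h :: "real \<Rightarrow> 'b::euclidean_space"
  assumes "continuous_on {0..t} h"
  shows "vconv (\<lambda>_. 1) h t = integral {0..t} h"
  unfolding vconv_def using set_borel_integral_eq_integral(2)[OF set_integrable_continuous_interval[OF assms]] by simp

lemma vconv_1_has_derivative:
  fixes h :: "real \<Rightarrow> 'b::euclidean_space"
  assumes h: "continuous_on {0..T} h" and t: "0 < t" "t < T"
  shows "(vconv (\<lambda>_. 1) h has_vector_derivative h t) (at t)"
proof -
  have "((\<lambda>u. integral {0..u} h) has_vector_derivative h t) (at t within {0..T})"
    using t by (intro integral_has_vector_derivative[OF h]) auto
  then have "((\<lambda>u. integral {0..u} h) has_vector_derivative h t) (at t)"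
    using t by (simp add: at_within_Icc_at)
  then show ?thesis
  proof (rule has_vector_derivative_transform_within_open[where S="{0<..<T}"])
    show "integral {0..x} h = vconv (\<lambda>_. 1) h x" if "x \<in> {0<..<T}" for x
      using that by (intro vconv_1[symmetric] continuous_on_subset[OF h]) auto
  qed (use t in auto)
qed

text \<open>The primitive is constant, so its derivative \<open>h\<close> vanishes at positive
  times; the value at 0 follows from right continuity.\<close>

lemma vconv_1_eq_0_imp:
  fixes h :: "real \<Rightarrow> 'b::euclidean_space"
  assumes h: "continuous_on {0..} h" and z: "\<And>t. t \<ge> 0 \<Longrightarrow> vconv (\<lambda>_. 1) h t = 0" and "t \<ge> 0"
  shows "h t = 0"
proof -
  have pos: "h t = 0" if "t > 0" for t
  proof -
    have "(vconv (\<lambda>_. 1) h has_vector_derivative h t) (at t)"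
      using that by (intro vconv_1_has_derivative[where T="t+1"] continuous_on_subset[OF h]) auto
    moreover have "(vconv (\<lambda>_. 1) h has_vector_derivative 0) (at t)"
      by (rule has_vector_derivative_transform_within_open[where S="{0<..}" and f="\<lambda>_. 0"])
         (use that z in auto)
    ultimately show ?thesis by (rule vector_derivative_unique_at)
  qed
  have "h 0 = 0"
  proof (rule tendsto_unique)
    show "(h \<longlongrightarrow> h 0) (at_right 0)"
      using h by (auto simp: continuous_on_def intro: tendsto_within_subset)
    show "(h \<longlongrightarrow> 0) (at_right 0)"
      by (rule tendsto_eventually, rule eventually_at_rightI[of 0 1]) (auto simp: pos)
  qed simp
  with pos \<open>t \<ge> 0\<close> show ?thesis by (cases "t = 0") auto
qed

section \<open>Volterra equations of the second kind, with an exponential weight\<close>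

lemma exp_weight_small:
  assumes w: "set_integrable lborel {0..T} w" and "\<epsilon> > (0::real)"
  obtains \<sigma> where "\<sigma> \<ge> 0" "(LINT s:{0..T}|lborel. \<bar>exp (- \<sigma> * s) * w s\<bar>) < \<epsilon>"
proof -
  define W where "W x = indicator {0..T} x *\<^sub>R w x" for x
  have W: "integrable lborel W" using w unfolding W_def set_integrable_def .
  have [measurable]: "W \<in> borel_measurable borel" using W by auto
  \<comment> \<open>The weights tend to 0 off \<open>s = 0\<close> and the integrands are dominated
    by the unweighted kernel, so the weighted L1 norm becomes as small as desired.\<close>
  have "(\<lambda>n. \<integral>s. \<bar>exp (- real n * s) * W s\<bar> \<partial>lborel) \<longlonglongrightarrow> (\<integral>(s::real). 0 \<partial>lborel)"
  proof (rule integral_dominated_convergence[where w="\<lambda>s. \<bar>W s\<bar>"])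
    show "AE s in lborel. (\<lambda>n. \<bar>exp (- real n * s) * W s\<bar>) \<longlonglongrightarrow> 0"
      using AE_lborel_singleton[of 0]
    proof eventually_elim
      case (elim s)
      show ?case
      proof (cases "s > 0")
        case True
        have "(\<lambda>n. exp (-s) ^ n) \<longlonglongrightarrow> 0" using True by (intro LIMSEQ_realpow_zero) auto
        then have "(\<lambda>n. exp (- real n * s)) \<longlonglongrightarrow> 0" by (simp add: exp_of_nat_mult[symmetric] mult.commute)
        then show ?thesis by (simp add: abs_mult tendsto_mult_left_zero)
      qed (use elim in \<open>simp add: W_def\<close>)
    qed
    show "AE s in lborel. norm \<bar>exp (- real n * s) * W s\<bar> \<le> \<bar>W s\<bar>" for n
      by (auto simp: abs_mult W_def indicator_def intro!: mult_left_le_one_le)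
  qed (use W in auto)
  then have "\<forall>\<^sub>F n in sequentially. (\<integral>s. \<bar>exp (- real n * s) * W s\<bar> \<partial>lborel) < \<epsilon>"
    using \<open>\<epsilon> > 0\<close> by (intro order_tendstoD) auto
  then obtain n where n: "(\<integral>s. \<bar>exp (- real n * s) * W s\<bar> \<partial>lborel) < \<epsilon>"
    by (auto simp: eventually_sequentially)
  have "(LINT s:{0..T}|lborel. \<bar>exp (- real n * s) * w s\<bar>) = (\<integral>s. \<bar>exp (- real n * s) * W s\<bar> \<partial>lborel)"
    unfolding W_def set_lebesgue_integral_def
    by (intro Bochner_Integration.integral_cong) (auto simp: indicator_def)
  with n show ?thesis by (intro that[of "real n"]) auto
qed

text \<open>\<open>exp (- \<sigma> * (t - s))\<close> times \<open>exp (- \<sigma> * s)\<close> does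
  not depend on \<open>s\<close>. This serves both the weighted Volterra equations and the
  convolution theorem for Laplace transforms.\<close>

lemma vconv_exp_weight:
  "vconv (\<lambda>s. exp (- \<sigma> * s) * w s) (\<lambda>s. exp (- \<sigma> * s) *\<^sub>R v s) t = exp (- \<sigma> * t) *\<^sub>R vconv w v t"
proof -
  have "vconv (\<lambda>s. exp (- \<sigma> * s) * w s) (\<lambda>s. exp (- \<sigma> * s) *\<^sub>R v s) t
      = (\<integral>s. exp (- \<sigma> * t) *\<^sub>R (indicator {0..t} s *\<^sub>R (w (t - s) *\<^sub>R v s)) \<partial>lborel)"
    unfolding vconv_def set_lebesgue_integral_def
    by (rule Bochner_Integration.integral_cong)
       (auto simp: indicator_def mult_exp_exp algebra_simps)
  also have "\<dots> = exp (- \<sigma> * t) *\<^sub>R vconv w v t"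
    unfolding vconv_def set_lebesgue_integral_def by (rule integral_scaleR_right)
  finally show ?thesis .
qed

lemma set_integral_abs_mono_interval:
  assumes "set_integrable lborel {0..T} (k :: real \<Rightarrow> real)" "x \<le> T"
  shows "(LINT s:{0..x}|lborel. \<bar>k s\<bar>) \<le> (LINT s:{0..T}|lborel. \<bar>k s\<bar>)"
proof -
  have "set_integrable lborel {0..x} k"
    by (rule set_integrable_subset[OF assms(1)]) (use assms(2) in auto)
  then show ?thesis
    using set_integrable_abs[of lborel "{0..x}" k] set_integrable_abs[OF assms(1)] assms(2)
    unfolding set_lebesgue_integral_def set_integrable_def
    by (intro integral_mono) (auto simp: indicator_def)
qed

text \<open>Banach's fixed point theorem for \<open>q\<close> mapped to
  \<open>(h - w * q) / b\<close>, with contraction constant the L1 norm of \<open>w\<close> divided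
  by \<open>b\<close>.\<close>

lemma volterra_small_exists:
  fixes h :: "real \<Rightarrow> 'b::{banach,second_countable_topology}"
  assumes w: "set_integrable lborel {0..T} w" and h: "continuous_on {0..T} h" and "b > 0" "T \<ge> 0"
    and small: "(LINT s:{0..T}|lborel. \<bar>w s\<bar>) < b"
  obtains p where "continuous_on UNIV p" "\<And>t. 0 \<le> t \<Longrightarrow> t \<le> T \<Longrightarrow> b *\<^sub>R p t + vconv w p t = h t"
proof -
  \<comment> \<open>Clamping time to \<open>{0..T}\<close> extends everything to the whole line, so
    that the fixed point can be sought in the complete type of bounded continuous functions.\<close>
  define c where "c t = max 0 (min T t)" for t
  have cT: "c t \<in> {0..T}" for t using \<open>T \<ge> 0\<close> by (auto simp: c_def)
  have cc: "continuous_on UNIV c" unfolding c_def by (intro continuous_intros)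
  define F where "F q t = (1 / b) *\<^sub>R (h (c t) - vconv w q (c t))" for q :: "real \<Rightarrow> 'b" and t
  have Fb: "F q \<in> bcontfun" if q: "continuous_on UNIV q" for q
  proof -
    have g: "continuous_on {0..T} (\<lambda>t. h t - vconv w q t)"
      using q by (intro continuous_intros h continuous_on_vconv w) (auto intro: continuous_on_subset)
    obtain B where B: "\<And>s. 0 \<le> s \<Longrightarrow> s \<le> T \<Longrightarrow> norm (h s - vconv w q s) \<le> B"
      using bounded_on_interval[OF g] by metis
    show ?thesis
    proof (rule bcontfun_normI)
      show "continuous_on UNIV (F q)" unfolding F_def
        by (intro continuous_on_scaleR continuous_on_const continuous_on_compose2[OF g cc]) (use cT in auto)
      show "norm (F q t) \<le> (1 / b) * B" for t
        using B[of "c t"] cT[of t] \<open>b > 0\<close> by (simp add: F_def divide_right_mono)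
    qed
  qed
  define G where "G q = Bcontfun (F (apply_bcontfun q))" for q
  have G: "apply_bcontfun (G q) = F (apply_bcontfun q)" for q
    unfolding G_def by (rule Bcontfun_inverse[OF Fb]) simp
  define K where "K = (LINT s:{0..T}|lborel. \<bar>w s\<bar>) / b"
  have K: "0 \<le> K" "K < 1" using small \<open>b > 0\<close> unfolding K_def
    by (auto simp: set_lebesgue_integral_def)
  have "\<exists>!q. G q = q"
  proof (rule banach_fix_type[where c=K])
    show "\<forall>x y. dist (G x) (G y) \<le> K * dist x y"
    proof (intro allI dist_bound)
      fix x y :: "real \<Rightarrow>\<^sub>C 'b" and t :: real
      let ?x = "apply_bcontfun x" and ?y = "apply_bcontfun y"
      have wt: "set_integrable lborel {0..c t} w" using w by (rule set_integrable_subset) (use cT[of t] in auto)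
      have "dist (F ?x t) (F ?y t) = (1 / b) * norm (vconv w (\<lambda>s. ?y s - ?x s) (c t))"
        using \<open>b > 0\<close> by (simp add: F_def dist_norm vconv_diff[OF wt] scaleR_diff_right[symmetric])
      also have "norm (vconv w (\<lambda>s. ?y s - ?x s) (c t)) \<le> dist x y * (LINT s:{0..c t}|lborel. \<bar>w s\<bar>)"
        by (rule vconv_norm_le[OF wt])
           (auto intro!: continuous_intros simp: dist_norm[symmetric] dist_commute[of "?y _"] dist_bounded)
      also have "(LINT s:{0..c t}|lborel. \<bar>w s\<bar>) \<le> (LINT s:{0..T}|lborel. \<bar>w s\<bar>)"
        by (rule set_integral_abs_mono_interval[OF w]) (use cT[of t] in auto)
      finally have "dist (F ?x t) (F ?y t) \<le> 1 / b * (dist x y * (LINT s:{0..T}|lborel. \<bar>w s\<bar>))"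
        using \<open>b > 0\<close> by (simp add: mult_left_mono divide_right_mono)
      then show "dist (apply_bcontfun (G x) t) (apply_bcontfun (G y) t) \<le> K * dist x y"
        unfolding G K_def by (simp add: mult.commute)
    qed
  qed (use K in auto)
  then obtain q where q: "G q = q" by auto
  let ?q = "apply_bcontfun q"
  have "?q t = F ?q t" for t using G[of q] q by simp
  moreover have "c t = t" if "0 \<le> t" "t \<le> T" for t using that by (auto simp: c_def)
  ultimately have qe: "?q t = (1 / b) *\<^sub>R (h t - vconv w ?q t)" if "0 \<le> t" "t \<le> T" for t
    using that unfolding F_def by simp
  then have "b *\<^sub>R ?q t = h t - vconv w ?q t" if "0 \<le> t" "t \<le> T" for t
  proof -
    have "b *\<^sub>R ?q t = b *\<^sub>R (1 / b) *\<^sub>R (h t - vconv w ?q t)"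
      using qe[OF that] by (rule arg_cong)
    then show ?thesis using \<open>b > 0\<close> by simp
  qed
  then show ?thesis by (intro that[of ?q]) auto
qed

text \<open>The exponential weight makes the kernel small on all of \<open>{0..T}\<close> at once,
  so the solution need not be continued from short intervals to longer ones.\<close>

lemma volterra_exists:
  fixes h :: "real \<Rightarrow> 'b::{banach,second_countable_topology}"
  assumes w: "set_integrable lborel {0..T} w" and h: "continuous_on {0..T} h" and "b > 0" "T \<ge> 0"
  obtains p where "continuous_on UNIV p" "\<And>t. 0 \<le> t \<Longrightarrow> t \<le> T \<Longrightarrow> b *\<^sub>R p t + vconv w p t = h t"
proof -
  obtain \<sigma> where \<sigma>: "\<sigma> \<ge> 0" "(LINT s:{0..T}|lborel. \<bar>exp (- \<sigma> * s) * w s\<bar>) < b"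
    using exp_weight_small[OF w \<open>b > 0\<close>] by blast
  have we: "set_integrable lborel {0..T} (\<lambda>s. exp (- \<sigma> * s) * w s)"
    using set_integrable_bounded_scaleR[OF w continuous_on_imp_set_borel_measurable, of "\<lambda>s. exp (- \<sigma> * s)" 1] \<sigma>(1)
    by (simp add: mult.commute[of "w _"] continuous_intros)
  have "continuous_on {0..T} (\<lambda>s. exp (- \<sigma> * s) *\<^sub>R h s)" by (intro continuous_intros h)
  then obtain q where q: "continuous_on UNIV q"
    "\<And>t. 0 \<le> t \<Longrightarrow> t \<le> T \<Longrightarrow> b *\<^sub>R q t + vconv (\<lambda>s. exp (- \<sigma> * s) * w s) q t = exp (- \<sigma> * t) *\<^sub>R h t"
    by (rule volterra_small_exists[OF we _ \<open>b > 0\<close> \<open>T \<ge> 0\<close> \<sigma>(2)]) blast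
  define p where "p t = exp (\<sigma> * t) *\<^sub>R q t" for t
  have qp: "q = (\<lambda>t. exp (- \<sigma> * t) *\<^sub>R p t)" by (auto simp: p_def mult_exp_exp)
  show ?thesis
  proof (rule that)
    show "continuous_on UNIV p" unfolding p_def by (intro continuous_intros q)
    fix t assume t: "0 \<le> t" "t \<le> T"
    have "exp (- \<sigma> * t) *\<^sub>R (b *\<^sub>R p t + vconv w p t) = exp (- \<sigma> * t) *\<^sub>R h t"
      using q(2)[OF t] vconv_exp_weight[of \<sigma> w p t] unfolding qp by (simp add: scaleR_add_right mult.commute)
    then show "b *\<^sub>R p t + vconv w p t = h t" by simp
  qed
qed

text \<open>At a point where the weighted solution \<open>q\<close> has maximal norm, the equation
  bounds \<open>b\<close> times this norm by the norm times a number smaller than \<open>b\<close>;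
  the maximum is therefore 0.\<close>

lemma volterra_unique:
  fixes v :: "real \<Rightarrow> 'b::{banach,second_countable_topology}"
  assumes w: "set_integrable lborel {0..T} w" and v: "continuous_on {0..T} v" and "b > 0"
    and eq: "\<And>t. 0 \<le> t \<Longrightarrow> t \<le> T \<Longrightarrow> b *\<^sub>R v t + vconv w v t = 0"
    and t: "0 \<le> t" "t \<le> T"
  shows "v t = 0"
proof -
  obtain \<sigma> where \<sigma>: "\<sigma> \<ge> 0" "(LINT s:{0..T}|lborel. \<bar>exp (- \<sigma> * s) * w s\<bar>) < b"
    using exp_weight_small[OF w \<open>b > 0\<close>] by blast
  define k where "k s = exp (- \<sigma> * s) * w s" for s
  define q where "q s = exp (- \<sigma> * s) *\<^sub>R v s" for s
  have k: "set_integrable lborel {0..T} k"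
    using set_integrable_bounded_scaleR[OF w continuous_on_imp_set_borel_measurable, of "\<lambda>s. exp (- \<sigma> * s)" 1] \<sigma>(1)
    by (simp add: k_def[abs_def] mult.commute[of "w _"] continuous_intros)
  have q: "continuous_on {0..T} q" unfolding q_def by (intro continuous_intros v)
  have qeq: "b *\<^sub>R q t = - vconv k q t" if "0 \<le> t" "t \<le> T" for t
  proof -
    have "b *\<^sub>R q t + vconv k q t = exp (- \<sigma> * t) *\<^sub>R (b *\<^sub>R v t + vconv w v t)"
      using vconv_exp_weight[of \<sigma> w v t] unfolding k_def q_def by (simp add: scaleR_add_right mult.commute)
    then show ?thesis using eq[OF that] by (simp add: eq_neg_iff_add_eq_0)
  qed
  have "{0..T} \<noteq> {}" using t by auto
  then obtain x where x: "x \<in> {0..T}" "\<And>y. y \<in> {0..T} \<Longrightarrow> norm (q y) \<le> norm (q x)"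
    using continuous_attains_sup[OF compact_Icc _ continuous_on_norm[OF q]] by blast
  have kx: "set_integrable lborel {0..x} k" using k by (rule set_integrable_subset) (use x in auto)
  have "b * norm (q x) = norm (vconv k q x)" using qeq[of x] x(1) \<open>b > 0\<close>
    by (metis abs_of_pos atLeastAtMost_iff norm_minus_cancel norm_scaleR)
  also have "\<dots> \<le> norm (q x) * (LINT s:{0..x}|lborel. \<bar>k s\<bar>)"
    by (rule vconv_norm_le[OF kx]) (use x in \<open>auto intro: continuous_on_subset[OF q]\<close>)
  also have "\<dots> \<le> norm (q x) * (LINT s:{0..T}|lborel. \<bar>k s\<bar>)"
    by (intro mult_left_mono set_integral_abs_mono_interval[OF k]) (use x in auto)
  finally have "norm (q x) * (b - (LINT s:{0..T}|lborel. \<bar>k s\<bar>)) \<le> 0" by (simp add: algebra_simps)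
  moreover have "b - (LINT s:{0..T}|lborel. \<bar>k s\<bar>) > 0" using \<sigma>(2) unfolding k_def by simp
  ultimately have "norm (q x) \<le> 0" by (simp add: mult_le_0_iff)
  then have "q t = 0" using x(2)[of t] t by auto
  then show ?thesis by (simp add: q_def)
qed

text \<open>The candidate derivative \<open>p\<close> is obtained from the equation \<open>b p + w * p = h\<close>; its primitive solves
  the equation of \<open>v\<close> and hence equals \<open>v\<close>.\<close>

lemma volterra_differentiable:
  fixes v :: "real \<Rightarrow> 'b::euclidean_space"
  assumes w: "\<And>T. set_integrable lborel {0..T} w" and v: "continuous_on {0..} v" and h: "continuous_on {0..} h"
    and "b > 0"
    and eq: "\<And>t. 0 \<le> t \<Longrightarrow> vconv w v t + b *\<^sub>R v t = vconv (\<lambda>_. 1) h t"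
    and t: "t > 0"
  shows "v differentiable (at t)"
proof -
  \<comment> \<open>One unit beyond \<open>t\<close>, so that \<open>t\<close> is interior and the
    derivative is two-sided.\<close>
  define T where "T = t + 1"
  have [simp]: "T \<ge> 0" "{0..T} \<subseteq> {0..}" using t by (auto simp: T_def)
  have vT: "continuous_on {0..T} v" and hT: "continuous_on {0..T} h"
    using v h by (auto intro: continuous_on_subset)
  obtain p where p: "continuous_on UNIV p" "\<And>t. 0 \<le> t \<Longrightarrow> t \<le> T \<Longrightarrow> b *\<^sub>R p t + vconv w p t = h t"
    using volterra_exists[OF w hT \<open>b > 0\<close>] by auto
  have pT: "continuous_on {0..s} p" for s using p(1) by (rule continuous_on_subset) auto
  define V where "V = vconv (\<lambda>_. 1) p"
  have VT: "continuous_on {0..T} V" unfolding V_def by (rule continuous_on_vconv[OF set_integrable_const_1 pT])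
  have vV: "v s - V s = 0" if "0 \<le> s" "s \<le> T" for s
  proof (rule volterra_unique[OF w[of T] _ \<open>b > 0\<close>, of "\<lambda>s. v s - V s"])
    show "continuous_on {0..T} (\<lambda>s. v s - V s)" by (intro continuous_intros vT VT)
    fix r assume r: "0 \<le> r" "r \<le> T"
    have sub: "continuous_on {0..r} v" "continuous_on {0..r} V" "continuous_on {0..r} h"
      using vT VT hT r by (auto intro: continuous_on_subset)
    have wV: "vconv w V r = vconv (\<lambda>_. 1) (vconv w p) r"
      unfolding V_def using vconv_left_commute[OF w _ pT, of r "\<lambda>_. 1"] by simp
    have "vconv (\<lambda>_. 1) (\<lambda>s. b *\<^sub>R p s + vconv w p s) r = vconv (\<lambda>_. 1) h r"
      by (rule vconv_cong) (use p(2) r in auto)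
    also have "vconv (\<lambda>_. 1) (\<lambda>s. b *\<^sub>R p s + vconv w p s) r = b *\<^sub>R V r + vconv (\<lambda>_. 1) (vconv w p) r"
      unfolding V_def
      by (subst vconv_add[OF set_integrable_const_1])
         (auto intro!: continuous_intros pT continuous_on_vconv[OF w] vconv_linear[OF bounded_linear_scaleR_right set_integrable_const_1])
    finally have "b *\<^sub>R V r = vconv (\<lambda>_. 1) h r - vconv (\<lambda>_. 1) (vconv w p) r"
      by (simp add: eq_diff_eq)
    moreover have "b *\<^sub>R v r = vconv (\<lambda>_. 1) h r - vconv w v r"
      using eq[OF r(1)] by (simp add: eq_diff_eq add.commute)
    ultimately show "b *\<^sub>R (v r - V r) + vconv w (\<lambda>s. v s - V s) r = 0"
      using wV vconv_diff[OF w sub(1,2)] by (simp add: scaleR_diff_right)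
  qed (use that in auto)
  have "(V has_vector_derivative p t) (at t)"
    unfolding V_def by (rule vconv_1_has_derivative[OF pT[of T]]) (use t in \<open>auto simp: T_def\<close>)
  then have "(v has_vector_derivative p t) (at t)"
    by (rule has_vector_derivative_transform_within_open[where S="{0<..<T}"])
       (use t vV in \<open>auto simp: T_def\<close>)
  then show ?thesis by (rule differentiableI_vector)
qed

section \<open>Laplace transforms and uniqueness for the relaxation equation\<close>

text \<open>The weighted convolution is the convolution of the weighted functions. These are
  integrable, so Fubini and translation invariance factor the integral.\<close>

lemma laplace_vconv:
  fixes w v :: "real \<Rightarrow> real"
  assumes w: "set_integrable lborel {0..} (\<lambda>t. exp (- \<theta> * t) * w t)"
    and v: "set_integrable lborel {0..} (\<lambda>t. exp (- \<theta> * t) * v t)"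
  shows "set_integrable lborel {0..} (\<lambda>t. exp (- \<theta> * t) * vconv w v t)"
    and "(LINT t:{0..}|lborel. exp (- \<theta> * t) * vconv w v t) =
      (LINT t:{0..}|lborel. exp (- \<theta> * t) * w t) * (LINT t:{0..}|lborel. exp (- \<theta> * t) * v t)"
proof -
  define w' where "w' x = indicator {0..} x *\<^sub>R (exp (- \<theta> * x) * w x)" for x
  define v' where "v' x = indicator {0..} x *\<^sub>R (exp (- \<theta> * x) * v x)" for x
  have iw: "integrable lborel w'" using w unfolding w'_def set_integrable_def .
  have iv: "integrable lborel v'" using v unfolding v'_def set_integrable_def .
  have [measurable]: "w' \<in> borel_measurable borel" "v' \<in> borel_measurable borel" using iw iv by auto
  define K where "K s t = w' (t - s) * v' s" for s t
  have [measurable]: "case_prod K \<in> borel_measurable (lborel \<Otimes>\<^sub>M lborel)"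
    unfolding K_def by measurable
  have ws: "integrable lborel (\<lambda>t. w' (t - s))" for s
    using lborel_integrable_real_affine[OF iw, of 1 "-s"] by simp
  have wsi: "(\<integral>t. w' (t - s) \<partial>lborel) = (\<integral>t. w' t \<partial>lborel)" for s
    using lborel_integral_real_affine[of 1 w' "-s"] by simp
  have wsn: "(\<integral>t. \<bar>w' (t - s)\<bar> \<partial>lborel) = (\<integral>t. \<bar>w' t\<bar> \<partial>lborel)" for s
    using lborel_integral_real_affine[of 1 "\<lambda>t. \<bar>w' t\<bar>" "-s"] by simp
  have iK: "integrable (lborel \<Otimes>\<^sub>M lborel) (case_prod K)"
  proof (rule lborel_pair.Fubini_integrable)
    show "AE x in lborel. integrable lborel (\<lambda>y. case (x, y) of (x, y) \<Rightarrow> K x y)"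
      using ws by (simp add: K_def)
    show "integrable lborel (\<lambda>x. \<integral> y. norm (case (x, y) of (x, y) \<Rightarrow> K x y) \<partial>lborel)"
      using iv by (simp add: K_def abs_mult wsn)
  qed measurable
  have eq: "(\<integral>s. K s t \<partial>lborel) = indicator {0..} t *\<^sub>R (exp (- \<theta> * t) * vconv w v t)" for t
  proof (cases "t \<ge> 0")
    case True
    have "(\<integral>s. K s t \<partial>lborel) = vconv (\<lambda>s. exp (- \<theta> * s) * w s) (\<lambda>s. exp (- \<theta> * s) *\<^sub>R v s) t"
      unfolding vconv_def set_lebesgue_integral_def K_def
      by (rule Bochner_Integration.integral_cong) (auto simp: w'_def v'_def indicator_def)
    then show ?thesis using True unfolding vconv_exp_weight by simp
  next
    case False
    then have "K s t = 0" for s by (auto simp: K_def w'_def v'_def indicator_def)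
    then show ?thesis using False by simp
  qed
  show "set_integrable lborel {0..} (\<lambda>t. exp (- \<theta> * t) * vconv w v t)"
    using lborel_pair.integrable_snd[OF iK] unfolding eq set_integrable_def .
  have "(LINT t:{0..}|lborel. exp (- \<theta> * t) * vconv w v t) = (\<integral>t. (\<integral>s. K s t \<partial>lborel) \<partial>lborel)"
    unfolding eq set_lebesgue_integral_def ..
  also have "\<dots> = (\<integral>s. (\<integral>t. K s t \<partial>lborel) \<partial>lborel)" by (rule lborel_pair.Fubini_integral[OF iK])
  also have "\<dots> = (\<integral>t. w' t \<partial>lborel) * (\<integral>t. v' t \<partial>lborel)" by (simp add: K_def wsi)
  finally show "(LINT t:{0..}|lborel. exp (- \<theta> * t) * vconv w v t) =
      (LINT t:{0..}|lborel. exp (- \<theta> * t) * w t) * (LINT t:{0..}|lborel. exp (- \<theta> * t) * v t)"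
    unfolding w'_def v'_def set_lebesgue_integral_def .
qed

text \<open>Polynomials in \<open>exp (-t)\<close> approximate \<open>F\<close> on compact sets, so that \<open>F\<close> is orthogonal to
  a cut-off of itself.\<close>

lemma laplace_transform_eq_0_imp:
  fixes F :: "real \<Rightarrow> real"
  assumes F: "continuous_on {0..} F"
    and int: "\<And>\<theta>. \<theta> > 0 \<Longrightarrow> set_integrable lborel {0..} (\<lambda>t. exp (- \<theta> * t) * F t)"
    and zero: "\<And>\<theta>. \<theta> > 0 \<Longrightarrow> (LINT t:{0..}|lborel. exp (- \<theta> * t) * F t) = 0"
    and "r \<ge> 0"
  shows "F r = 0"
proof -
  \<comment> \<open>The weight for \<open>\<theta> = 1\<close> makes \<open>F\<close> integrable;
    for \<open>\<theta> = 1 + n\<close> the remaining factor is the monomial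
    \<open>exp (-t) ^ n\<close>.\<close>
  define G where "G t = indicator {0..} t *\<^sub>R (exp (- 1 * t) * F t)" for t
  have G: "integrable lborel G" using int[of 1] unfolding G_def set_integrable_def by simp
  have eqn: "exp (-t) ^ n * G t = indicator {0..} t *\<^sub>R (exp (- (1 + real n) * t) * F t)" for n :: nat and t
  proof -
    have "exp (-t) ^ n * exp (- 1 * t) = exp (- (1 + real n) * t)"
      by (simp add: exp_of_nat_mult[symmetric] mult_exp_exp algebra_simps)
    then show ?thesis by (simp add: G_def mult.assoc[symmetric])
  qed
  have Gn: "integrable lborel (\<lambda>t. exp (-t) ^ n * G t)" "(\<integral>t. exp (-t) ^ n * G t \<partial>lborel) = 0" for n :: nat
    using int[of "1 + real n"] zero[of "1 + real n"] unfolding eqn set_integrable_def set_lebesgue_integral_def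
    by auto
  \<comment> \<open>A cut-off that is 1 up to \<open>r\<close> and falls linearly to 0 at
    \<open>r + 1\<close>, multiplied by \<open>F\<close>.\<close>
  define \<psi> where "\<psi> t = max 0 (min 1 (r + 1 - t)) * F (max 0 t)" for t
  have \<psi>: "continuous_on UNIV \<psi>" unfolding \<psi>_def
    by (intro continuous_intros continuous_on_compose2[OF F]) auto
  \<comment> \<open>This is \<open>\<psi>\<close> in the variable \<open>x = exp (-t)\<close>.
    Truncating \<open>x\<close> from below keeps the logarithm finite and changes nothing, since
    \<open>\<psi>\<close> vanishes from \<open>r + 1\<close> on.\<close>
  define \<phi> where "\<phi> x = \<psi> (- ln (max x (exp (- (r + 1)))))" for x
  have pos: "max x (exp (- (r + 1))) > 0" for x :: real by (simp add: less_max_iff_disj)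
  have \<phi>: "continuous_on {0..1} \<phi>" unfolding \<phi>_def
    by (rule continuous_on_compose2[OF \<psi>])
       (use pos in \<open>auto intro!: continuous_intros simp del: exp_minus simp: less_le\<close>)
  have \<phi>\<psi>: "\<phi> (exp (-t)) = \<psi> t" for t
  proof (cases "t \<le> r + 1")
    case True
    then have "max (exp (-t)) (exp (- (r + 1))) = exp (-t)" by (simp add: max_def)
    then show ?thesis by (simp add: \<phi>_def)
  next
    case False
    then have "max (exp (-t)) (exp (- (r + 1))) = exp (- (r + 1))" by (simp add: max_def)
    then show ?thesis using False \<open>r \<ge> 0\<close> by (simp add: \<phi>_def \<psi>_def)
  qed
  obtain B where B: "B \<ge> 0" "\<And>s. 0 \<le> s \<Longrightarrow> s \<le> 1 \<Longrightarrow> norm (\<phi> s) \<le> B"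
    using bounded_on_interval[OF \<phi>] by metis
  have [measurable]: "\<psi> \<in> borel_measurable borel" by (rule borel_measurable_continuous_onI[OF \<psi>])
  have [measurable]: "G \<in> borel_measurable borel" using G by auto
  have \<psi>G: "integrable lborel (\<lambda>t. \<psi> t * G t)"
  proof (rule Bochner_Integration.integrable_bound)
    show "integrable lborel (\<lambda>t. B * norm (G t))" using G by auto
    have "\<bar>\<psi> t * G t\<bar> \<le> B * \<bar>G t\<bar>" for t
      using B(2)[of "exp (-t)"] \<phi>\<psi>[of t]
      by (cases "t \<ge> 0") (auto simp: abs_mult G_def intro!: mult_right_mono)
    then show "AE t in lborel. norm (\<psi> t * G t) \<le> norm (B * norm (G t))"
      using B(1) by (auto simp: abs_mult)
  qed measurable
  have small: "\<bar>\<integral>t. \<psi> t * G t \<partial>lborel\<bar> \<le> e * (\<integral>t. norm (G t) \<partial>lborel)" if "e > 0" for e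
  proof -
    obtain p where p: "real_polynomial_function p" "\<And>x. x \<in> {0..1} \<Longrightarrow> \<bar>\<phi> x - p x\<bar> < e"
      using Stone_Weierstrass_real_polynomial_function[OF compact_Icc \<phi> \<open>e > 0\<close>] by auto
    then obtain a n where p': "p = (\<lambda>x. \<Sum>i\<le>n. a i * x ^ i)"
      by (auto simp: real_polynomial_function_iff_sum)
    have pG: "integrable lborel (\<lambda>t. p (exp (-t)) * G t)" "(\<integral>t. p (exp (-t)) * G t \<partial>lborel) = 0"
      using Gn unfolding p' by (simp_all add: sum_distrib_right mult.assoc)
    have "(\<integral>t. \<psi> t * G t \<partial>lborel) = (\<integral>t. (\<psi> t - p (exp (-t))) * G t \<partial>lborel)"
      using pG \<psi>G by (simp add: left_diff_distrib)
    also have "\<bar>\<dots>\<bar> \<le> (\<integral>t. norm ((\<psi> t - p (exp (-t))) * G t) \<partial>lborel)"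
      using integral_norm_bound[of lborel "\<lambda>t. (\<psi> t - p (exp (-t))) * G t"] by simp
    also have "\<dots> \<le> (\<integral>t. e * norm (G t) \<partial>lborel)"
    proof (rule integral_mono)
      show "integrable lborel (\<lambda>t. norm ((\<psi> t - p (exp (-t))) * G t))"
        using Bochner_Integration.integrable_diff[OF \<psi>G pG(1)] by (simp add: left_diff_distrib)
      show "integrable lborel (\<lambda>t. e * norm (G t))" using G by auto
      show "norm ((\<psi> t - p (exp (-t))) * G t) \<le> e * norm (G t)" for t
        using p(2)[of "exp (-t)"] \<phi>\<psi>[of t]
        by (cases "t \<ge> 0") (auto simp: abs_mult G_def intro!: mult_right_mono)
    qed
    finally show ?thesis by simp
  qed
  have z: "(\<integral>t. \<psi> t * G t \<partial>lborel) = 0"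
  proof (rule ccontr)
    assume n: "(\<integral>t. \<psi> t * G t \<partial>lborel) \<noteq> 0"
    define I where "I = (\<integral>t. norm (G t) \<partial>lborel)"
    have "I \<ge> 0" unfolding I_def by simp
    define X where "X = \<bar>\<integral>t. \<psi> t * G t \<partial>lborel\<bar>"
    have "X > 0" using n unfolding X_def by simp
    then have "X \<le> X / (2 * (I + 1)) * I"
      using small[of "X / (2 * (I + 1))"] \<open>I \<ge> 0\<close> unfolding I_def[symmetric] X_def[symmetric] by simp
    then have "X * (I + 2) \<le> 0" using \<open>I \<ge> 0\<close> by (simp add: field_simps)
    then show False using \<open>X > 0\<close> \<open>I \<ge> 0\<close> by (simp add: mult_le_0_iff)
  qed
  \<comment> \<open>The cut-off times \<open>exp (-t)\<close> times the square of \<open>F\<close>: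
    continuous, nonnegative and of integral 0, hence zero. At \<open>r\<close> the cut-off equals
    1.\<close>
  define f where "f t = \<psi> t * (exp (-t) * F t)" for t
  have f: "continuous_on {0..r + 1} f" unfolding f_def
    by (intro continuous_intros continuous_on_subset[OF \<psi>] continuous_on_subset[OF F]) auto
  have fpos: "f t \<ge> 0" if "t \<in> {0..r + 1}" for t
    using that by (simp add: f_def \<psi>_def mult.assoc mult.left_commute[of "F t"])
  have "integral {0..r + 1} f = (LINT t:{0..r + 1}|lborel. f t)"
    using set_borel_integral_eq_integral(2)[OF set_integrable_continuous_interval[OF f]] by simp
  also have "\<dots> = (\<integral>t. \<psi> t * G t \<partial>lborel)" unfolding set_lebesgue_integral_def
    by (rule Bochner_Integration.integral_cong) (auto simp: f_def G_def indicator_def \<psi>_def)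
  finally have "integral {0..r + 1} f = 0" using z by simp
  then have "f r = 0"
    using integral_eq_0_iff[OF f] fpos \<open>r \<ge> 0\<close> by auto
  then show ?thesis using \<open>r \<ge> 0\<close> by (simp add: f_def \<psi>_def)
qed

section \<open>Uniqueness by convolution with a family of relaxation functions\<close>

lemma vconv_add_left:
  fixes c :: "real \<Rightarrow> 'b::{banach,second_countable_topology}"
  assumes "continuous_on {0..t} c" "set_integrable lborel {0..t} w" "set_integrable lborel {0..t} w'"
  shows "vconv (\<lambda>s. w s + w' s) c t = vconv w c t + vconv w' c t"
  unfolding vconv_def scaleR_add_left
  by (intro set_integral_add set_integrable_vconv assms)

lemma vconv_scale_left: "vconv (\<lambda>s. a * w s) c t = a *\<^sub>R vconv w c t"
  unfolding vconv_def set_lebesgue_integral_def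
  by (subst integral_scaleR_right[symmetric]) (simp add: mult.commute mult.left_commute)

lemma vconv_scale: "vconv w (\<lambda>s. a *\<^sub>R c s) t = a *\<^sub>R vconv w c t"
  unfolding vconv_def set_lebesgue_integral_def
  by (subst integral_scaleR_right[symmetric]) (simp add: mult.commute mult.left_commute)

text \<open>The family \<open>D\<close> is abstract, which separates the argument from probability.
  \<open>Dlim\<close> concerns positive times only, as a single instant is negligible under the
  integral.\<close>

lemma relaxation_unique:
  fixes c :: "real \<Rightarrow> 'b::euclidean_space"
  assumes w: "\<And>T. set_integrable lborel {0..T} w"
    and D: "\<And>\<mu>. \<mu> > 0 \<Longrightarrow> continuous_on {0..} (D \<mu>)"
    and D1: "\<And>\<mu> t. \<mu> > 0 \<Longrightarrow> t \<ge> 0 \<Longrightarrow> \<bar>D \<mu> t\<bar> \<le> 1"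
    and Dlim: "\<And>t. t > 0 \<Longrightarrow> (\<lambda>n. D (1 / real (Suc n)) t) \<longlonglongrightarrow> 1"
    and Deq: "\<And>\<mu> t. \<mu> > 0 \<Longrightarrow> t \<ge> 0 \<Longrightarrow>
       vconv w (\<lambda>s. 1 - D \<mu> s) t + b * (1 - D \<mu> t) = \<mu> * vconv (\<lambda>_. 1) (D \<mu>) t"
    and c: "continuous_on {0..} c" and "l \<ge> 0"
    and ceq: "\<And>t. t \<ge> 0 \<Longrightarrow> vconv w c t + b *\<^sub>R c t = - l *\<^sub>R vconv (\<lambda>_. 1) c t"
    and "t \<ge> 0"
  shows "c t = 0"
proof -
  have cT: "continuous_on {0..T} c" for T using c by (rule continuous_on_subset) auto
  have DT: "continuous_on {0..T} (D \<mu>)" if "\<mu> > 0" for T \<mu> using D[OF that] by (rule continuous_on_subset) auto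
  have si: "set_integrable lborel {0..T} e" if "continuous_on {0..T} e" for e :: "real \<Rightarrow> real" and T
    using that by (rule set_integrable_continuous_interval)
  \<comment> \<open>Proved after one more integration in time, because the relaxation equation and
    the equation of \<open>c\<close> both carry a convolution with the constant 1;
    \<open>vconv_1_eq_0_imp\<close> then strips it off.\<close>
  have key: "l *\<^sub>R vconv (\<lambda>s. 1 - D \<mu> s) c t + \<mu> *\<^sub>R vconv (D \<mu>) c t = 0" if \<mu>: "\<mu> > 0" and "t \<ge> 0" for \<mu> t
  proof -
    define e where "e s = 1 - D \<mu> s" for s
    have eT: "continuous_on {0..T} e" for T unfolding e_def using DT[OF \<mu>] by (intro continuous_intros)
    have cont: "continuous_on {0..T} (\<lambda>t. l *\<^sub>R vconv e c t + \<mu> *\<^sub>R vconv (D \<mu>) c t)" for T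
      by (intro continuous_intros continuous_on_vconv si eT DT \<mu> cT)
    show ?thesis unfolding e_def[symmetric]
    proof (rule vconv_1_eq_0_imp[of "\<lambda>t. l *\<^sub>R vconv e c t + \<mu> *\<^sub>R vconv (D \<mu>) c t"])
      show "continuous_on {0..} (\<lambda>t. l *\<^sub>R vconv e c t + \<mu> *\<^sub>R vconv (D \<mu>) c t)"
        by (rule continuous_on_halfline[OF cont])
      fix t :: real assume "t \<ge> 0"
      have "vconv e (\<lambda>s. vconv w c s + b *\<^sub>R c s) t = vconv e (vconv w c) t + b *\<^sub>R vconv e c t"
        using vconv_add[OF si[OF eT] continuous_on_vconv[OF w cT] continuous_on_scaleR[OF continuous_on_const cT]]
        by (simp add: vconv_scale)
      also have "vconv e (vconv w c) t = vconv (vconv w e) c t"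
        by (rule vconv_left_commute[OF w eT cT])
      also have "vconv (vconv w e) c t + b *\<^sub>R vconv e c t = vconv (\<lambda>s. vconv w e s + b * e s) c t"
        by (subst vconv_add_left[OF cT])
           (auto intro!: si continuous_intros continuous_on_vconv[OF w] eT simp: vconv_scale_left)
      also have "\<dots> = vconv (\<lambda>s. \<mu> * vconv (\<lambda>_. 1) (D \<mu>) s) c t"
        by (rule vconv_cong) (use Deq[OF \<mu>] in \<open>auto simp: e_def[abs_def]\<close>)
      also have "\<dots> = \<mu> *\<^sub>R vconv (\<lambda>_. 1) (vconv (D \<mu>) c) t"
        unfolding vconv_scale_left vconv_left_commute(1)[OF set_integrable_const_1 DT[OF \<mu>] cT] ..
      finally have 1: "vconv e (\<lambda>s. vconv w c s + b *\<^sub>R c s) t = \<mu> *\<^sub>R vconv (\<lambda>_. 1) (vconv (D \<mu>) c) t" .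
      have "vconv e (\<lambda>s. vconv w c s + b *\<^sub>R c s) t = vconv e (\<lambda>s. (- l) *\<^sub>R vconv (\<lambda>_. 1) c s) t"
        by (rule vconv_cong) (use ceq in auto)
      also have "\<dots> = (- l) *\<^sub>R vconv (\<lambda>_. 1) (vconv e c) t"
        unfolding vconv_scale vconv_left_commute[OF set_integrable_const_1 eT cT] ..
      finally have 2: "vconv e (\<lambda>s. vconv w c s + b *\<^sub>R c s) t = (- l) *\<^sub>R vconv (\<lambda>_. 1) (vconv e c) t" .
      have "vconv (\<lambda>_. 1) (\<lambda>t. l *\<^sub>R vconv e c t + \<mu> *\<^sub>R vconv (D \<mu>) c t) t
        = l *\<^sub>R vconv (\<lambda>_. 1) (vconv e c) t + \<mu> *\<^sub>R vconv (\<lambda>_. 1) (vconv (D \<mu>) c) t"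
        by (subst vconv_add[OF set_integrable_const_1])
           (auto intro!: continuous_intros continuous_on_vconv si eT DT \<mu> cT simp: vconv_scale)
      also have "\<dots> = 0" unfolding 1[symmetric] 2 by simp
      finally show "vconv (\<lambda>_. 1) (\<lambda>t. l *\<^sub>R vconv e c t + \<mu> *\<^sub>R vconv (D \<mu>) c t) t = 0" .
    qed fact
  qed
  have "vconv (\<lambda>_. 1) c t = 0" if t: "t \<ge> 0" for t
  proof (cases "l = 0")
    case False
    then have "l > 0" using \<open>l \<ge> 0\<close> by simp
    have "0 = l *\<^sub>R (vconv (\<lambda>s. 1 - D l s) c t + vconv (D l) c t)"
      using key[OF \<open>l > 0\<close> t] by (simp add: scaleR_add_right)
    also have "vconv (\<lambda>s. 1 - D l s) c t + vconv (D l) c t = vconv (\<lambda>s. (1 - D l s) + D l s) c t"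
      by (rule vconv_add_left[symmetric]) (intro cT si continuous_intros DT \<open>l > 0\<close>)+
    finally show ?thesis using False by simp
  next
    case True
    have z: "vconv (D (1 / real (Suc n))) c t = 0" for n
      using key[of "1 / real (Suc n)" t] True t by simp
    obtain B where B: "B \<ge> 0" "\<And>s. 0 \<le> s \<Longrightarrow> s \<le> t \<Longrightarrow> norm (c s) \<le> B"
      using bounded_on_interval[OF cT[of t]] by metis
    have "(\<lambda>n. vconv (D (1 / real (Suc n))) c t) \<longlonglongrightarrow> vconv (\<lambda>_. 1) c t"
      unfolding vconv_def set_lebesgue_integral_def
    proof (rule integral_dominated_convergence[where w="\<lambda>s. B * indicator {0..t} s"])
      show "integrable lborel (\<lambda>s. B * indicator {0..t} s)"
        by (intro integrable_mult_right integrable_real_indicator) (auto simp: emeasure_lborel_Icc_eq)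
      show "AE s in lborel. (\<lambda>n. indicator {0..t} s *\<^sub>R D (1 / real (Suc n)) (t - s) *\<^sub>R c s) \<longlonglongrightarrow>
          indicator {0..t} s *\<^sub>R 1 *\<^sub>R c s"
        using AE_lborel_singleton[of t]
      proof eventually_elim
        case (elim s)
        show ?case
        proof (cases "s < t")
          case True
          then show ?thesis by (intro tendsto_intros Dlim) auto
        qed (use elim in auto)
      qed
      show "AE s in lborel. norm (indicator {0..t} s *\<^sub>R D (1 / real (Suc n)) (t - s) *\<^sub>R c s) \<le> B * indicator {0..t} s" for n
        using mult_mono[OF D1[of "1 / real (Suc n)"] B(2)] B(1)
        by (intro AE_I2) (auto simp: indicator_def)
      show "(\<lambda>s. indicator {0..t} s *\<^sub>R D (1 / real (Suc n)) (t - s) *\<^sub>R c s) \<in> borel_measurable lborel" for n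
        using set_integrable_vconv[OF si[OF DT] cT, of "1 / real (Suc n)" t]
        unfolding set_integrable_def by auto
      show "(\<lambda>s. indicator {0..t} s *\<^sub>R 1 *\<^sub>R c s) \<in> borel_measurable lborel"
        using set_integrable_vconv[OF set_integrable_const_1 cT, of t] unfolding set_integrable_def by auto
    qed
    then show ?thesis unfolding z using LIMSEQ_unique by blast
  qed
  then show ?thesis using vconv_1_eq_0_imp[OF c] \<open>t \<ge> 0\<close> by blast
qed

section \<open>Levy measures and Bernstein functions\<close>

lemma levy_measure_id_measurable:
  assumes "levy_measure \<nu>"
  shows "(\<lambda>x. x) \<in> \<nu> \<rightarrow>\<^sub>M borel" and "space \<nu> = {0<..}"
proof -
  have s: "sets \<nu> = sets (restrict_space borel {0<..})" using assms by (simp add: levy_measure_def)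
  show "(\<lambda>x. x) \<in> \<nu> \<rightarrow>\<^sub>M borel"
    unfolding measurable_cong_sets[OF s refl] by (rule measurable_restrict_space1) simp
  show "space \<nu> = {0<..}" using sets_eq_imp_space_eq[OF s] by (simp add: space_restrict_space)
qed

lemma levy_measure_greaterThan:
  assumes "levy_measure \<nu>" "t \<ge> 0"
  shows "{t<..} \<in> sets \<nu>"
proof -
  have "(\<lambda>x. x) -` {t<..} \<inter> space \<nu> \<in> sets \<nu>"
    by (rule measurable_sets[OF levy_measure_id_measurable(1)[OF assms(1)]]) simp
  also have "(\<lambda>x. x) -` {t<..} \<inter> space \<nu> = {t<..}"
    unfolding levy_measure_id_measurable(2)[OF assms(1)] using assms(2) by auto
  finally show ?thesis .
qed

text \<open>Markov's inequality for \<open>min z 1\<close>, which is at least \<open>min t 1\<close>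
  beyond \<open>t\<close>.\<close>

lemma levy_tail_finite:
  assumes \<nu>: "levy_measure \<nu>" and t: "t > 0"
  shows "emeasure \<nu> {t<..} = ennreal (levy_tail \<nu> t)"
proof -
  have "ennreal (min t 1) * emeasure \<nu> {t<..} = (\<integral>\<^sup>+z. ennreal (min t 1) * indicator {t<..} z \<partial>\<nu>)"
    using levy_measure_greaterThan[OF \<nu>, of t] t by (simp add: nn_integral_cmult_indicator)
  also have "\<dots> \<le> (\<integral>\<^sup>+ z. ennreal (min z 1) \<partial>\<nu>)"
    by (intro nn_integral_mono) (auto simp: indicator_def intro!: ennreal_leI)
  also have "\<dots> < \<infinity>" using \<nu> by (simp add: levy_measure_def)
  finally have "emeasure \<nu> {t<..} < \<infinity>"
    using t by (auto simp: ennreal_mult_less_top ennreal_eq_0_iff)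
  then show ?thesis unfolding levy_tail_def by (intro emeasure_eq_ennreal_measure) auto
qed

text \<open>Needed for Tonelli with \<open>\<nu>\<close>, whose total mass may be infinite because
  of small jumps; away from 0 the mass is finite.\<close>

lemma levy_measure_sigma_finite:
  assumes \<nu>: "levy_measure \<nu>"
  shows "sigma_finite_measure \<nu>"
proof
  show "\<exists>A. countable A \<and> A \<subseteq> sets \<nu> \<and> \<Union> A = space \<nu> \<and> (\<forall>a\<in>A. emeasure \<nu> a \<noteq> \<infinity>)"
  proof (intro exI conjI ballI)
    let ?A = "range (\<lambda>n. {1 / real (Suc n)<..})"
    show "countable ?A" by simp
    show "?A \<subseteq> sets \<nu>" using levy_measure_greaterThan[OF \<nu>] by auto
    show "\<Union> ?A = space \<nu>" unfolding levy_measure_id_measurable(2)[OF \<nu>]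
    proof safe
      fix x :: real and n assume "1 / real (Suc n) < x"
      moreover have "0 < 1 / real (Suc n)" by simp
      ultimately show "0 < x" by linarith
    next
      fix x :: real assume "0 < x"
      then obtain n where "inverse (real (Suc n)) < x" using reals_Archimedean by auto
      then show "x \<in> \<Union> ?A" by (auto simp: inverse_eq_divide intro!: exI[of _ n])
    qed
    fix a assume "a \<in> ?A"
    then obtain n where "a = {1 / real (Suc n)<..}" by auto
    then show "emeasure \<nu> a \<noteq> \<infinity>" using levy_tail_finite[OF \<nu>, of "1 / real (Suc n)"] by simp
  qed
qed

text \<open>Bounds the integrand of \<open>bernstein\<close> by a multiple of the function that
  \<open>levy_measure\<close> makes integrable.\<close>

lemma one_minus_exp_le: "1 - exp (- s * x) \<le> max 1 x * min s 1" if "s \<ge> 0" for s x :: real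
proof (cases "s \<le> 1")
  case True
  have "1 + (- s * x) \<le> exp (- s * x)" by (rule exp_ge_add_one_self)
  also have "s * x \<le> s * max 1 x" using that by (intro mult_left_mono) auto
  ultimately show ?thesis using True by (simp add: mult.commute)
next
  case False
  have "1 - exp (- s * x) \<le> 1" by simp
  also have "1 \<le> max 1 x * min s 1" using False by simp
  finally show ?thesis .
qed

lemma bernstein_integrable:
  assumes \<nu>: "levy_measure \<nu>" and "x \<ge> 0"
  shows "integrable \<nu> (\<lambda>s. 1 - exp (- s * x))"
proof (rule integrableI_bounded)
  note [measurable] = levy_measure_id_measurable(1)[OF \<nu>]
  show "(\<lambda>s. 1 - exp (- s * x)) \<in> borel_measurable \<nu>" by measurable
  have "(\<integral>\<^sup>+ s. norm (1 - exp (- s * x)) \<partial>\<nu>) \<le> (\<integral>\<^sup>+ s. ennreal (max 1 x) * ennreal (min s 1) \<partial>\<nu>)"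
  proof (rule nn_integral_mono)
    fix s assume "s \<in> space \<nu>"
    then have s: "s > 0" using levy_measure_id_measurable(2)[OF \<nu>] by auto
    have "exp (- s * x) \<le> 1" using s assms(2) by simp
    then show "ennreal (norm (1 - exp (- s * x))) \<le> ennreal (max 1 x) * ennreal (min s 1)"
      using one_minus_exp_le[of s x] s by (subst ennreal_mult[symmetric]) (auto intro!: ennreal_leI)
  qed
  also have "\<dots> = ennreal (max 1 x) * (\<integral>\<^sup>+ s. ennreal (min s 1) \<partial>\<nu>)"
    by (rule nn_integral_cmult) measurable
  also have "\<dots> < \<infinity>" using \<nu> by (simp add: levy_measure_def ennreal_mult_less_top)
  finally show "(\<integral>\<^sup>+ s. norm (1 - exp (- s * x)) \<partial>\<nu>) < \<infinity>" .
qed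

text \<open>Only the jumps larger than \<open>d\<close> are kept, and on them
  \<open>1 - exp (- s * x)\<close> is at least its value at \<open>s = d\<close>.\<close>

lemma bernstein_ge:
  assumes \<nu>: "levy_measure \<nu>" and "b \<ge> 0" "x \<ge> 0" "d > 0"
  shows "(1 - exp (- d * x)) * levy_tail \<nu> d \<le> bernstein b \<nu> x"
proof -
  have m: "{d<..} \<in> sets \<nu>" using levy_measure_greaterThan[OF \<nu>, of d] \<open>d > 0\<close> by simp
  have fin: "emeasure \<nu> {d<..} < \<infinity>" using levy_tail_finite[OF \<nu> \<open>d > 0\<close>] by simp
  have "(1 - exp (- d * x)) * levy_tail \<nu> d = (\<integral>s. (1 - exp (- d * x)) * indicator {d<..} s \<partial>\<nu>)"
    unfolding levy_tail_def using m fin levy_measure_id_measurable(2)[OF \<nu>] \<open>d > 0\<close>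
    by (simp add: Int_absorb2 subset_eq)
  also have "\<dots> \<le> (\<integral>s. 1 - exp (- s * x) \<partial>\<nu>)"
  proof (rule integral_mono)
    show "integrable \<nu> (\<lambda>s. (1 - exp (- d * x)) * indicator {d<..} s)"
      using m fin by (intro integrable_mult_right integrable_real_indicator)
    show "integrable \<nu> (\<lambda>s. 1 - exp (- s * x))" by (rule bernstein_integrable) fact+
    fix s assume "s \<in> space \<nu>"
    then have s: "s > 0" using levy_measure_id_measurable(2)[OF \<nu>] by auto
    show "(1 - exp (- d * x)) * indicator {d<..} s \<le> 1 - exp (- s * x)"
      using s \<open>x \<ge> 0\<close> by (auto simp: indicator_def intro!: mult_right_mono)
  qed
  also have "\<dots> \<le> bernstein b \<nu> x" using assms unfolding bernstein_def by simp
  finally show ?thesis .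
qed

lemma nn_integral_exp_Ico:
  assumes "\<theta> > 0" "z > 0"
  shows "(\<integral>\<^sup>+t. ennreal (exp (- \<theta> * t)) * indicator {0..<z} t \<partial>lborel) = ennreal ((1 - exp (- \<theta> * z)) / \<theta>)"
proof -
  have "(\<integral>\<^sup>+t. ennreal (exp (- \<theta> * t)) * indicator {0..<z} t \<partial>lborel)
      = (\<integral>\<^sup>+t. ennreal (exp (- \<theta> * t)) * indicator {0..z} t \<partial>lborel)"
    by (rule nn_integral_cong_AE) (use AE_lborel_singleton[of z] in eventually_elim, auto simp: indicator_def)
  also have "\<dots> = ennreal ((- exp (- \<theta> * z) / \<theta>) - (- exp (- \<theta> * 0) / \<theta>))"
    by (rule nn_integral_FTC_Icc) (use assms in \<open>auto intro!: derivative_eq_intros\<close>)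
  finally show ?thesis by (simp add: diff_divide_distrib)
qed

text \<open>Tonelli on the region \<open>0 \<le> t < z\<close>: one order of integration produces
  the tail, the other \<open>(1 - exp (- \<theta> * z)) / \<theta>\<close>. The drift accounts for
  the summand \<open>b\<close> in \<open>bernstein b \<nu> \<theta> / \<theta>\<close>, which is
  subtracted.\<close>

lemma levy_tail_laplace:
  assumes \<nu>: "levy_measure \<nu>" and \<theta>: "\<theta> > 0"
  shows "set_integrable lborel {0..} (\<lambda>t. exp (- \<theta> * t) * levy_tail \<nu> t)"
    and "(LINT t:{0..}|lborel. exp (- \<theta> * t) * levy_tail \<nu> t) = bernstein b \<nu> \<theta> / \<theta> - b"
proof -
  interpret N: sigma_finite_measure \<nu> by (rule levy_measure_sigma_finite[OF \<nu>])
  interpret P: pair_sigma_finite \<nu> lborel by unfold_locales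
  define f :: "real \<Rightarrow> real \<Rightarrow> ennreal"
    where "f z t = (if 0 \<le> t \<and> t < z then ennreal (exp (- \<theta> * t)) else 0)" for z t
  have [measurable]: "(\<lambda>p. fst p) \<in> \<nu> \<Otimes>\<^sub>M lborel \<rightarrow>\<^sub>M borel"
    by (rule measurable_compose[OF measurable_fst levy_measure_id_measurable(1)[OF \<nu>]])
  have fm[measurable]: "case_prod f \<in> borel_measurable (\<nu> \<Otimes>\<^sub>M lborel)"
    unfolding f_def case_prod_beta' by measurable
  define g where "g t = indicator {0..} t *\<^sub>R (exp (- \<theta> * t) * levy_tail \<nu> t)" for t
  have spos: "z > 0" if "z \<in> space \<nu>" for z
    using that levy_measure_id_measurable(2)[OF \<nu>] by auto
  have npos: "0 \<le> (1 - exp (- z * \<theta>)) / \<theta>" if "z \<in> space \<nu>" for z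
    using spos[OF that] \<theta> by (intro divide_nonneg_pos) auto
  have bi: "integrable \<nu> (\<lambda>z. (1 - exp (- z * \<theta>)) / \<theta>)"
    by (rule integrable_divide, rule bernstein_integrable[OF \<nu>]) (use \<theta> in simp)
  have ft: "(\<integral>\<^sup>+z. f z t \<partial>\<nu>) = indicator {0..} t * (ennreal (exp (- \<theta> * t)) * emeasure \<nu> {t<..})" for t
  proof (cases "t \<ge> 0")
    case True
    have "(\<integral>\<^sup>+z. f z t \<partial>\<nu>) = (\<integral>\<^sup>+z. ennreal (exp (- \<theta> * t)) * indicator {t<..} z \<partial>\<nu>)"
      by (rule nn_integral_cong) (use True in \<open>auto simp: f_def indicator_def\<close>)
    then show ?thesis using True levy_measure_greaterThan[OF \<nu> True] by (simp add: nn_integral_cmult_indicator)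
  qed (simp add: f_def)
  \<comment> \<open>Measurability of the tail comes from its being an inner integral of a jointly
    measurable function.\<close>
  have "(\<lambda>t. enn2real (\<integral>\<^sup>+z. f z t \<partial>\<nu>)) \<in> borel_measurable lborel" by measurable
  moreover have "enn2real (\<integral>\<^sup>+z. f z t \<partial>\<nu>) = g t" for t
    unfolding ft g_def levy_tail_def measure_def by (auto simp: indicator_def enn2real_mult)
  ultimately have gm: "g \<in> borel_measurable lborel" by simp
  have gpos: "g t \<ge> 0" for t by (simp add: g_def levy_tail_def)
  have "(\<integral>\<^sup>+t. ennreal (g t) \<partial>lborel) = (\<integral>\<^sup>+t. \<integral>\<^sup>+z. f z t \<partial>\<nu> \<partial>lborel)"
  \<comment> \<open>At \<open>t = 0\<close> the mass of \<open>{0<..}\<close> may be infinite, in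
    which case \<open>levy_tail\<close> has the default value 0; this one point is
    discarded.\<close>
  proof (rule nn_integral_cong_AE, use AE_lborel_singleton[of 0] in eventually_elim)
    case (elim t)
    then show ?case
      by (cases "t > 0") (simp_all add: ft g_def levy_tail_finite[OF \<nu>] ennreal_mult' indicator_def)
  qed
  also have "\<dots> = (\<integral>\<^sup>+z. \<integral>\<^sup>+t. f z t \<partial>lborel \<partial>\<nu>)" by (rule P.Fubini'[OF fm])
  also have "\<dots> = (\<integral>\<^sup>+z. ennreal ((1 - exp (- z * \<theta>)) / \<theta>) \<partial>\<nu>)"
  proof (rule nn_integral_cong)
    fix z assume "z \<in> space \<nu>"
    then have z: "z > 0" by (rule spos)
    have "(\<integral>\<^sup>+t. f z t \<partial>lborel) = (\<integral>\<^sup>+t. ennreal (exp (- \<theta> * t)) * indicator {0..<z} t \<partial>lborel)"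
      by (rule nn_integral_cong) (auto simp: f_def indicator_def)
    then show "(\<integral>\<^sup>+t. f z t \<partial>lborel) = ennreal ((1 - exp (- z * \<theta>)) / \<theta>)"
      using nn_integral_exp_Ico[OF \<theta> z] by (simp add: mult.commute)
  qed
  also have "\<dots> = ennreal (\<integral>z. (1 - exp (- z * \<theta>)) / \<theta> \<partial>\<nu>)"
    by (rule nn_integral_eq_integral[OF bi]) (rule AE_I2[OF npos])
  finally have eq: "(\<integral>\<^sup>+t. ennreal (g t) \<partial>lborel) = ennreal (\<integral>z. (1 - exp (- z * \<theta>)) / \<theta> \<partial>\<nu>)" .
  have gi: "integrable lborel g"
    by (rule integrableI_nonneg) (use gm gpos eq in auto)
  then show "set_integrable lborel {0..} (\<lambda>t. exp (- \<theta> * t) * levy_tail \<nu> t)"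
    unfolding g_def set_integrable_def .
  have "(\<integral>z. (1 - exp (- z * \<theta>)) / \<theta> \<partial>\<nu>) \<ge> 0"
    by (rule Bochner_Integration.integral_nonneg[OF npos])
  then have "(\<integral>t. g t \<partial>lborel) = (\<integral>z. (1 - exp (- z * \<theta>)) / \<theta> \<partial>\<nu>)"
    using eq by (subst integral_eq_nn_integral) (use gm gpos in auto)
  also have "\<dots> = bernstein b \<nu> \<theta> / \<theta> - b"
    using \<theta> by (simp add: bernstein_def add_divide_distrib)
  finally show "(LINT t:{0..}|lborel. exp (- \<theta> * t) * levy_tail \<nu> t) = bernstein b \<nu> \<theta> / \<theta> - b"
    unfolding g_def set_lebesgue_integral_def .
qed

text \<open>The Laplace integral at \<open>\<theta> = 1\<close> converges, and on a bounded interval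
  its weight can be undone by the bounded factor \<open>exp\<close>.\<close>

lemma set_integrable_levy_tail:
  assumes \<nu>: "levy_measure \<nu>"
  shows "set_integrable lborel {0..T} (levy_tail \<nu>)"
proof -
  have "set_integrable lborel {0..T} (\<lambda>t. exp (- 1 * t) * levy_tail \<nu> t)"
    by (rule set_integrable_subset[OF levy_tail_laplace(1)[OF \<nu>]]) auto
  from set_integrable_bounded_scaleR[OF this continuous_on_imp_set_borel_measurable, of exp "exp T"]
  show ?thesis by (simp add: mult.commute[of _ "levy_tail _ _"] mult.assoc mult_exp_exp continuous_intros)
qed

section \<open>The inverse subordinator\<close>

text \<open>For \<open>\<mu> > 0\<close>, the density of the exponential law with rate
  \<open>\<mu>\<close>. It vanishes for \<open>s \<le> 0\<close>, so that nothing has to be known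
  about \<open>H s\<close> at such times.\<close>

definition exp_kernel :: "real \<Rightarrow> real \<Rightarrow> real" where
  "exp_kernel \<mu> s = indicator {0<..} s * (\<mu> * exp (- \<mu> * s))"

lemma exp_kernel_measurable [measurable]: "exp_kernel \<mu> \<in> borel_measurable borel"
  unfolding exp_kernel_def by measurable

lemma exp_kernel_nonneg [simp]: "\<mu> > 0 \<Longrightarrow> exp_kernel \<mu> s \<ge> 0"
  by (simp add: exp_kernel_def)

text \<open>With \<open>x = E t\<close> this writes \<open>exp (- \<mu> * E t)\<close> as the mass
  that the exponential law puts beyond \<open>E t\<close>; taking expectations then involves only
  the distribution function of \<open>E t\<close>.\<close>

lemma exp_kernel_tail_nn:
  assumes "\<mu> > 0" "x \<ge> 0"
  shows "(\<integral>\<^sup>+s. ennreal (exp_kernel \<mu> s * indicator {x..} s) \<partial>lborel) = ennreal (exp (- \<mu> * x))"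
proof -
  have "(\<integral>\<^sup>+s. ennreal (exp_kernel \<mu> s * indicator {x..} s) \<partial>lborel)
      = (\<integral>\<^sup>+s. ennreal (\<mu> * exp (- \<mu> * s)) * indicator {x..} s \<partial>lborel)"
    by (rule nn_integral_cong_AE, use AE_lborel_singleton[of 0] in eventually_elim)
       (use assms in \<open>auto simp: exp_kernel_def indicator_def\<close>)
  also have "\<dots> = ennreal (0 - (- exp (- \<mu> * x)))"
  proof (rule nn_integral_FTC_atLeast)
    have "((\<lambda>s. exp (- (\<mu> * s))) \<longlongrightarrow> 0) at_top"
      using assms(1) by real_asymp
    from tendsto_minus[OF this] show "((\<lambda>s. - exp (- \<mu> * s)) \<longlongrightarrow> 0) at_top" by simp
  qed (use assms in \<open>auto intro!: derivative_eq_intros\<close>)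
  finally show ?thesis by simp
qed

lemma exp_kernel_tail:
  assumes "\<mu> > 0" "x \<ge> 0"
  shows "integrable lborel (\<lambda>s. exp_kernel \<mu> s * indicator {x..} s)"
    and "(\<integral>s. exp_kernel \<mu> s * indicator {x..} s \<partial>lborel) = exp (- \<mu> * x)"
proof -
  have nn: "0 \<le> exp_kernel \<mu> s * indicator {x..} s" for s using assms by simp
  show "integrable lborel (\<lambda>s. exp_kernel \<mu> s * indicator {x..} s)"
    by (rule integrableI_nonneg) (use exp_kernel_tail_nn[OF assms] nn in auto)
  show "(\<integral>s. exp_kernel \<mu> s * indicator {x..} s \<partial>lborel) = exp (- \<mu> * x)"
    by (subst integral_eq_nn_integral) (use exp_kernel_tail_nn[OF assms] nn in auto)
qed

lemma exp_kernel_integral: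
  assumes "\<mu> > 0"
  shows "integrable lborel (exp_kernel \<mu>)" and "(\<integral>s. exp_kernel \<mu> s \<partial>lborel) = 1"
proof -
  have eq: "(\<lambda>s. exp_kernel \<mu> s * indicator {0..} s) = exp_kernel \<mu>"
    by (rule ext) (simp add: exp_kernel_def indicator_def)
  show "integrable lborel (exp_kernel \<mu>)"
    using exp_kernel_tail(1)[OF assms order_refl] unfolding eq .
  show "(\<integral>s. exp_kernel \<mu> s \<partial>lborel) = 1"
    using exp_kernel_tail(2)[OF assms order_refl] unfolding eq by simp
qed

text \<open>\<open>ennreal\<close> sends negative numbers to 0, so \<open>density\<close> alone
  would speak only of the positive part of \<open>m\<close>; \<open>density_nonneg\<close> makes
  \<open>m\<close> itself the density, and it is \<open>m\<close> that enters
  \<open>W_op\<close>.\<close>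

locale inverse_subordinator_density = prob_space M
  for M :: "'a measure" +
  fixes \<nu> :: "real measure" and b :: real and H :: "real \<Rightarrow> 'a \<Rightarrow> real" and m :: "real \<Rightarrow> real \<Rightarrow> real"
  assumes b_nonneg: "b \<ge> 0"
    and levy: "levy_measure \<nu>"
    and tail_at_0: "filterlim (levy_tail \<nu>) at_top (at_right 0)"
    and subordinator: "subordinator M (bernstein b \<nu>) H"
    and density_nonneg: "\<And>s t. t > 0 \<Longrightarrow> m s t \<ge> 0"
    and density: "\<And>t. t > 0 \<Longrightarrow> distributed M lborel (inverse_subordinator H t) (\<lambda>s. ennreal (m s t))"
begin

abbreviation "g \<equiv> bernstein b \<nu>"
abbreviation "E \<equiv> inverse_subordinator H"

section \<open>Growth of the exponent and strict growth of the subordinator\<close>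

lemma tail_ge: "\<exists>d>0. levy_tail \<nu> d \<ge> Z"
proof -
  have "\<forall>\<^sub>F d in at_right 0. levy_tail \<nu> d \<ge> Z" using tail_at_0 by (simp add: filterlim_at_top)
  moreover have "\<forall>\<^sub>F d in at_right 0. d > (0::real)" by (rule eventually_at_right_less)
  ultimately have "\<forall>\<^sub>F d in at_right (0::real). d > 0 \<and> levy_tail \<nu> d \<ge> Z" by eventually_elim auto
  then show ?thesis using eventually_happens'[OF trivial_limit_at_right_real] by blast
qed

lemma g_pos: assumes "\<theta> > 0" shows "g \<theta> > 0"
proof -
  obtain d where d: "d > 0" "levy_tail \<nu> d \<ge> 1" using tail_ge by blast
  have "0 < (1 - exp (- d * \<theta>)) * levy_tail \<nu> d" using d assms by (intro mult_pos_pos) auto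
  also have "\<dots> \<le> g \<theta>" using bernstein_ge[OF levy b_nonneg _ d(1)] assms by simp
  finally show ?thesis .
qed

text \<open>At \<open>x = 1 / d\<close> the factor in \<open>bernstein_ge\<close> is the constant
  \<open>1 - exp (- 1)\<close>, so the large values of the tail near 0 pass to
  \<open>g\<close>.\<close>

lemma g_unbounded: "\<exists>\<theta>>0. g \<theta> \<ge> Z"
proof -
  define q where "q = 1 - exp (- 1 :: real)"
  have q: "q > 0" by (simp add: q_def)
  obtain d where d: "d > 0" "levy_tail \<nu> d \<ge> Z / q" using tail_ge by blast
  have "Z \<le> q * levy_tail \<nu> d" using d(2) q by (simp add: field_simps)
  also have "\<dots> = (1 - exp (- d * (1 / d))) * levy_tail \<nu> d" using d(1) by (simp add: q_def)
  also have "\<dots> \<le> g (1 / d)" using d(1) by (intro bernstein_ge[OF levy b_nonneg]) auto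
  finally show ?thesis using d(1) by (intro exI[of _ "1 / d"]) auto
qed

lemma H_measurable [measurable]: "t \<ge> 0 \<Longrightarrow> H t \<in> borel_measurable M"
  using subordinator by (simp add: subordinator_def)

lemma H_laplace: "t \<ge> 0 \<Longrightarrow> \<theta> \<ge> 0 \<Longrightarrow> expectation (\<lambda>\<omega>. exp (- \<theta> * H t \<omega>)) = exp (- t * g \<theta>)"
  using subordinator by (simp add: subordinator_def)

lemma H_paths: "AE \<omega> in M. mono_on {0..} (\<lambda>t. H t \<omega>) \<and> (\<forall>t\<ge>0. H t \<omega> \<ge> 0)"
proof -
  have "AE \<omega> in M. H 0 \<omega> = 0" "AE \<omega> in M. mono_on {0..} (\<lambda>t. H t \<omega>) \<and>
        (\<forall>t\<ge>0. continuous (at_right t) (\<lambda>s. H s \<omega>))"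
    using subordinator by (simp_all add: subordinator_def)
  then show ?thesis
  proof eventually_elim
    case (elim \<omega>)
    have "H t \<omega> \<ge> 0" if "t \<ge> 0" for t
      using mono_onD[of "{0..}" "\<lambda>t. H t \<omega>" 0 t] elim that by auto
    then show ?case using elim by auto
  qed
qed

lemma H_exp_integrable:
  assumes "t \<ge> 0" "\<theta> \<ge> 0"
  shows "integrable M (\<lambda>\<omega>. exp (- \<theta> * H t \<omega>))"
proof (rule integrable_const_bound[where B=1])
  show "AE \<omega> in M. norm (exp (- \<theta> * H t \<omega>)) \<le> 1"
    using H_paths by eventually_elim (use assms in auto)
qed (use assms in measurable)

text \<open>Chernoff's bound: on the event \<open>exp (- \<theta> * H d)\<close> is at least 1,
  while its mean \<open>exp (- d * g \<theta>)\<close> is arbitrarily small because \<open>g\<close>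
  is unbounded.\<close>

lemma prob_H_nonpos:
  assumes "d > 0"
  shows "prob {\<omega> \<in> space M. H d \<omega> \<le> 0} = 0"
proof (rule ccontr)
  let ?p = "prob {\<omega> \<in> space M. H d \<omega> \<le> 0}"
  assume "?p \<noteq> 0"
  then have p: "?p > 0" using measure_nonneg[of M] by (simp add: less_le)
  \<comment> \<open>This \<open>\<theta>\<close> makes the mean at most \<open>exp (- 1)\<close>
    times the probability in question.\<close>
  obtain \<theta> where \<theta>: "\<theta> > 0" "g \<theta> \<ge> (1 - ln ?p) / d" using g_unbounded by blast
  have [measurable]: "H d \<in> borel_measurable M" using assms by simp
  have "?p = expectation (indicator {\<omega> \<in> space M. H d \<omega> \<le> 0})" by simp
  also have "\<dots> \<le> expectation (\<lambda>\<omega>. exp (- \<theta> * H d \<omega>))"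
  proof (rule integral_mono)
    show "integrable M (indicator {\<omega> \<in> space M. H d \<omega> \<le> 0} :: 'a \<Rightarrow> real)"
      by (intro integrable_real_indicator) (measurable, auto simp: emeasure_eq_measure)
    show "integrable M (\<lambda>\<omega>. exp (- \<theta> * H d \<omega>))" using assms \<theta> by (intro H_exp_integrable) auto
    show "indicator {\<omega> \<in> space M. H d \<omega> \<le> 0} \<omega> \<le> exp (- \<theta> * H d \<omega>)" for \<omega>
      using \<theta> by (auto simp: indicator_def mult_le_0_iff)
  qed
  also have "\<dots> = exp (- d * g \<theta>)" using assms \<theta> by (intro H_laplace) auto
  also have "\<dots> \<le> exp (ln ?p - 1)" using \<theta>(2) assms by (simp add: field_simps)
  also have "\<dots> < exp (ln ?p)" by simp
  also have "\<dots> = ?p" using p by (rule exp_ln)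
  finally show False by simp
qed

lemma AE_H_pos: assumes "d > 0" shows "AE \<omega> in M. H d \<omega> > 0"
proof -
  have [measurable]: "H d \<in> borel_measurable M" using assms by simp
  have "AE \<omega> in M. \<not> H d \<omega> \<le> 0"
    using prob_H_nonpos[OF assms] by (subst AE_iff_measurable[OF _ refl]) (auto simp: emeasure_eq_measure)
  then show ?thesis by eventually_elim auto
qed

text \<open>The increment has the law of \<open>H (s' - s)\<close>, which is almost surely positive.
  The exceptional set depends on the pair of times, so this is no statement about whole
  paths.\<close>

lemma AE_H_less:
  assumes "0 \<le> s" "s < s'"
  shows "AE \<omega> in M. H s \<omega> < H s' \<omega>"
proof -
  have [measurable]: "H s \<in> borel_measurable M" "H s' \<in> borel_measurable M" "H (s' - s) \<in> borel_measurable M"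
    using assms by simp_all
  have "\<forall>s\<ge>0. \<forall>t\<ge>0. distr M borel (\<lambda>\<omega>. H (s + t) \<omega> - H s \<omega>) = distr M borel (H t)"
    using subordinator unfolding subordinator_def by blast
  from this[rule_format, of s "s' - s"] assms have d: "distr M borel (\<lambda>\<omega>. H s' \<omega> - H s \<omega>) = distr M borel (H (s' - s))" by simp
  have "AE x in distr M borel (H (s' - s)). x > 0"
    using AE_H_pos[of "s' - s"] assms by (subst AE_distr_iff) auto
  then have "AE x in distr M borel (\<lambda>\<omega>. H s' \<omega> - H s \<omega>). x > 0" unfolding d .
  then have "AE \<omega> in M. H s' \<omega> - H s \<omega> > 0" by (subst (asm) AE_distr_iff) auto
  then show ?thesis by eventually_elim auto
qed

text \<open>Ensures that the infimum defining \<open>E t\<close> is not taken over the empty set. By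
  Markov's inequality, \<open>H n \<le> t\<close> has probability at most
  \<open>exp (t - n * g 1)\<close>, and \<open>g 1\<close> is positive.\<close>

lemma AE_H_unbounded: "AE \<omega> in M. \<exists>s>0. H s \<omega> > t"
proof -
  let ?N = "{\<omega> \<in> space M. \<forall>n::nat. H (real (Suc n)) \<omega> \<le> t}"
  have [measurable]: "H (real (Suc n)) \<in> borel_measurable M" for n by simp
  have le: "prob ?N \<le> exp (t - real (Suc n) * g 1)" for n
  proof -
    have "prob ?N = expectation (indicator ?N)" by simp
    also have "\<dots> \<le> expectation (\<lambda>\<omega>. exp t * exp (- 1 * H (real (Suc n)) \<omega>))"
    proof (rule integral_mono)
      show "integrable M (indicator ?N :: 'a \<Rightarrow> real)"
        by (intro integrable_real_indicator) (measurable, auto simp: emeasure_eq_measure)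
      show "integrable M (\<lambda>\<omega>. exp t * exp (- 1 * H (real (Suc n)) \<omega>))"
        by (intro integrable_mult_right H_exp_integrable) auto
      show "indicator ?N \<omega> \<le> exp t * exp (- 1 * H (real (Suc n)) \<omega>)" for \<omega>
        by (auto simp: indicator_def mult_exp_exp)
    qed
    also have "\<dots> = exp t * exp (- real (Suc n) * g 1)"
      using H_laplace[of "real (Suc n)" 1] by simp
    also have "\<dots> = exp (t - real (Suc n) * g 1)" by (simp add: mult_exp_exp del: of_nat_Suc)
    finally show ?thesis .
  qed
  have "prob ?N = 0"
  proof (rule ccontr)
    assume "prob ?N \<noteq> 0"
    then have p: "prob ?N > 0" using measure_nonneg[of M] by (simp add: less_le)
    obtain n where "(t - ln (prob ?N)) / g 1 < real n" using reals_Archimedean2 by blast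
    then have "t - ln (prob ?N) < real n * g 1" using g_pos[of 1] by (simp add: field_simps)
    also have "\<dots> \<le> real (Suc n) * g 1" using g_pos[of 1] by (simp add: mult_right_mono)
    finally have "exp (t - real (Suc n) * g 1) < exp (ln (prob ?N))" by (simp only: exp_less_cancel_iff)
    also have "\<dots> = prob ?N" using p by (rule exp_ln)
    finally show False using le[of n] by linarith
  qed
  then have "AE \<omega> in M. \<not> (\<forall>n::nat. H (real (Suc n)) \<omega> \<le> t)"
    by (subst AE_iff_measurable[OF _ refl]) (auto simp: emeasure_eq_measure)
  then show ?thesis
  proof eventually_elim
    case (elim \<omega>)
    then obtain n where "\<not> H (real (Suc n)) \<omega> \<le> t" by blast
    then show ?case by (intro exI[of _ "real (Suc n)"]) auto
  qed
qed

section \<open>The inverse process and its distribution function\<close>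

lemma E_le: assumes "s > 0" "H s \<omega> > t" shows "E t \<omega> \<le> s"
  unfolding inverse_subordinator_def
  by (rule cInf_lower) (use assms in \<open>auto intro!: bdd_belowI[of _ 0]\<close>)

text \<open>Monotone paths stay above the level once they have passed it. Nothing is claimed at
  \<open>s = E t\<close>; that boundary case is null because \<open>E t\<close> has no
  atoms.\<close>

lemma AE_E_less:
  shows "AE \<omega> in M. E t \<omega> \<ge> 0 \<and> (\<forall>s. E t \<omega> < s \<longrightarrow> H s \<omega> > t)"
  using H_paths AE_H_unbounded[of t]
proof eventually_elim
  case (elim \<omega>)
  let ?S = "{s. s > 0 \<and> H s \<omega> > t}"
  have ne: "?S \<noteq> {}" using elim by auto
  have "E t \<omega> \<ge> 0" unfolding inverse_subordinator_def by (rule cInf_greatest[OF ne]) auto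
  moreover have "H s \<omega> > t" if "E t \<omega> < s" for s
  proof -
    have "\<exists>x\<in>?S. x < s"
      using cInf_lessD[OF ne] that unfolding inverse_subordinator_def by blast
    then obtain x where x: "x > 0" "H x \<omega> > t" "x < s" by auto
    have "mono_on {0..} (\<lambda>t. H t \<omega>)" using elim by blast
    from mono_onD[OF this, of x s] x have "H x \<omega> \<le> H s \<omega>" by simp
    then show ?thesis using x by simp
  qed
  ultimately show ?case by blast
qed

text \<open>Measurability is part of having a density, so the infimum over uncountably many times
  need not be analysed.\<close>

lemma E_measurable [measurable]:
  assumes "t > 0"
  shows "E t \<in> borel_measurable M"
  using distributed_measurable[OF density[OF assms]] by simp

lemma prob_E_eq: assumes "t > 0" shows "prob {\<omega> \<in> space M. E t \<omega> = s} = 0"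
proof -
  have "emeasure M (E t -` {s} \<inter> space M) = (\<integral>\<^sup>+x. ennreal (m x t) * indicator {s} x \<partial>lborel)"
    by (rule distributed_emeasure[OF density[OF assms]]) simp
  also have "\<dots> = (\<integral>\<^sup>+(x::real). 0 \<partial>lborel)"
    by (rule nn_integral_cong_AE, use AE_lborel_singleton[of s] in eventually_elim) auto
  finally have "emeasure M (E t -` {s} \<inter> space M) = 0" by simp
  moreover have "E t -` {s} \<inter> space M = {\<omega> \<in> space M. E t \<omega> = s}" by auto
  ultimately show ?thesis by (simp add: measure_def)
qed

lemma AE_E_neq: assumes "t > 0" shows "AE \<omega> in M. E t \<omega> \<noteq> s"
proof -
  have [measurable]: "E t \<in> borel_measurable M" using assms by simp
  show ?thesis using prob_E_eq[OF assms, of s] by (subst AE_iff_measurable[OF _ refl]) (auto simp: emeasure_eq_measure)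
qed

text \<open>The survival function of \<open>H s\<close>; for fixed \<open>t > 0\<close> it is, in
  \<open>s > 0\<close>, also the distribution function of \<open>E t\<close>. The first reading
  gives continuity in \<open>t\<close>, the second continuity in \<open>s\<close>.\<close>

definition G :: "real \<Rightarrow> real \<Rightarrow> real" where
  "G s t = prob {\<omega> \<in> space M. H s \<omega> > t}"

lemma G_bounds [simp]: "0 \<le> G s t" "G s t \<le> 1"
  by (simp_all add: G_def)

lemma prob_E_le:
  assumes "t > 0" "s > 0"
  shows "prob {\<omega> \<in> space M. E t \<omega> \<le> s} = G s t"
proof -
  have [measurable]: "E t \<in> borel_measurable M" "H s \<in> borel_measurable M" using assms by simp_all
  have "AE \<omega> in M. \<omega> \<in> {\<omega> \<in> space M. E t \<omega> \<le> s} \<longleftrightarrow> \<omega> \<in> {\<omega> \<in> space M. H s \<omega> > t}"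
    using AE_E_less[of t] AE_E_neq[OF assms(1), of s]
  proof eventually_elim
    case (elim \<omega>)
    then have "E t \<omega> \<le> s \<longleftrightarrow> H s \<omega> > t" using E_le[OF assms(2), of t \<omega>] by (metis order_le_less)
    then show ?case by simp
  qed
  then show ?thesis unfolding G_def by (intro measure_eq_AE) auto
qed

lemma measure_distr_Collect:
  "X \<in> borel_measurable M \<Longrightarrow> A \<in> sets borel \<Longrightarrow>
    measure (distr M borel X) A = prob {\<omega> \<in> space M. X \<omega> \<in> A}" for X :: "'a \<Rightarrow> real"
  by (simp add: measure_distr vimage_def Int_def conj_commute)

lemma cdf_E:
  assumes "t > 0" "s > 0"
  shows "cdf (distr M borel (E t)) s = G s t"
  unfolding prob_E_le[OF assms, symmetric] cdf_def
  using measure_distr_Collect[OF E_measurable[OF assms(1)], of "{..s}"] by simp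

lemma isCont_cdf_E: assumes "t > 0" shows "isCont (cdf (distr M borel (E t))) s"
proof -
  have [measurable]: "E t \<in> borel_measurable M" using assms by simp
  interpret D: real_distribution "distr M borel (E t)" by simp
  show ?thesis
    using prob_E_eq[OF assms, of s] measure_distr_Collect[OF E_measurable[OF assms], of "{s}"]
    by (subst D.isCont_cdf) simp
qed

lemma G_nonpos: assumes "t \<le> 0" "s > 0" shows "G s t = 1"
proof -
  have [measurable]: "H s \<in> borel_measurable M" using assms by simp
  show ?thesis unfolding G_def
    by (rule prob_Collect_eq_1[THEN iffD2]) (use AE_H_pos[OF assms(2)] assms(1) in auto)
qed

text \<open>For \<open>s < s'\<close>, the event \<open>t \<le> H s\<close> almost surely implies \<open>t < H s'\<close>, that is \<open>E t \<le> s'\<close>; as \<open>E t\<close> has no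
  atoms, letting \<open>s'\<close> tend to \<open>s\<close> excludes atoms of \<open>H s\<close>.\<close>

lemma prob_H_eq: assumes "s > 0" shows "prob {\<omega> \<in> space M. H s \<omega> = t} = 0"
proof (cases "t > 0")
  case False
  have [measurable]: "H s \<in> borel_measurable M" using assms by simp
  have "prob {\<omega> \<in> space M. H s \<omega> = t} \<le> prob {\<omega> \<in> space M. H s \<omega> \<le> 0}"
    by (rule finite_measure_mono) (use False in auto)
  then show ?thesis using prob_H_nonpos[OF assms] measure_nonneg[of M] by (simp add: order_antisym)
next
  case True
  have [measurable]: "H s \<in> borel_measurable M" using assms by simp
  let ?F = "cdf (distr M borel (E t))"
  have le: "prob {\<omega> \<in> space M. H s \<omega> \<ge> t} \<le> ?F s'" if "s < s'" for s'
  proof -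
    have [measurable]: "H s' \<in> borel_measurable M" using assms that by simp
    have "prob {\<omega> \<in> space M. H s \<omega> \<ge> t} \<le> prob {\<omega> \<in> space M. H s' \<omega> > t}"
    proof (rule finite_measure_mono_AE)
      show "AE \<omega> in M. \<omega> \<in> {\<omega> \<in> space M. t \<le> H s \<omega>} \<longrightarrow> \<omega> \<in> {\<omega> \<in> space M. t < H s' \<omega>}"
        using AE_H_less[OF less_imp_le[OF assms] that] by eventually_elim auto
    qed measurable
    also have "\<dots> = ?F s'" using cdf_E[OF True, of s'] assms that by (simp add: G_def)
    finally show ?thesis .
  qed
  have "(?F \<longlongrightarrow> ?F s) (at_right s)"
    using isCont_cdf_E[OF True, of s] by (simp add: isCont_def filterlim_at_split)
  then have "prob {\<omega> \<in> space M. H s \<omega> \<ge> t} \<le> ?F s"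
    by (rule tendsto_lowerbound) (auto simp: eventually_at_right_less intro!: eventually_at_rightI[of s "s + 1"] le)
  also have "?F s = prob {\<omega> \<in> space M. H s \<omega> > t}" using cdf_E[OF True assms] by (simp add: G_def)
  finally have "prob {\<omega> \<in> space M. H s \<omega> \<ge> t} \<le> prob {\<omega> \<in> space M. H s \<omega> > t}" .
  moreover have "prob {\<omega> \<in> space M. H s \<omega> \<ge> t} = prob ({\<omega> \<in> space M. H s \<omega> = t} \<union> {\<omega> \<in> space M. H s \<omega> > t})"
    by (rule arg_cong[where f=prob]) auto
  moreover have "\<dots> = prob {\<omega> \<in> space M. H s \<omega> = t} + prob {\<omega> \<in> space M. H s \<omega> > t}"
    by (rule finite_measure_Union) auto
  ultimately show ?thesis using measure_nonneg[of M "{\<omega> \<in> space M. H s \<omega> = t}"] by linarith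
qed

lemma isCont_G: assumes "s > 0" shows "isCont (G s) t"
proof -
  have [measurable]: "H s \<in> borel_measurable M" using assms by simp
  interpret D: real_distribution "distr M borel (H s)" by simp
  have "isCont (cdf (distr M borel (H s))) t"
    using prob_H_eq[OF assms, of t] measure_distr_Collect[of "H s" "{t}"]
    by (subst D.isCont_cdf) simp
  then have "isCont (\<lambda>t. 1 - cdf (distr M borel (H s)) t) t" by (intro continuous_intros)
  moreover have "1 - cdf (distr M borel (H s)) t = G s t" for t
  proof -
    have "G s t = prob (space M - {\<omega> \<in> space M. H s \<omega> \<le> t})"
      unfolding G_def by (rule arg_cong[where f=prob]) auto
    also have "\<dots> = 1 - prob {\<omega> \<in> space M. H s \<omega> \<le> t}" by (rule prob_compl) measurable
    finally show ?thesis using measure_distr_Collect[of "H s" "{..t}"] by (simp add: cdf_def)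
  qed
  ultimately show ?thesis by simp
qed

end

section \<open>The relaxation function: expectation, continuity and Laplace transform\<close>

context inverse_subordinator_density begin

text \<open>Defined by the integral rather than by the expectation over \<open>E t\<close>, because
  \<open>density\<close> covers only \<open>t > 0\<close>; here the value 1 at
  \<open>t \<le> 0\<close> and continuity at 0 come out directly.\<close>

definition relax :: "real \<Rightarrow> real \<Rightarrow> real" where
  "relax \<mu> t = (\<integral>s. exp_kernel \<mu> s * G s t \<partial>lborel)"

lemma kernel_G_measurable: "(\<lambda>s. exp_kernel \<mu> s * G s t) \<in> borel_measurable lborel"
proof (cases "t > 0")
  case True
  have "cdf (distr M borel (E t)) \<in> borel_measurable borel"
    by (intro borel_measurable_continuous_onI continuous_at_imp_continuous_on ballI isCont_cdf_E True)
  moreover have "(\<lambda>s. exp_kernel \<mu> s * G s t) = (\<lambda>s. exp_kernel \<mu> s * cdf (distr M borel (E t)) s)"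
    by (rule ext) (simp add: exp_kernel_def indicator_def cdf_E[OF True])
  ultimately show ?thesis by simp
next
  case False
  then have "(\<lambda>s. exp_kernel \<mu> s * G s t) = exp_kernel \<mu>"
    by (intro ext) (simp add: exp_kernel_def indicator_def G_nonpos)
  then show ?thesis by (metis exp_kernel_measurable measurable_lborel2)
qed

lemma kernel_G_integrable:
  assumes "\<mu> > 0"
  shows "integrable lborel (\<lambda>s. exp_kernel \<mu> s * G s t)"
proof (rule Bochner_Integration.integrable_bound[OF exp_kernel_integral(1)[OF assms] kernel_G_measurable])
  show "AE s in lborel. norm (exp_kernel \<mu> s * G s t) \<le> norm (exp_kernel \<mu> s)"
    using assms by (intro AE_I2) (simp add: abs_mult mult_left_le)
qed

lemma relax_bounds:
  assumes "\<mu> > 0"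
  shows "0 \<le> relax \<mu> t" "relax \<mu> t \<le> 1"
proof -
  show "0 \<le> relax \<mu> t" unfolding relax_def using assms by (intro Bochner_Integration.integral_nonneg) simp
  have "relax \<mu> t \<le> (\<integral>s. exp_kernel \<mu> s \<partial>lborel)" unfolding relax_def
    using assms by (intro integral_mono kernel_G_integrable exp_kernel_integral(1)) (simp_all add: mult_left_le)
  then show "relax \<mu> t \<le> 1" using exp_kernel_integral(2)[OF assms] by simp
qed

lemma relax_nonpos:
  assumes "\<mu> > 0" "t \<le> 0"
  shows "relax \<mu> t = 1"
proof -
  have "relax \<mu> t = (\<integral>s. exp_kernel \<mu> s \<partial>lborel)" unfolding relax_def
    by (rule Bochner_Integration.integral_cong) (auto simp: exp_kernel_def indicator_def G_nonpos assms)
  then show ?thesis using exp_kernel_integral(2)[OF assms(1)] by simp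
qed

lemma relax_isCont:
  assumes "\<mu> > 0"
  shows "isCont (relax \<mu>) t"
  unfolding continuous_at_sequentially
proof (intro allI impI)
  fix u :: "nat \<Rightarrow> real" assume u: "u \<longlonglongrightarrow> t"
  show "(relax \<mu> \<circ> u) \<longlonglongrightarrow> relax \<mu> t"
    unfolding comp_def relax_def
  proof (rule integral_dominated_convergence[where w="exp_kernel \<mu>"])
    show "AE s in lborel. (\<lambda>n. exp_kernel \<mu> s * G s (u n)) \<longlonglongrightarrow> exp_kernel \<mu> s * G s t"
    proof (rule AE_I2)
      fix s
      show "(\<lambda>n. exp_kernel \<mu> s * G s (u n)) \<longlonglongrightarrow> exp_kernel \<mu> s * G s t"
      proof (cases "s > 0")
        case True
        show ?thesis by (intro tendsto_intros isCont_tendsto_compose[OF isCont_G[OF True] u])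
      qed (simp add: exp_kernel_def)
    qed
    show "AE s in lborel. norm (exp_kernel \<mu> s * G s (u n)) \<le> exp_kernel \<mu> s" for n
      using assms by (intro AE_I2) (simp add: abs_mult mult_left_le)
  qed (rule kernel_G_measurable exp_kernel_integral(1)[OF assms])+
qed

lemma relax_continuous_on: "\<mu> > 0 \<Longrightarrow> continuous_on A (relax \<mu>)"
  by (intro continuous_at_imp_continuous_on ballI relax_isCont)

lemma relax_expectation:
  assumes \<mu>: "\<mu> > 0" and t: "t > 0"
  shows "expectation (\<lambda>\<omega>. exp (- \<mu> * E t \<omega>)) = relax \<mu> t"
proof -
  interpret P: pair_sigma_finite M lborel by unfold_locales
  have [measurable]: "E t \<in> borel_measurable M" by (rule E_measurable[OF t])
  define K where "K \<omega> s = exp_kernel \<mu> s * (if E t \<omega> \<le> s then 1 else 0)" for \<omega> s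
  have Km[measurable]: "case_prod K \<in> borel_measurable (M \<Otimes>\<^sub>M lborel)"
    unfolding K_def case_prod_beta' by measurable
  have Kle: "\<bar>K \<omega> s\<bar> \<le> exp_kernel \<mu> s" for \<omega> s using \<mu> by (simp add: K_def)
  have Ki: "integrable lborel (K \<omega>)" for \<omega>
  proof (rule Bochner_Integration.integrable_bound[OF exp_kernel_integral(1)[OF \<mu>]])
    show "K \<omega> \<in> borel_measurable lborel" unfolding K_def by measurable
    show "AE s in lborel. norm (K \<omega> s) \<le> norm (exp_kernel \<mu> s)" using Kle \<mu> by (intro AE_I2) simp
  qed
  have iK: "integrable (M \<Otimes>\<^sub>M lborel) (case_prod K)"
  proof (rule P.Fubini_integrable[OF Km])
    show "AE \<omega> in M. integrable lborel (\<lambda>s. case (\<omega>, s) of (\<omega>, s) \<Rightarrow> K \<omega> s)" using Ki by simp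
    show "integrable M (\<lambda>\<omega>. \<integral>s. norm (case (\<omega>, s) of (\<omega>, s) \<Rightarrow> K \<omega> s) \<partial>lborel)"
    proof (rule integrable_const_bound[where B=1])
      show "AE \<omega> in M. norm (\<integral>s. norm (case (\<omega>, s) of (\<omega>, s) \<Rightarrow> K \<omega> s) \<partial>lborel) \<le> 1"
      proof (rule AE_I2)
        fix \<omega>
        have "(\<integral>s. norm (K \<omega> s) \<partial>lborel) \<le> (\<integral>s. exp_kernel \<mu> s \<partial>lborel)"
          by (intro integral_mono integrable_norm Ki exp_kernel_integral \<mu>) (use Kle in simp)
        then show "norm (\<integral>s. norm (case (\<omega>, s) of (\<omega>, s) \<Rightarrow> K \<omega> s) \<partial>lborel) \<le> 1"
          using exp_kernel_integral(2)[OF \<mu>] by simp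
      qed
    qed measurable
  qed
  have "expectation (\<lambda>\<omega>. exp (- \<mu> * E t \<omega>)) = (\<integral>\<omega>. \<integral>s. K \<omega> s \<partial>lborel \<partial>M)"
  proof (rule integral_cong_AE)
    show "AE \<omega> in M. exp (- \<mu> * E t \<omega>) = (\<integral>s. K \<omega> s \<partial>lborel)"
      using AE_E_less[of t]
    proof eventually_elim
      case (elim \<omega>)
      have "(\<integral>s. K \<omega> s \<partial>lborel) = (\<integral>s. exp_kernel \<mu> s * indicator {E t \<omega>..} s \<partial>lborel)"
        by (rule Bochner_Integration.integral_cong) (auto simp: K_def indicator_def)
      then show ?case using exp_kernel_tail(2)[OF \<mu>, of "E t \<omega>"] elim by simp
    qed
  qed measurable
  also have "\<dots> = (\<integral>s. \<integral>\<omega>. K \<omega> s \<partial>M \<partial>lborel)" by (rule P.Fubini_integral[OF iK, symmetric])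
  also have "\<dots> = relax \<mu> t" unfolding relax_def
  proof (rule Bochner_Integration.integral_cong[OF refl])
    fix s
    have "(\<integral>\<omega>. K \<omega> s \<partial>M) = (\<integral>\<omega>. exp_kernel \<mu> s * indicator {\<omega> \<in> space M. E t \<omega> \<le> s} \<omega> \<partial>M)"
      unfolding K_def by (rule Bochner_Integration.integral_cong) (auto simp: indicator_def)
    also have "\<dots> = exp_kernel \<mu> s * prob {\<omega> \<in> space M. E t \<omega> \<le> s}" by simp
    also have "\<dots> = exp_kernel \<mu> s * G s t"
      by (cases "s > 0") (simp_all add: prob_E_le[OF t] exp_kernel_def)
    finally show "(\<integral>\<omega>. K \<omega> s \<partial>M) = exp_kernel \<mu> s * G s t" .
  qed
  finally show ?thesis .
qed

text \<open>\<open>E t\<close> is finite and almost surely nonnegative, so dominated convergence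
  applies. This supplies the limit of vanishing rate for the mode \<open>k = 0\<close> in the
  uniqueness proof.\<close>

lemma relax_tendsto_1:
  assumes t: "t > 0"
  shows "(\<lambda>n. relax (1 / real (Suc n)) t) \<longlonglongrightarrow> 1"
proof -
  have [measurable]: "E t \<in> borel_measurable M" by (rule E_measurable[OF t])
  have "(\<lambda>n. expectation (\<lambda>\<omega>. exp (- (1 / real (Suc n)) * E t \<omega>))) \<longlonglongrightarrow> expectation (\<lambda>\<omega>. 1)"
  proof (rule integral_dominated_convergence[where w="\<lambda>_. 1::real"])
    show "(\<lambda>\<omega>. exp (- (1 / real (Suc n)) * E t \<omega>)) \<in> borel_measurable M" for n
      using \<open>E t \<in> borel_measurable M\<close> by simp
    show "AE \<omega> in M. (\<lambda>n. exp (- (1 / real (Suc n)) * E t \<omega>)) \<longlonglongrightarrow> 1"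
    proof (rule AE_I2)
      fix \<omega>
      have "(\<lambda>n. exp (- (1 / real (Suc n)) * E t \<omega>)) \<longlonglongrightarrow> exp (- 0 * E t \<omega>)"
        by (intro tendsto_intros LIMSEQ_Suc[OF lim_1_over_n])
      then show "(\<lambda>n. exp (- (1 / real (Suc n)) * E t \<omega>)) \<longlonglongrightarrow> 1" by simp
    qed
    show "AE \<omega> in M. norm (exp (- (1 / real (Suc n)) * E t \<omega>)) \<le> 1" for n
      using AE_E_less[of t] by eventually_elim (simp add: divide_nonneg_pos)
  qed simp_all
  then show ?thesis by (simp add: relax_expectation[OF _ t, symmetric] prob_space)
qed

text \<open>Joint measurability is not part of the definition of a subordinator; it follows by discretising \<open>s\<close>,
  since \<open>G\<close> is continuous in each variable.\<close>

lemma kernel_G_measurable2: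
  "(\<lambda>(s, t). exp_kernel \<mu> s * indicator {0<..} t * G s t) \<in> borel_measurable (lborel \<Otimes>\<^sub>M lborel)"
proof -
  \<comment> \<open>\<open>s\<close> is replaced by the next point of the grid with mesh
    \<open>1 / Suc n\<close>. The added 1 keeps that point positive even for
    \<open>s \<le> 0\<close>, so that \<open>G\<close> is measurable in \<open>t\<close>
    there.\<close>
  define F where "F n x = (case x of (s, t) \<Rightarrow> exp_kernel \<mu> s * indicator {0<..} t *
      G ((real (nat \<lfloor>real (Suc n) * s\<rfloor>) + 1) / real (Suc n)) t)" for n and x :: "real \<times> real"
  have Fm: "F n \<in> borel_measurable (borel \<Otimes>\<^sub>M borel)" for n
  proof -
    have Gm: "G s \<in> borel_measurable borel" if "s > 0" for s
      by (intro borel_measurable_continuous_onI continuous_at_imp_continuous_on ballI isCont_G that)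
    have 1: "(\<lambda>x. G ((real i + 1) / real (Suc n)) (snd x)) \<in> borel_measurable (borel \<Otimes>\<^sub>M borel)" for i :: nat
      by (rule measurable_compose[OF measurable_snd Gm]) (simp add: add_nonneg_pos)
    have 2: "(\<lambda>x. nat \<lfloor>real (Suc n) * fst x\<rfloor>) \<in> (borel \<Otimes>\<^sub>M borel) \<rightarrow>\<^sub>M count_space UNIV"
      by measurable
    have 3[measurable]: "(\<lambda>x. G ((real (nat \<lfloor>real (Suc n) * fst x\<rfloor>) + 1) / real (Suc n)) (snd x)) \<in> borel_measurable (borel \<Otimes>\<^sub>M borel)"
      by (rule measurable_compose_countable[where f="\<lambda>i x. G ((real i + 1) / real (Suc n)) (snd x)", OF 1 2])
    show ?thesis unfolding F_def case_prod_beta' by measurable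
  qed
  have "(\<lambda>(s, t). exp_kernel \<mu> s * indicator {0<..} t * G s t) \<in> borel_measurable (borel \<Otimes>\<^sub>M borel)"
  proof (rule borel_measurable_LIMSEQ_real[OF _ Fm])
    fix x :: "real \<times> real"
    obtain s t where x: "x = (s, t)" by (cases x)
    show "(\<lambda>n. F n x) \<longlonglongrightarrow> (case x of (s, t) \<Rightarrow> exp_kernel \<mu> s * indicator {0<..} t * G s t)"
    proof (cases "s > 0 \<and> t > 0")
      case True
      define u where "u n = (real (nat \<lfloor>real (Suc n) * s\<rfloor>) + 1) / real (Suc n)" for n
      have u0: "u n > 0" for n by (simp add: u_def add_nonneg_pos)
      have us: "u \<longlonglongrightarrow> s"
      proof (rule tendsto_sandwich[OF always_eventually always_eventually])
        have r: "real (nat \<lfloor>real (Suc n) * s\<rfloor>) = of_int \<lfloor>real (Suc n) * s\<rfloor>" for n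
          using True by (intro of_nat_nat) simp
        show "\<forall>n. s \<le> u n"
        proof
          fix n
          have "real (Suc n) * s \<le> of_int \<lfloor>real (Suc n) * s\<rfloor> + 1" by linarith
          then show "s \<le> u n" unfolding u_def r by (simp add: field_simps)
        qed
        show "\<forall>n. u n \<le> s + 1 / real (Suc n)"
        proof
          fix n
          have "of_int \<lfloor>real (Suc n) * s\<rfloor> \<le> real (Suc n) * s" by linarith
          then have "of_int \<lfloor>real (Suc n) * s\<rfloor> / real (Suc n) \<le> s"
            by (simp add: divide_le_eq mult.commute)
          then show "u n \<le> s + 1 / real (Suc n)" unfolding u_def r by (simp add: add_divide_distrib)
        qed
        have "(\<lambda>n. s + 1 / real (Suc n)) \<longlonglongrightarrow> s + 0" by (intro tendsto_intros LIMSEQ_Suc[OF lim_1_over_n])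
        then show "(\<lambda>n. s + 1 / real (Suc n)) \<longlonglongrightarrow> s" by simp
      qed (rule tendsto_const)
      have "(\<lambda>n. cdf (distr M borel (E t)) (u n)) \<longlonglongrightarrow> cdf (distr M borel (E t)) s"
        by (rule isCont_tendsto_compose[OF isCont_cdf_E us]) (use True in simp)
      then have "(\<lambda>n. G (u n) t) \<longlonglongrightarrow> G s t" using True u0 by (simp add: cdf_E)
      then have "(\<lambda>n. exp_kernel \<mu> s * indicator {0<..} t * G (u n) t) \<longlonglongrightarrow> exp_kernel \<mu> s * indicator {0<..} t * G s t"
        by (intro tendsto_intros)
      then show ?thesis unfolding x F_def u_def by simp
    next
      case False
      then show ?thesis by (auto simp: x F_def exp_kernel_def)
    qed
  qed
  then show ?thesis by (simp cong: measurable_cong_sets)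
qed

text \<open>Integrating \<open>exp (- \<theta> * t)\<close> over \<open>0 < t < H s\<close> gives
  \<open>(1 - exp (- \<theta> * H s)) / \<theta>\<close>, whose expectation is prescribed by the
  Laplace exponent.\<close>

lemma G_laplace:
  assumes \<theta>: "\<theta> > 0" and s: "s > 0"
  shows "(\<integral>\<^sup>+t. ennreal (exp (- \<theta> * t) * indicator {0<..} t * G s t) \<partial>lborel) = ennreal ((1 - exp (- s * g \<theta>)) / \<theta>)"
proof -
  interpret P: pair_sigma_finite M lborel by unfold_locales
  have [measurable]: "H s \<in> borel_measurable M" using s by simp
  define f :: "'a \<Rightarrow> real \<Rightarrow> ennreal"
    where "f \<omega> t = (if 0 < t \<and> t < H s \<omega> then ennreal (exp (- \<theta> * t)) else 0)" for \<omega> t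
  have [measurable]: "case_prod f \<in> borel_measurable (M \<Otimes>\<^sub>M lborel)"
    unfolding f_def case_prod_beta' by measurable
  have "(\<integral>\<^sup>+t. ennreal (exp (- \<theta> * t) * indicator {0<..} t * G s t) \<partial>lborel) = (\<integral>\<^sup>+t. \<integral>\<^sup>+\<omega>. f \<omega> t \<partial>M \<partial>lborel)"
  proof (rule nn_integral_cong)
    fix t :: real
    have "(\<integral>\<^sup>+\<omega>. f \<omega> t \<partial>M) = (\<integral>\<^sup>+\<omega>. ennreal (exp (- \<theta> * t) * indicator {0<..} t) * indicator {\<omega> \<in> space M. H s \<omega> > t} \<omega> \<partial>M)"
      by (rule nn_integral_cong) (auto simp: f_def indicator_def)
    also have "\<dots> = ennreal (exp (- \<theta> * t) * indicator {0<..} t) * emeasure M {\<omega> \<in> space M. H s \<omega> > t}"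
      by (rule nn_integral_cmult_indicator) measurable
    also have "\<dots> = ennreal (exp (- \<theta> * t) * indicator {0<..} t * G s t)"
      unfolding G_def emeasure_eq_measure by (rule ennreal_mult[symmetric]) auto
    finally show "ennreal (exp (- \<theta> * t) * indicator {0<..} t * G s t) = (\<integral>\<^sup>+\<omega>. f \<omega> t \<partial>M)" ..
  qed
  also have "\<dots> = (\<integral>\<^sup>+\<omega>. \<integral>\<^sup>+t. f \<omega> t \<partial>lborel \<partial>M)" by (rule P.Fubini') measurable
  also have "\<dots> = (\<integral>\<^sup>+\<omega>. ennreal ((1 - exp (- \<theta> * H s \<omega>)) / \<theta>) \<partial>M)"
  proof (rule nn_integral_cong_AE, use AE_H_pos[OF s] in eventually_elim)
    case (elim \<omega>)
    have "(\<integral>\<^sup>+t. f \<omega> t \<partial>lborel) = (\<integral>\<^sup>+t. ennreal (exp (- \<theta> * t)) * indicator {0..<H s \<omega>} t \<partial>lborel)"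
      by (rule nn_integral_cong_AE, use AE_lborel_singleton[of 0] in eventually_elim)
         (auto simp: f_def indicator_def)
    then show ?case using nn_integral_exp_Ico[OF \<theta> elim] by simp
  qed
  also have "\<dots> = ennreal (expectation (\<lambda>\<omega>. (1 - exp (- \<theta> * H s \<omega>)) / \<theta>))"
  proof (rule nn_integral_eq_integral)
    show "integrable M (\<lambda>\<omega>. (1 - exp (- \<theta> * H s \<omega>)) / \<theta>)"
      by (intro integrable_divide Bochner_Integration.integrable_diff H_exp_integrable) (use \<theta> s in auto)
    show "AE \<omega> in M. 0 \<le> (1 - exp (- \<theta> * H s \<omega>)) / \<theta>"
      using AE_H_pos[OF s] by eventually_elim (use \<theta> in \<open>simp add: divide_nonneg_pos\<close>)
  qed
  also have "expectation (\<lambda>\<omega>. (1 - exp (- \<theta> * H s \<omega>)) / \<theta>) = (1 - exp (- s * g \<theta>)) / \<theta>"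
    using H_laplace[of s \<theta>] H_exp_integrable[of s \<theta>] \<theta> s by (simp add: prob_space)
  finally show ?thesis .
qed

lemma relax_laplace:
  assumes \<mu>: "\<mu> > 0" and \<theta>: "\<theta> > 0"
  shows "set_integrable lborel {0..} (\<lambda>t. exp (- \<theta> * t) * relax \<mu> t)"
    and "(LINT t:{0..}|lborel. exp (- \<theta> * t) * relax \<mu> t) = g \<theta> / (\<theta> * (g \<theta> + \<mu>))"
proof -
  define f :: "real \<Rightarrow> real \<Rightarrow> ennreal"
    where "f s t = ennreal (exp (- \<theta> * t)) * ennreal (exp_kernel \<mu> s * indicator {0<..} t * G s t)" for s t
  have [measurable]: "(\<lambda>x. exp_kernel \<mu> (fst x) * indicator {0<..} (snd x) * G (fst x) (snd x)) \<in> borel_measurable (lborel \<Otimes>\<^sub>M lborel)"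
    using kernel_G_measurable2[of \<mu>] by (simp add: case_prod_beta')
  have fm[measurable]: "case_prod f \<in> borel_measurable (lborel \<Otimes>\<^sub>M lborel)"
    unfolding f_def case_prod_beta' by measurable
  define q where "q t = indicator {0..} t *\<^sub>R (exp (- \<theta> * t) * relax \<mu> t)" for t
  have qm: "q \<in> borel_measurable lborel"
    using borel_measurable_continuous_onI[OF relax_continuous_on[OF \<mu>, of UNIV]] unfolding q_def by simp
  have qpos: "0 \<le> q t" for t using relax_bounds(1)[OF \<mu>] by (simp add: q_def)
  have "(\<integral>\<^sup>+t. ennreal (q t) \<partial>lborel) = (\<integral>\<^sup>+t. \<integral>\<^sup>+s. f s t \<partial>lborel \<partial>lborel)"
  proof (rule nn_integral_cong_AE, use AE_lborel_singleton[of 0] in eventually_elim)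
    case (elim t)
    show ?case
    proof (cases "t > 0")
      case True
      have "(\<integral>\<^sup>+s. f s t \<partial>lborel) = (\<integral>\<^sup>+s. ennreal (exp (- \<theta> * t)) * ennreal (exp_kernel \<mu> s * G s t) \<partial>lborel)"
        using True by (intro nn_integral_cong) (simp add: f_def)
      also have "\<dots> = ennreal (exp (- \<theta> * t)) * (\<integral>\<^sup>+s. ennreal (exp_kernel \<mu> s * G s t) \<partial>lborel)"
        using kernel_G_measurable[of \<mu> t] by (intro nn_integral_cmult) simp
      also have "(\<integral>\<^sup>+s. ennreal (exp_kernel \<mu> s * G s t) \<partial>lborel) = ennreal (relax \<mu> t)"
        unfolding relax_def using \<mu> by (intro nn_integral_eq_integral kernel_G_integrable) auto
      finally show ?thesis using True relax_bounds(1)[OF \<mu>] by (simp add: q_def ennreal_mult)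
    qed (use elim in \<open>auto simp: q_def f_def\<close>)
  qed
  also have "\<dots> = (\<integral>\<^sup>+s. \<integral>\<^sup>+t. f s t \<partial>lborel \<partial>lborel)" by (rule lborel_pair.Fubini'[OF fm])
  also have "\<dots> = (\<integral>\<^sup>+s. ennreal (exp_kernel \<mu> s * ((1 - exp (- s * g \<theta>)) / \<theta>)) \<partial>lborel)"
  proof (rule nn_integral_cong)
    fix s :: real
    show "(\<integral>\<^sup>+t. f s t \<partial>lborel) = ennreal (exp_kernel \<mu> s * ((1 - exp (- s * g \<theta>)) / \<theta>))"
    proof (cases "s > 0")
      case True
      have Gm: "G s \<in> borel_measurable borel"
        by (intro borel_measurable_continuous_onI continuous_at_imp_continuous_on ballI isCont_G True)
      have "(\<integral>\<^sup>+t. f s t \<partial>lborel) = (\<integral>\<^sup>+t. ennreal (exp_kernel \<mu> s) * ennreal (exp (- \<theta> * t) * indicator {0<..} t * G s t) \<partial>lborel)"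
        using \<mu> by (intro nn_integral_cong) (simp add: f_def ennreal_mult[symmetric] mult_ac)
      also have "\<dots> = ennreal (exp_kernel \<mu> s) * (\<integral>\<^sup>+t. ennreal (exp (- \<theta> * t) * indicator {0<..} t * G s t) \<partial>lborel)"
        using Gm by (intro nn_integral_cmult) measurable
      also have "\<dots> = ennreal (exp_kernel \<mu> s * ((1 - exp (- s * g \<theta>)) / \<theta>))"
        unfolding G_laplace[OF \<theta> True] using \<mu> by (intro ennreal_mult''[symmetric] divide_nonneg_pos) (use \<theta> True g_pos[OF \<theta>] in auto)
      finally show ?thesis .
    qed (simp add: f_def exp_kernel_def)
  qed
  finally have eq1: "(\<integral>\<^sup>+t. ennreal (q t) \<partial>lborel) = (\<integral>\<^sup>+s. ennreal (exp_kernel \<mu> s * ((1 - exp (- s * g \<theta>)) / \<theta>)) \<partial>lborel)" .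
  have \<mu>g: "\<mu> + g \<theta> > 0" using \<mu> g_pos[OF \<theta>] by simp
  \<comment> \<open>An exponential density times \<open>exp (- s * g \<theta>)\<close> is a multiple
    of the exponential density with rate \<open>\<mu> + g \<theta>\<close>, so both integrals are
    known.\<close>
  have ks: "exp_kernel \<mu> s * ((1 - exp (- s * g \<theta>)) / \<theta>)
      = (1 / \<theta>) * exp_kernel \<mu> s - (1 / \<theta>) * (\<mu> / (\<mu> + g \<theta>)) * exp_kernel (\<mu> + g \<theta>) s" for s
  proof -
    have "exp (- \<mu> * s) * exp (- s * g \<theta>) = exp (- (\<mu> + g \<theta>) * s)" by (simp add: mult_exp_exp algebra_simps)
    then have "exp_kernel \<mu> s * exp (- s * g \<theta>) = (\<mu> / (\<mu> + g \<theta>)) * exp_kernel (\<mu> + g \<theta>) s"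
      using \<mu>g by (simp add: exp_kernel_def mult.assoc)
    then show ?thesis by (simp add: right_diff_distrib diff_divide_distrib)
  qed
  have ki: "integrable lborel (\<lambda>s. exp_kernel \<mu> s * ((1 - exp (- s * g \<theta>)) / \<theta>))"
    "(\<integral>s. exp_kernel \<mu> s * ((1 - exp (- s * g \<theta>)) / \<theta>) \<partial>lborel) = 1 / \<theta> - (1 / \<theta>) * (\<mu> / (\<mu> + g \<theta>))"
    unfolding ks using exp_kernel_integral[OF \<mu>] exp_kernel_integral[OF \<mu>g] by simp_all
  have "(\<integral>\<^sup>+s. ennreal (exp_kernel \<mu> s * ((1 - exp (- s * g \<theta>)) / \<theta>)) \<partial>lborel) = ennreal (1 / \<theta> - (1 / \<theta>) * (\<mu> / (\<mu> + g \<theta>)))"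
    unfolding ki(2)[symmetric]
  proof (rule nn_integral_eq_integral[OF ki(1)], rule AE_I2)
    fix s
    show "0 \<le> exp_kernel \<mu> s * ((1 - exp (- s * g \<theta>)) / \<theta>)"
      using \<mu> \<theta> g_pos[OF \<theta>] by (cases "s > 0") (auto intro!: mult_nonneg_nonneg divide_nonneg_pos simp: exp_kernel_def)
  qed
  then have eq: "(\<integral>\<^sup>+t. ennreal (q t) \<partial>lborel) = ennreal (1 / \<theta> - (1 / \<theta>) * (\<mu> / (\<mu> + g \<theta>)))"
    unfolding eq1 .
  have "integrable lborel q" by (rule integrableI_nonneg) (use qm qpos eq in auto)
  then show "set_integrable lborel {0..} (\<lambda>t. exp (- \<theta> * t) * relax \<mu> t)"
    unfolding q_def set_integrable_def .
  have val: "1 / \<theta> - (1 / \<theta>) * (\<mu> / (\<mu> + g \<theta>)) = g \<theta> / (\<theta> * (g \<theta> + \<mu>))"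
  proof -
    have "1 - \<mu> / (\<mu> + g \<theta>) = g \<theta> / (\<mu> + g \<theta>)" using \<mu>g by (simp add: field_simps)
    then have "(1 / \<theta>) * (1 - \<mu> / (\<mu> + g \<theta>)) = g \<theta> / (\<theta> * (g \<theta> + \<mu>))" by (simp add: add.commute)
    then show ?thesis by (simp add: right_diff_distrib)
  qed
  have "(\<integral>t. q t \<partial>lborel) = g \<theta> / (\<theta> * (g \<theta> + \<mu>))"
    using eq \<mu>g \<theta> \<mu> g_pos[OF \<theta>] unfolding val by (subst integral_eq_nn_integral) (use qm qpos in auto)
  then show "(LINT t:{0..}|lborel. exp (- \<theta> * t) * relax \<mu> t) = g \<theta> / (\<theta> * (g \<theta> + \<mu>))"
    unfolding q_def set_lebesgue_integral_def .
qed

end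

lemma laplace_1:
  fixes \<theta> :: real
  assumes "\<theta> > 0"
  shows "set_integrable lborel {0..} (\<lambda>t. exp (- \<theta> * t) * 1)"
    and "(LINT t:{0..}|lborel. exp (- \<theta> * t) * 1) = 1 / \<theta>"
proof -
  have ae: "AE t in lborel. (1 / \<theta>) * exp_kernel \<theta> t = indicator {0..} t *\<^sub>R (exp (- \<theta> * t) * 1)"
    using AE_lborel_singleton[of 0]
    by eventually_elim (use assms in \<open>auto simp: exp_kernel_def indicator_def\<close>)
  have k: "integrable lborel (\<lambda>t. (1 / \<theta>) * exp_kernel \<theta> t)"
    using exp_kernel_integral(1)[OF assms] by (rule integrable_mult_right)
  have [measurable]: "(\<lambda>t. indicator {0..} t *\<^sub>R (exp (- \<theta> * t) * 1)) \<in> borel_measurable lborel" by measurable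
  show "set_integrable lborel {0..} (\<lambda>t. exp (- \<theta> * t) * 1)"
    unfolding set_integrable_def
    using integrable_cong_AE[OF borel_measurable_integrable[OF k] _ ae] k by simp
  have "(LINT t:{0..}|lborel. exp (- \<theta> * t) * 1) = (\<integral>t. (1 / \<theta>) * exp_kernel \<theta> t \<partial>lborel)"
    unfolding set_lebesgue_integral_def
    by (rule integral_cong_AE[symmetric, OF borel_measurable_integrable[OF k] _ ae]) measurable
  then show "(LINT t:{0..}|lborel. exp (- \<theta> * t) * 1) = 1 / \<theta>"
    using exp_kernel_integral(2)[OF assms] by simp
qed

section \<open>The relaxation equation and the modes\<close>

context inverse_subordinator_density begin

abbreviation "w \<equiv> levy_tail \<nu>"

text \<open>Both sides are continuous, so equality of the Laplace transforms gives equality at every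
  \<open>t\<close>, not only almost everywhere.\<close>

lemma relax_equation:
  assumes \<mu>: "\<mu> > 0" and "t \<ge> 0"
  shows "vconv w (\<lambda>s. 1 - relax \<mu> s) t + b * (1 - relax \<mu> t) = \<mu> * vconv (\<lambda>_. 1) (relax \<mu>) t"
proof -
  define e where "e s = 1 - relax \<mu> s" for s
  have ec: "continuous_on A e" for A unfolding e_def by (intro continuous_intros relax_continuous_on \<mu>)
  define F where "F t = vconv w e t + b * e t - \<mu> * vconv (\<lambda>_. 1) (relax \<mu>) t" for t
  have "F t = 0"
  proof (rule laplace_transform_eq_0_imp[OF _ _ _ \<open>t \<ge> 0\<close>])
    show "continuous_on {0..} F"
      unfolding F_def
      by (intro continuous_on_halfline continuous_intros continuous_on_vconv set_integrable_levy_tail[OF levy] set_integrable_const_1 ec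
          relax_continuous_on \<mu>)
    fix \<theta> :: real assume \<theta>: "\<theta> > 0"
    note lw = levy_tail_laplace[OF levy \<theta>]
    note lr = relax_laplace[OF \<mu> \<theta>]
    note l1 = laplace_1[OF \<theta>]
    have eq: "exp (- \<theta> * t) * e t = exp (- \<theta> * t) * 1 - exp (- \<theta> * t) * relax \<mu> t" for t
      by (simp add: e_def right_diff_distrib)
    have le: "set_integrable lborel {0..} (\<lambda>t. exp (- \<theta> * t) * e t)"
      "(LINT t:{0..}|lborel. exp (- \<theta> * t) * e t) = 1 / \<theta> - g \<theta> / (\<theta> * (g \<theta> + \<mu>))"
      unfolding eq
      by (intro set_integral_diff l1 lr) (subst set_integral_diff(2)[OF l1(1) lr(1)], simp only: l1 lr)
    note c1 = laplace_vconv[OF lw(1) le(1)]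
    note c2 = laplace_vconv[OF l1(1) lr(1)]
    have F: "exp (- \<theta> * t) * F t = (exp (- \<theta> * t) * vconv w e t + b * (exp (- \<theta> * t) * e t))
        - \<mu> * (exp (- \<theta> * t) * vconv (\<lambda>_. 1) (relax \<mu>) t)" for t
      by (simp add: F_def algebra_simps)
    have i1: "set_integrable lborel {0..} (\<lambda>t. b * (exp (- \<theta> * t) * e t))"
      by (rule set_integrable_mult_right) (rule le(1))
    have i2: "set_integrable lborel {0..} (\<lambda>t. \<mu> * (exp (- \<theta> * t) * vconv (\<lambda>_. 1) (relax \<mu>) t))"
      by (rule set_integrable_mult_right) (rule c2(1))
    show "set_integrable lborel {0..} (\<lambda>t. exp (- \<theta> * t) * F t)"
      unfolding F by (intro set_integral_diff(1) set_integral_add(1) c1 i1 i2)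
    have "(LINT t:{0..}|lborel. exp (- \<theta> * t) * F t) =
       (g \<theta> / \<theta> - b) * (1 / \<theta> - g \<theta> / (\<theta> * (g \<theta> + \<mu>))) + b * (1 / \<theta> - g \<theta> / (\<theta> * (g \<theta> + \<mu>)))
       - \<mu> * (1 / \<theta> * (g \<theta> / (\<theta> * (g \<theta> + \<mu>))))"
      unfolding F
      by (subst set_integral_diff(2)[OF set_integral_add(1)[OF c1(1) i1] i2],
          subst set_integral_add(2)[OF c1(1) i1])
         (simp only: set_integral_mult_right c1(2) c2(2) le(2) lw(2)[of b] l1(2) lr(2))
    also have "\<dots> = 0"
    proof -
      have "g \<theta> + \<mu> \<noteq> 0" using g_pos[OF \<theta>] \<mu> by simp
      \<comment> \<open>The transform of \<open>1 - relax \<mu>\<close>. The two terms with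
        \<open>b\<close> cancel, and both remaining products equal \<open>\<mu> * g \<theta> /
        (\<theta>\<^sup>2 * (g \<theta> + \<mu>))\<close>.\<close>
      then have q: "1 / \<theta> - g \<theta> / (\<theta> * (g \<theta> + \<mu>)) = \<mu> / (\<theta> * (g \<theta> + \<mu>))"
        using \<theta> by (simp add: divide_simps)
      show ?thesis unfolding q distrib_right[symmetric] diff_add_cancel by (simp add: mult.commute)
    qed
    finally show "(LINT t:{0..}|lborel. exp (- \<theta> * t) * F t) = 0" .
  qed
  then show ?thesis by (simp add: F_def e_def[abs_def])
qed

text \<open>The coefficient function \<open>d_coeff\<close>, continued by 1 to
  \<open>t \<le> 0\<close>. The case \<open>k = 0\<close> is separate because
  \<open>exp_kernel 0\<close> vanishes and \<open>relax 0\<close> would be 0 instead of 1.\<close>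

definition mode :: "nat \<Rightarrow> real \<Rightarrow> real" where
  "mode k t = (if k = 0 then 1 else relax ((real k)\<^sup>2 / 2) t)"

lemma mode_continuous_on: "continuous_on A (mode k)"
  unfolding mode_def[abs_def] by (cases "k = 0") (auto intro!: relax_continuous_on)

lemma mode_le_1: "\<bar>mode k t\<bar> \<le> 1"
  using relax_bounds[of "(real k)\<^sup>2 / 2" t] by (simp add: mode_def)

lemma mode_0 [simp]: "mode k 0 = 1"
  by (simp add: mode_def relax_nonpos)

lemma mode_d_coeff: "t > 0 \<Longrightarrow> d_coeff M H k t = mode k t"
  using relax_expectation[of "(real k)\<^sup>2 / 2" t] by (cases "k = 0") (simp_all add: mode_def d_coeff_def prob_space)

lemma mode_equation:
  assumes "t \<ge> 0"
  shows "vconv w (\<lambda>s. mode k s - 1) t + b * (mode k t - 1) = - ((real k)\<^sup>2 / 2) * vconv (\<lambda>_. 1) (mode k) t"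
proof (cases "k = 0")
  case True
  then show ?thesis by (simp add: mode_def vconv_def)
next
  case False
  have m: "vconv w (\<lambda>s. mode k s - 1) t = - vconv w (\<lambda>s. 1 - mode k s) t"
    using vconv_scale[of w "-1" "\<lambda>s. 1 - mode k s" t] by simp
  show ?thesis
    unfolding m using relax_equation[OF _ assms, of "(real k)\<^sup>2 / 2"] False
    by (simp add: mode_def[abs_def] right_diff_distrib)
qed

lemma mode_laplace:
  assumes \<theta>: "\<theta> > 0"
  shows "set_integrable lborel {0..} (\<lambda>t. exp (- \<theta> * t) * mode k t)"
    and "(LINT t:{0..}|lborel. exp (- \<theta> * t) * mode k t) = d_laplace g k \<theta>"
proof -
  have "set_integrable lborel {0..} (\<lambda>t. exp (- \<theta> * t) * mode k t) \<and>
    (LINT t:{0..}|lborel. exp (- \<theta> * t) * mode k t) = d_laplace g k \<theta>"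
  proof (cases "k = 0")
    case True
    then show ?thesis using laplace_1[OF \<theta>] g_pos[OF \<theta>] by (simp add: mode_def d_laplace_def)
  next
    case False
    then have "(real k)\<^sup>2 / 2 > 0" by simp
    from relax_laplace[OF this \<theta>] False show ?thesis by (simp add: mode_def d_laplace_def)
  qed
  then show "set_integrable lborel {0..} (\<lambda>t. exp (- \<theta> * t) * mode k t)"
    and "(LINT t:{0..}|lborel. exp (- \<theta> * t) * mode k t) = d_laplace g k \<theta>" by auto
qed

lemma mode_unique:
  fixes c :: "real \<Rightarrow> complex"
  assumes c: "continuous_on {0..} c"
    and eq: "\<And>t. t \<ge> 0 \<Longrightarrow> vconv w c t + b *\<^sub>R c t = - ((real k)\<^sup>2 / 2) *\<^sub>R vconv (\<lambda>_. 1) c t"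
    and "t \<ge> 0"
  shows "c t = 0"
proof (rule relaxation_unique[where D=relax and l="(real k)\<^sup>2 / 2" and w=w and b=b, OF _ _ _ _ _ c _ _ \<open>t \<ge> 0\<close>])
  show "set_integrable lborel {0..T} w" for T by (rule set_integrable_levy_tail[OF levy])
  show "\<bar>relax \<mu> t\<bar> \<le> 1" if "\<mu> > 0" for \<mu> t using relax_bounds[OF that, of t] by simp
qed (simp_all add: relax_continuous_on relax_tendsto_1 relax_equation eq del: of_nat_Suc)

end

section \<open>Power series with time-dependent coefficients\<close>

text \<open>The integrals of the term norms are at most \<open>A k\<close> times the L1 norm of
  \<open>w\<close> on \<open>{0..t}\<close>, so summation and integration may be exchanged.\<close>

lemma vconv_sums:
  fixes S :: "nat \<Rightarrow> real \<Rightarrow> 'b::{banach,second_countable_topology}"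
  assumes w: "set_integrable lborel {0..t} w" and S: "\<And>k. continuous_on {0..t} (S k)"
    and le: "\<And>k s. 0 \<le> s \<Longrightarrow> s \<le> t \<Longrightarrow> norm (S k s) \<le> A k" and A: "summable A" and "t \<ge> 0"
  shows "(\<lambda>k. vconv w (S k) t) sums vconv w (\<lambda>s. \<Sum>k. S k s) t"
proof -
  have wr: "set_integrable lborel {0..t} (\<lambda>s. \<bar>w (t - s)\<bar>)"
    using set_integrable_reflect[OF w] by (rule set_integrable_abs)
  define I where "I = (\<integral>s. indicator {0..t} s * \<bar>w (t - s)\<bar> \<partial>lborel)"
  have sm: "summable (\<lambda>k. norm (S k s))" if "0 \<le> s" "s \<le> t" for s
    using le[OF that] by (intro summable_comparison_test'[OF A]) simp
  have A0: "A k \<ge> 0" for k using le[of 0 k] \<open>t \<ge> 0\<close> norm_ge_zero order_trans by blast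
  have i: "integrable lborel (\<lambda>s. indicator {0..t} s *\<^sub>R (w (t - s) *\<^sub>R S k s))" for k
    using set_integrable_vconv[OF w S] unfolding set_integrable_def .
  have "(\<lambda>k. vconv w (S k) t) sums (\<integral>s. (\<Sum>k. indicator {0..t} s *\<^sub>R (w (t - s) *\<^sub>R S k s)) \<partial>lborel)"
    unfolding vconv_def set_lebesgue_integral_def
  proof (rule sums_integral[OF i])
    show "AE s in lborel. summable (\<lambda>k. norm (indicator {0..t} s *\<^sub>R (w (t - s) *\<^sub>R S k s)))"
      using sm by (intro AE_I2) (auto simp: indicator_def intro: summable_mult)
    have "(\<integral>s. norm (indicator {0..t} s *\<^sub>R (w (t - s) *\<^sub>R S k s)) \<partial>lborel) \<le> (\<integral>s. A k * (indicator {0..t} s * \<bar>w (t - s)\<bar>) \<partial>lborel)" for k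
      using wr[unfolded set_integrable_def]
      by (intro integral_mono integrable_norm i integrable_mult_right)
         (auto simp: indicator_def mult.commute[of "A k"] intro!: mult_left_mono le)
    then have le: "norm (\<integral>s. norm (indicator {0..t} s *\<^sub>R (w (t - s) *\<^sub>R S k s)) \<partial>lborel) \<le> A k * I" for k
      by (simp add: I_def)
    show "summable (\<lambda>k. \<integral>s. norm (indicator {0..t} s *\<^sub>R (w (t - s) *\<^sub>R S k s)) \<partial>lborel)"
      by (rule summable_comparison_test'[OF summable_mult2[OF A, of I]]) (rule le)
  qed
  also have "(\<integral>s. (\<Sum>k. indicator {0..t} s *\<^sub>R (w (t - s) *\<^sub>R S k s)) \<partial>lborel) = vconv w (\<lambda>s. \<Sum>k. S k s) t"
    unfolding vconv_def set_lebesgue_integral_def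
  proof (rule Bochner_Integration.integral_cong[OF refl])
    fix s
    show "(\<Sum>k. indicator {0..t} s *\<^sub>R (w (t - s) *\<^sub>R S k s)) = indicator {0..t} s *\<^sub>R (w (t - s) *\<^sub>R (\<Sum>k. S k s))"
    proof (cases "s \<in> {0..t}")
      case True
      then have "summable (\<lambda>k. S k s)" using summable_norm_cancel[OF sm[of s]] by simp
      then show ?thesis using True by (simp add: suminf_scaleR_right[symmetric])
    qed simp
  qed
  finally show ?thesis .
qed

lemma continuous_on_suminf:
  fixes S :: "nat \<Rightarrow> 'a::topological_space \<Rightarrow> 'b::banach"
  assumes S: "\<And>k. continuous_on X (S k)"
    and le: "\<And>k s. s \<in> X \<Longrightarrow> norm (S k s) \<le> A k" and A: "summable A"
  shows "continuous_on X (\<lambda>s. \<Sum>k. S k s)"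
proof (rule uniform_limit_theorem)
  show "uniform_limit X (\<lambda>n s. \<Sum>k<n. S k s) (\<lambda>s. \<Sum>k. S k s) sequentially"
    by (rule Weierstrass_m_test) (use le A in auto)
qed (auto intro!: always_eventually continuous_on_sum S)

section \<open>Angular derivatives of power series\<close>

lemma summable_index_power_series:
  fixes c :: "nat \<Rightarrow> 'a::{real_normed_field,banach}"
  assumes "\<And>z. norm z < R \<Longrightarrow> summable (\<lambda>k. c k * z ^ k)" and z: "norm z < R"
  shows "summable (\<lambda>k. of_nat k * c k * z ^ k)"
proof -
  \<comment> \<open>This is \<open>z\<close> times the derived series; its coefficient at
    \<open>z ^ k\<close> is \<open>k\<close> times \<open>c k\<close>.\<close>
  have "summable (\<lambda>k. z * (diffs c k * z ^ k))"
    by (intro summable_mult termdiff_converges[OF z assms(1)])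
  then have "summable (\<lambda>k. of_nat (Suc k) * c (Suc k) * z ^ Suc k)"
    by (simp add: diffs_def mult_ac)
  then show ?thesis by (subst (asm) summable_Suc_iff)
qed

lemma summable_square_geometric:
  fixes q :: real
  assumes "0 \<le> q" "q < 1"
  shows "summable (\<lambda>k. (1 + (real k)\<^sup>2) * q ^ k)"
proof -
  have 0: "norm z < 1 \<Longrightarrow> summable (\<lambda>k. 1 * z ^ k)" for z :: real by (simp add: summable_geometric)
  have 1: "norm z < 1 \<Longrightarrow> summable (\<lambda>k. real k * z ^ k)" for z :: real
    using summable_index_power_series[of 1 "\<lambda>_. 1", OF 0] by simp
  have 2: "norm z < 1 \<Longrightarrow> summable (\<lambda>k. real k * real k * z ^ k)" for z :: real
    using summable_index_power_series[of 1 real, OF 1] by simp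
  have "summable (\<lambda>k. 1 * q ^ k + real k * real k * q ^ k)"
    using assms by (intro summable_add 0 2) auto
  then show ?thesis by (simp add: distrib_right power2_eq_square)
qed

text \<open>The Euler operator \<open>z d/dz\<close> multiplies the coefficient of
  \<open>z ^ k\<close> by \<open>k\<close>. Shifting the index loses nothing, as the term at
  \<open>k = 0\<close> vanishes.\<close>

lemma sums_z_deriv:
  fixes v :: "complex \<Rightarrow> complex"
  assumes v: "\<And>z. norm z < 1 \<Longrightarrow> (\<lambda>k. c k * z ^ k) sums v z" and z: "norm z < 1"
  shows "v field_differentiable (at z)" and "(\<lambda>k. of_nat k * c k * z ^ k) sums (z * deriv v z)"
proof -
  have "v holomorphic_on ball 0 1"
    by (rule power_series_holomorphic[where a=c]) (use v in auto)
  then show fd: "v field_differentiable (at z)"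
    using z by (intro holomorphic_on_imp_differentiable_at) auto
  have "(\<lambda>k. z * (diffs c k * z ^ k)) sums (z * deriv v z)"
    by (intro sums_mult termdiffs_sums_strong[OF v _ z] field_differentiable_derivI fd)
  then have "(\<lambda>k. of_nat (Suc k) * c (Suc k) * z ^ Suc k) sums (z * deriv v z)"
    by (simp add: diffs_def mult_ac)
  then show "(\<lambda>k. of_nat k * c k * z ^ k) sums (z * deriv v z)"
    by (subst (asm) sums_Suc_iff) simp
qed

text \<open>On holomorphic functions the derivative in the angle is \<open>\<i>\<close> times the
  Euler operator.\<close>

lemma angular_derivative:
  assumes "v field_differentiable (at (rcis r \<alpha>))"
  shows "((\<lambda>\<beta>. v (rcis r \<beta>)) has_vector_derivative \<i> * (rcis r \<alpha> * deriv v (rcis r \<alpha>))) (at \<alpha>)"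
proof -
  have "((\<lambda>\<beta>. rcis r \<beta>) has_vector_derivative \<i> * rcis r \<alpha>) (at \<alpha>)"
  proof -
    have "((\<lambda>z. of_real r * exp (\<i> * z)) has_field_derivative of_real r * (exp (\<i> * of_real \<alpha>) * \<i>)) (at (of_real \<alpha>))"
      by (auto intro!: derivative_eq_intros)
    from has_vector_derivative_real_field[OF this] show ?thesis
      by (simp add: rcis_def cis_conv_exp mult_ac)
  qed
  from field_vector_diff_chain_at[OF this DERIV_deriv_iff_field_differentiable[THEN iffD2, OF assms]]
  show ?thesis by (simp add: o_def mult_ac)
qed

text \<open>Two angular derivatives multiply the coefficient of \<open>z ^ k\<close> by the square
  of \<open>\<i> * k\<close>. The first one is again a power series on the whole disk, so the same
  argument applies twice.\<close>

lemma angular_derivative2_sums: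
  assumes v: "\<And>z. norm z < 1 \<Longrightarrow> (\<lambda>k. c k * z ^ k) sums v z" and r: "0 < r" "r < 1"
  shows "(\<lambda>k. - ((real k)\<^sup>2) *\<^sub>R (c k * rcis r \<phi> ^ k)) sums angular_derivative2 v r \<phi>"
proof -
  define v1 where "v1 z = z * deriv v z" for z
  have v1: "(\<lambda>k. (of_nat k * c k) * z ^ k) sums v1 z" if "norm z < 1" for z
    using sums_z_deriv(2)[OF v that] unfolding v1_def .
  have n: "norm (rcis r \<beta>) < 1" for \<beta> using r by simp
  have d1: "vector_derivative (\<lambda>\<beta>. v (rcis r \<beta>)) (at \<alpha>) = \<i> * v1 (rcis r \<alpha>)" for \<alpha>
    unfolding v1_def by (intro vector_derivative_at angular_derivative sums_z_deriv(1)[OF v n])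
  have "((\<lambda>\<alpha>. \<i> * v1 (rcis r \<alpha>)) has_vector_derivative \<i> * (\<i> * (rcis r \<phi> * deriv v1 (rcis r \<phi>)))) (at \<phi>)"
    by (intro has_vector_derivative_mult_right angular_derivative sums_z_deriv(1)[OF v1 n])
  then have "angular_derivative2 v r \<phi> = - (rcis r \<phi> * deriv v1 (rcis r \<phi>))"
    unfolding angular_derivative2_def d1 by (simp add: vector_derivative_at)
  moreover have "(\<lambda>k. - (of_nat k * (of_nat k * c k) * rcis r \<phi> ^ k)) sums - (rcis r \<phi> * deriv v1 (rcis r \<phi>))"
    by (intro sums_minus sums_z_deriv(2)[OF v1 n])
  moreover have "- (of_nat k * (of_nat k * c k) * rcis r \<phi> ^ k) = - ((real k)\<^sup>2) *\<^sub>R (c k * rcis r \<phi> ^ k)" for k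
    by (simp add: scaleR_conv_of_real power2_eq_square mult_ac)
  ultimately show ?thesis by simp
qed

text \<open>Serves both the explicit series of \<open>W_op\<close> and the Taylor series of an
  arbitrary solution. The \<open>bound\<close> may depend on \<open>T\<close> and on the radius, so
  no growth condition in time is imposed.\<close>

locale time_power_series =
  fixes C :: "nat \<Rightarrow> real \<Rightarrow> complex"
  assumes cont: "\<And>k. continuous_on {0..} (C k)"
    and bound: "\<And>T \<rho>. 0 < \<rho> \<Longrightarrow> \<rho> < 1 \<Longrightarrow> \<exists>B. \<forall>k. \<forall>s\<in>{0..T}. norm (C k s) * \<rho> ^ k \<le> B"
begin

definition val :: "complex \<Rightarrow> real \<Rightarrow> complex" where
  "val z t = (\<Sum>k. C k t * z ^ k)"

text \<open>The right-hand side of the Cauchy problem as a series. In this form it also makes sense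
  at \<open>z = 0\<close> and is continuous down to \<open>t = 0\<close>, as integration in time
  requires.\<close>

definition half_angular :: "complex \<Rightarrow> real \<Rightarrow> complex" where
  "half_angular z t = (\<Sum>k. - ((real k)\<^sup>2 / 2) *\<^sub>R (C k t * z ^ k))"

lemma majorant:
  assumes "0 \<le> r" "r < 1"
  obtains A where "summable A" "\<And>k s z. s \<in> {0..T} \<Longrightarrow> norm z \<le> r \<Longrightarrow> (1 + (real k)\<^sup>2) * norm (C k s * z ^ k) \<le> A k"
proof -
  \<comment> \<open>The room between \<open>r\<close> and \<open>\<rho>\<close> leaves a geometric
    factor \<open>q < 1\<close>, which absorbs the polynomial weight in \<open>k\<close>.\<close>
  define \<rho> where "\<rho> = (1 + r) / 2"
  have \<rho>: "0 < \<rho>" "\<rho> < 1" "r < \<rho>" using assms by (auto simp: \<rho>_def)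
  obtain B where B: "\<And>k s. s \<in> {0..T} \<Longrightarrow> norm (C k s) * \<rho> ^ k \<le> B" using bound[OF \<rho>(1,2)] by metis
  define q where "q = r / \<rho>"
  have q: "0 \<le> q" "q < 1" using \<rho> assms by (auto simp: q_def)
  show ?thesis
  proof (rule that)
    show "summable (\<lambda>k. B * ((1 + (real k)\<^sup>2) * q ^ k))"
      by (intro summable_mult summable_square_geometric q)
    fix k s z assume s: "s \<in> {0..T}" and z: "norm (z::complex) \<le> r"
    have "norm (C k s * z ^ k) \<le> norm (C k s) * r ^ k"
      using z by (simp add: norm_mult norm_power mult_left_mono power_mono)
    also have "\<dots> = (norm (C k s) * \<rho> ^ k) * q ^ k" using \<rho> by (simp add: q_def power_divide)
    also have "\<dots> \<le> B * q ^ k" using B[OF s] q by (intro mult_right_mono) auto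
    finally have "(1 + (real k)\<^sup>2) * norm (C k s * z ^ k) \<le> (1 + (real k)\<^sup>2) * (B * q ^ k)"
      by (intro mult_left_mono) auto
    then show "(1 + (real k)\<^sup>2) * norm (C k s * z ^ k) \<le> B * ((1 + (real k)\<^sup>2) * q ^ k)"
      by (simp add: mult_ac)
  qed
qed

lemma majorant1:
  assumes "0 \<le> r" "r < 1"
  obtains A where "summable A" "\<And>k s z. s \<in> {0..T} \<Longrightarrow> norm z \<le> r \<Longrightarrow> norm (C k s * z ^ k) \<le> A k"
    "\<And>k s z. s \<in> {0..T} \<Longrightarrow> norm z \<le> r \<Longrightarrow> norm (- ((real k)\<^sup>2 / 2) *\<^sub>R (C k s * z ^ k)) \<le> A k"
proof -
  obtain A where A: "summable A" "\<And>k s z. s \<in> {0..T} \<Longrightarrow> norm z \<le> r \<Longrightarrow> (1 + (real k)\<^sup>2) * norm (C k s * z ^ k) \<le> A k"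
    using majorant[OF assms] by metis
  show ?thesis
  proof (rule that[OF A(1)])
    fix k s and z :: complex assume sz: "s \<in> {0..T}" "norm z \<le> r"
    have "1 * norm (C k s * z ^ k) \<le> (1 + (real k)\<^sup>2) * norm (C k s * z ^ k)"
      by (intro mult_right_mono) auto
    then show "norm (C k s * z ^ k) \<le> A k" using A(2)[OF sz, of k] by simp
    have "((real k)\<^sup>2 / 2) * norm (C k s * z ^ k) \<le> (1 + (real k)\<^sup>2) * norm (C k s * z ^ k)"
      by (intro mult_right_mono) auto
    then show "norm (- ((real k)\<^sup>2 / 2) *\<^sub>R (C k s * z ^ k)) \<le> A k" using A(2)[OF sz, of k] by simp
  qed
qed

lemma val_sums: assumes "norm z < 1" "t \<ge> 0" shows "(\<lambda>k. C k t * z ^ k) sums val z t"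
proof -
  obtain A where A: "summable A" "\<And>k s y. s \<in> {0..t} \<Longrightarrow> norm y \<le> norm z \<Longrightarrow> norm (C k s * y ^ k) \<le> A k"
    using majorant1[of "norm z" t] assms(1) by (metis norm_ge_zero)
  have "summable (\<lambda>k. C k t * z ^ k)"
    by (rule summable_comparison_test'[OF A(1)]) (use A(2)[of t z] assms in auto)
  then show ?thesis unfolding val_def by (rule summable_sums)
qed

lemma half_angular_sums:
  assumes "norm z < 1" "t \<ge> 0"
  shows "(\<lambda>k. - ((real k)\<^sup>2 / 2) *\<^sub>R (C k t * z ^ k)) sums half_angular z t"
proof -
  obtain A where A: "summable A"
    "\<And>k s y. s \<in> {0..t} \<Longrightarrow> norm y \<le> norm z \<Longrightarrow> norm (- ((real k)\<^sup>2 / 2) *\<^sub>R (C k s * y ^ k)) \<le> A k"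
    using majorant1[of "norm z" t] assms(1) by (metis norm_ge_zero)
  have "summable (\<lambda>k. - ((real k)\<^sup>2 / 2) *\<^sub>R (C k t * z ^ k))"
    by (rule summable_comparison_test'[OF A(1)]) (use A(2)[of t z] assms in auto)
  then show ?thesis unfolding half_angular_def by (rule summable_sums)
qed

lemma term_continuous: "continuous_on {0..t} (\<lambda>s. C k s * z ^ k)"
  by (intro continuous_on_mult continuous_on_const continuous_on_subset[OF cont]) auto

lemma val_continuous: assumes "norm z < 1" shows "continuous_on {0..} (val z)"
proof (rule continuous_on_halfline)
  fix T
  obtain A where A: "summable A" "\<And>k s y. s \<in> {0..T} \<Longrightarrow> norm y \<le> norm z \<Longrightarrow> norm (C k s * y ^ k) \<le> A k"
    using majorant1[of "norm z" T] assms by (metis norm_ge_zero)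
  show "continuous_on {0..T} (val z)"
    unfolding val_def[abs_def]
    by (rule continuous_on_suminf[OF term_continuous A(2)[OF _ order_refl] A(1)])
qed

lemma val_continuous2: "continuous_on (ball 0 1 \<times> {0..}) (\<lambda>(z, t). val z t)"
  unfolding continuous_on_eq_continuous_within
proof
  fix x :: "complex \<times> real" assume x: "x \<in> ball 0 1 \<times> {0..}"
  define r where "r = (1 + norm (fst x)) / 2"
  define T where "T = snd x + 1"
  have r: "0 \<le> r" "r < 1" "norm (fst x) < r" using x by (auto simp: r_def)
  obtain A where A: "summable A" "\<And>k s y. s \<in> {0..T} \<Longrightarrow> norm y \<le> r \<Longrightarrow> norm (C k s * y ^ k) \<le> A k"
    using majorant1[OF r(1,2), of T] by metis
  have "continuous_on (ball 0 r \<times> {0..T}) (\<lambda>p. \<Sum>k. C k (snd p) * fst p ^ k)"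
  proof (rule continuous_on_suminf[OF _ _ A(1)])
    show "continuous_on (ball 0 r \<times> {0..T}) (\<lambda>p. C k (snd p) * fst p ^ k)" for k
      by (intro continuous_intros continuous_on_compose2[OF cont]) auto
    show "norm (C k (snd p) * fst p ^ k) \<le> A k" if "p \<in> ball 0 r \<times> {0..T}" for k p
      using that by (intro A(2)) auto
  qed
  moreover have "x \<in> ball 0 r \<times> {0..T}" using x r by (auto simp: T_def mem_Times_iff)
  ultimately have "continuous (at x within ball 0 r \<times> {0..T}) (\<lambda>(z, t). val z t)"
    unfolding continuous_on_eq_continuous_within val_def case_prod_beta' by blast
  moreover have "at x within ball 0 r \<times> {0..T} = at x within ball 0 1 \<times> {0..}"
  proof (rule at_within_nhd[where S="ball 0 r \<times> {..<T}"])
    show "x \<in> ball 0 r \<times> {..<T}" using x r by (auto simp: T_def mem_Times_iff)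
    show "open (ball (0::complex) r \<times> {..<T})" by (intro open_Times) auto
    show "ball 0 r \<times> {0..T} \<inter> ball 0 r \<times> {..<T} - {x} = ball 0 1 \<times> {0..} \<inter> ball 0 r \<times> {..<T} - {x}"
      using r by auto
  qed
  ultimately show "continuous (at x within ball 0 1 \<times> {0..}) (\<lambda>(z, t). val z t)" by simp
qed

lemma half_angular_continuous: assumes "norm z < 1" shows "continuous_on {0..} (half_angular z)"
proof (rule continuous_on_halfline)
  fix T
  obtain A where A: "summable A"
    "\<And>k s y. s \<in> {0..T} \<Longrightarrow> norm y \<le> norm z \<Longrightarrow> norm (- ((real k)\<^sup>2 / 2) *\<^sub>R (C k s * y ^ k)) \<le> A k"
    using majorant1[of "norm z" T] assms by (metis norm_ge_zero)
  show "continuous_on {0..T} (half_angular z)"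
    unfolding half_angular_def[abs_def]
    by (rule continuous_on_suminf[OF _ A(2)[OF _ order_refl] A(1)])
       (intro continuous_on_scaleR continuous_on_const term_continuous)
qed

lemma half_angular_eq:
  assumes "0 < r" "r < 1" "t \<ge> 0" and u: "\<And>z. norm z < 1 \<Longrightarrow> u z = val z t"
  shows "half_angular (rcis r \<phi>) t = (1 / 2) *\<^sub>R angular_derivative2 u r \<phi>"
proof -
  have us: "(\<lambda>k. C k t * z ^ k) sums u z" if "norm z < 1" for z
    using val_sums[OF that assms(3)] u[OF that] by simp
  have "(\<lambda>k. (1 / 2) *\<^sub>R (- ((real k)\<^sup>2) *\<^sub>R (C k t * rcis r \<phi> ^ k))) sums ((1 / 2) *\<^sub>R angular_derivative2 u r \<phi>)"
    by (intro sums_scaleR_right angular_derivative2_sums[OF us assms(1,2)])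
  moreover have "(1 / 2) *\<^sub>R (- ((real k)\<^sup>2) *\<^sub>R (C k t * rcis r \<phi> ^ k)) = - ((real k)\<^sup>2 / 2) *\<^sub>R (C k t * rcis r \<phi> ^ k)" for k
    by simp
  ultimately show ?thesis
    using half_angular_sums[of "rcis r \<phi>" t] assms sums_unique2 by force
qed

text \<open>Used in both directions: to obtain the equation of \<open>W_op\<close> from its modes,
  and to extract the equation of each coefficient from that of a given solution.\<close>

lemma val_equation_sums:
  assumes z: "norm z < 1" and t: "t \<ge> 0" and w: "set_integrable lborel {0..t} w"
  shows "(\<lambda>k. (vconv w (\<lambda>s. C k s - C k 0) t + b *\<^sub>R (C k t - C k 0)) * z ^ k) sums
       (vconv w (\<lambda>s. val z s - val z 0) t + b *\<^sub>R (val z t - val z 0))"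
proof -
  obtain A where A: "summable A" "\<And>k s y. s \<in> {0..t} \<Longrightarrow> norm y \<le> norm z \<Longrightarrow> norm (C k s * y ^ k) \<le> A k"
    using majorant1[of "norm z" t] z by (metis norm_ge_zero)
  have le: "norm (C k s * z ^ k - C k 0 * z ^ k) \<le> A k + A k" if "0 \<le> s" "s \<le> t" for k s
    by (rule order_trans[OF norm_triangle_ineq4] add_mono)+ (use A(2) that t in auto)
  have "(\<lambda>k. vconv w (\<lambda>s. C k s * z ^ k - C k 0 * z ^ k) t) sums vconv w (\<lambda>s. \<Sum>k. C k s * z ^ k - C k 0 * z ^ k) t"
    by (rule vconv_sums[OF w _ le summable_add[OF A(1) A(1)] t])
       (intro continuous_on_diff term_continuous continuous_on_const)
  also have "vconv w (\<lambda>s. \<Sum>k. C k s * z ^ k - C k 0 * z ^ k) t = vconv w (\<lambda>s. val z s - val z 0) t"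
    by (rule vconv_cong) (use val_sums[OF z] in \<open>auto intro!: sums_unique[symmetric] sums_diff\<close>)
  finally have 1: "(\<lambda>k. vconv w (\<lambda>s. C k s * z ^ k - C k 0 * z ^ k) t) sums vconv w (\<lambda>s. val z s - val z 0) t" .
  have e: "vconv w (\<lambda>s. C k s * z ^ k - C k 0 * z ^ k) t = vconv w (\<lambda>s. C k s - C k 0) t * z ^ k" for k
    unfolding left_diff_distrib[symmetric]
    by (rule vconv_linear[OF bounded_linear_mult_left w]) (intro continuous_intros continuous_on_subset[OF cont], auto)
  have "(\<lambda>k. b *\<^sub>R (C k t * z ^ k - C k 0 * z ^ k)) sums (b *\<^sub>R (val z t - val z 0))"
    by (intro sums_scaleR_right sums_diff val_sums z t order_refl)
  from sums_add[OF 1[unfolded e] this] show ?thesis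
    by (simp add: algebra_simps)
qed

lemma half_angular_integral_sums:
  assumes z: "norm z < 1" and t: "t \<ge> 0"
  shows "(\<lambda>k. (- ((real k)\<^sup>2 / 2) *\<^sub>R vconv (\<lambda>_. 1) (C k) t) * z ^ k) sums vconv (\<lambda>_. 1) (half_angular z) t"
proof -
  obtain A where A: "summable A"
    "\<And>k s y. s \<in> {0..t} \<Longrightarrow> norm y \<le> norm z \<Longrightarrow> norm (- ((real k)\<^sup>2 / 2) *\<^sub>R (C k s * y ^ k)) \<le> A k"
    using majorant1[of "norm z" t] z by (metis norm_ge_zero)
  have "(\<lambda>k. vconv (\<lambda>_. 1) (\<lambda>s. - ((real k)\<^sup>2 / 2) *\<^sub>R (C k s * z ^ k)) t) sums vconv (\<lambda>_. 1) (half_angular z) t"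
    unfolding half_angular_def[abs_def]
    by (rule vconv_sums[OF set_integrable_const_1 _ _ A(1) t])
       (intro continuous_on_scaleR continuous_on_const term_continuous, rule A(2), auto)
  moreover have "vconv (\<lambda>_. 1) (\<lambda>s. - ((real k)\<^sup>2 / 2) *\<^sub>R (C k s * z ^ k)) t = (- ((real k)\<^sup>2 / 2) *\<^sub>R vconv (\<lambda>_. 1) (C k) t) * z ^ k" for k
  proof -
    have "vconv (\<lambda>_. 1) (\<lambda>s. C k s * z ^ k) t = vconv (\<lambda>_. 1) (C k) t * z ^ k"
      by (rule vconv_linear[OF bounded_linear_mult_left set_integrable_const_1]) (rule continuous_on_subset[OF cont], auto)
    then show ?thesis by (simp only: vconv_scale mult_scaleR_left)
  qed
  ultimately show ?thesis by simp
qed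

end

section \<open>The subordinated rotation operator\<close>

text \<open>The substitution \<open>u = \<sigma> * v\<close> reduces this to the characteristic
  function of the standard normal law.\<close>

lemma normal_density_char:
  assumes "\<sigma> > 0"
  shows "(\<integral>u. normal_density 0 \<sigma> u *\<^sub>R exp (\<i> * of_real (q * u)) \<partial>lborel) = of_real (exp (- (q\<^sup>2 * \<sigma>\<^sup>2) / 2))"
proof -
  have n: "\<sigma> * normal_density 0 \<sigma> (\<sigma> * v) = std_normal_density v" for v
    using assms by (simp add: normal_density_def power_mult_distrib real_sqrt_mult)
  have "(\<integral>u. normal_density 0 \<sigma> u *\<^sub>R exp (\<i> * of_real (q * u)) \<partial>lborel)
      = \<bar>\<sigma>\<bar> *\<^sub>R (\<integral>v. normal_density 0 \<sigma> (0 + \<sigma> * v) *\<^sub>R exp (\<i> * of_real (q * (0 + \<sigma> * v))) \<partial>lborel)"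
    by (rule lborel_integral_real_affine) (use assms in simp)
  also have "\<dots> = (\<integral>v. \<sigma> *\<^sub>R (normal_density 0 \<sigma> (0 + \<sigma> * v) *\<^sub>R exp (\<i> * of_real (q * (0 + \<sigma> * v)))) \<partial>lborel)"
    using assms by (simp only: integral_scaleR_right abs_of_pos)
  also have "\<dots> = (\<integral>v. std_normal_density v *\<^sub>R iexp ((q * \<sigma>) * v) \<partial>lborel)"
    by (rule Bochner_Integration.integral_cong[OF refl]) (simp only: scaleR_scaleR n add_0 mult.assoc)
  also have "\<dots> = char std_normal_distribution (q * \<sigma>)"
    unfolding char_def by (subst integral_density) auto
  also have "\<dots> = of_real (exp (- (q\<^sup>2 * \<sigma>\<^sup>2) / 2))"
    unfolding char_std_normal_distribution by (simp add: power_mult_distrib)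
  finally show ?thesis .
qed

section \<open>The law of Brownian motion at the inverse subordinator\<close>

context inverse_subordinator_density begin

text \<open>For \<open>t > 0\<close>, the joint density of the random time \<open>y\<close> and the
  Brownian position \<open>u\<close>.\<close>

definition heat :: "real \<Rightarrow> real \<Rightarrow> real \<Rightarrow> real" where
  "heat t y u = indicator {0<..} y *\<^sub>R (exp (- u\<^sup>2 / (2 * y)) / sqrt (2 * pi * y) * m y t)"

lemma heat_eq: "heat t y u = indicator {0<..} y * (normal_density 0 (sqrt y) u * m y t)"
  by (auto simp: heat_def normal_density_def indicator_def)

lemma subordinated_density_eq: "subordinated_density m u t = (\<integral>y. heat t y u \<partial>lborel)"
  by (simp add: subordinated_density_def set_lebesgue_integral_def heat_def)

lemma m_measurable: "t > 0 \<Longrightarrow> (\<lambda>y. m y t) \<in> borel_measurable lborel"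
  by (rule distributed_real_measurable[OF density_nonneg density])

lemma m_integrable:
  assumes "t > 0" shows "integrable lborel (\<lambda>y. m y t)"
  using distributed_integrable[OF density[OF assms], of "\<lambda>_. 1"] density_nonneg[OF assms] by simp

lemma heat_nonneg: "t > 0 \<Longrightarrow> 0 \<le> heat t y u"
  using density_nonneg[of t y] by (simp add: heat_eq)

lemma heat_measurable:
  assumes "t > 0" shows "(\<lambda>(y, u). heat t y u) \<in> borel_measurable (lborel \<Otimes>\<^sub>M lborel)"
proof -
  have [measurable]: "(\<lambda>y. m y t) \<in> borel_measurable borel" using m_measurable[OF assms] by simp
  show ?thesis unfolding heat_def case_prod_beta' by measurable
qed

lemma heat_integrable:
  assumes t: "t > 0"
  shows "integrable lborel (heat t y)" and "(\<integral>u. heat t y u \<partial>lborel) = indicator {0<..} y * m y t"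
proof -
  have h: "heat t y = (\<lambda>u. (indicator {0<..} y * m y t) * normal_density 0 (sqrt y) u)"
    by (auto simp: heat_eq)
  show "integrable lborel (heat t y)"
    unfolding h by (cases "y > 0") auto
  show "(\<integral>u. heat t y u \<partial>lborel) = indicator {0<..} y * m y t"
    unfolding h by (cases "y > 0") auto
qed

text \<open>The integral of \<open>heat t y\<close> over \<open>u\<close> is at most
  \<open>m y t\<close>, so a factor bounded by \<open>B\<close> gives at most \<open>B\<close> times
  the mass of \<open>m\<close>. It is applied to constants and to characters.\<close>

lemma heat_times_integrable:
  fixes F :: "real \<Rightarrow> complex"
  assumes t: "t > 0" and F[measurable]: "F \<in> borel_measurable borel" and B: "\<And>u. norm (F u) \<le> B"
  shows "integrable (lborel \<Otimes>\<^sub>M lborel) (\<lambda>(y, u). heat t y u *\<^sub>R F u)"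
proof (rule lborel_pair.Fubini_integrable)
  note [measurable] = heat_measurable[OF t]
  have i: "integrable lborel (\<lambda>u. heat t y u *\<^sub>R F u)" for y
  proof (rule Bochner_Integration.integrable_bound)
    show "integrable lborel (\<lambda>u. B * heat t y u)" using heat_integrable(1)[OF t] by auto
    show "AE u in lborel. norm (heat t y u *\<^sub>R F u) \<le> norm (B * heat t y u)"
    proof (rule AE_I2)
      fix u
      have "norm (F u) \<le> \<bar>B\<bar>" using B[of u] by linarith
      then show "norm (heat t y u *\<^sub>R F u) \<le> norm (B * heat t y u)"
        using heat_nonneg[OF t, of y u] by (simp add: abs_mult mult.commute[of "\<bar>B\<bar>"] mult_left_mono)
    qed
    show "(\<lambda>u. heat t y u *\<^sub>R F u) \<in> borel_measurable lborel"
      using borel_measurable_integrable[OF heat_integrable(1)[OF t, of y]] by measurable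
  qed
  then show "AE y in lborel. integrable lborel (\<lambda>u. case (y, u) of (y, u) \<Rightarrow> heat t y u *\<^sub>R F u)" by simp
  have "B \<ge> 0" using order_trans[OF norm_ge_zero B] .
  show m: "(\<lambda>(y, u). heat t y u *\<^sub>R F u) \<in> borel_measurable (lborel \<Otimes>\<^sub>M lborel)"
    using heat_measurable[OF t] unfolding case_prod_beta' by measurable
  show "integrable lborel (\<lambda>y. \<integral>u. norm (case (y, u) of (y, u) \<Rightarrow> heat t y u *\<^sub>R F u) \<partial>lborel)"
  proof (rule Bochner_Integration.integrable_bound)
    show "integrable lborel (\<lambda>y. B * m y t)" using m_integrable[OF t] by auto
    show "(\<lambda>y. \<integral>u. norm (case (y, u) of (y, u) \<Rightarrow> heat t y u *\<^sub>R F u) \<partial>lborel) \<in> borel_measurable lborel"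
      using m by measurable
    show "AE y in lborel. norm (\<integral>u. norm (case (y, u) of (y, u) \<Rightarrow> heat t y u *\<^sub>R F u) \<partial>lborel) \<le> norm (B * m y t)"
    proof (rule AE_I2)
      fix y
      have "(\<integral>u. norm (heat t y u *\<^sub>R F u) \<partial>lborel) \<le> (\<integral>u. B * heat t y u \<partial>lborel)"
        using heat_integrable(1)[OF t] heat_nonneg[OF t]
        by (intro integral_mono integrable_norm i integrable_mult_right)
           (auto simp: mult.commute[of B] intro!: mult_left_mono B)
      also have "\<dots> \<le> B * m y t"
        using heat_integrable(2)[OF t] density_nonneg[OF t, of y] \<open>B \<ge> 0\<close> by (simp add: indicator_def)
      finally show "norm (\<integral>u. norm (case (y, u) of (y, u) \<Rightarrow> heat t y u *\<^sub>R F u) \<partial>lborel) \<le> norm (B * m y t)"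
        by simp
    qed
  qed
qed

lemma subordinated_density_integrable:
  assumes t: "t > 0"
  shows "integrable lborel (\<lambda>u. subordinated_density m u t)" and "subordinated_density m u t \<ge> 0"
proof -
  have "integrable lborel (\<lambda>u. \<integral>y. heat t y u *\<^sub>R (1 :: complex) \<partial>lborel)"
    by (rule lborel_pair.integrable_snd[OF heat_times_integrable[OF t, of "\<lambda>_. 1" 1]]) auto
  then have "integrable lborel (\<lambda>u. complex_of_real (subordinated_density m u t))"
    by (simp add: subordinated_density_eq scaleR_conv_of_real)
  then show "integrable lborel (\<lambda>u. subordinated_density m u t)"
    by (simp only: complex_of_real_integrable_eq)
  show "subordinated_density m u t \<ge> 0"
    unfolding subordinated_density_eq by (intro Bochner_Integration.integral_nonneg heat_nonneg t)
qed

text \<open>For given time \<open>y\<close> the Gaussian characteristic function at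
  \<open>- k\<close> is \<open>exp (- (k\<^sup>2 / 2) * y)\<close>; averaging it over the law of
  \<open>E t\<close> gives the mode.\<close>

lemma subordinated_density_char:
  assumes t: "t > 0"
  shows "(\<integral>u. subordinated_density m u t *\<^sub>R exp (- \<i> * of_real u) ^ k \<partial>lborel) = of_real (mode k t)"
proof -
  define F where "F u = exp (\<i> * of_real (- real k * u))" for u
  have F: "exp (- \<i> * of_real u) ^ k = F u" for u
    by (simp add: F_def exp_of_nat_mult[symmetric] mult_ac)
  have Fn: "norm (F u) \<le> 1" for u by (simp add: F_def)
  have Fm: "F \<in> borel_measurable borel" unfolding F_def by measurable
  note i = heat_times_integrable[OF t Fm Fn]
  have "(\<integral>u. subordinated_density m u t *\<^sub>R F u \<partial>lborel) = (\<integral>u. \<integral>y. heat t y u *\<^sub>R F u \<partial>lborel \<partial>lborel)"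
  proof (rule Bochner_Integration.integral_cong[OF refl])
    fix u
    show "subordinated_density m u t *\<^sub>R F u = (\<integral>y. heat t y u *\<^sub>R F u \<partial>lborel)"
    \<comment> \<open>If the integral diverges, then both sides have the junk value \<open>0\<close>.\<close>
    proof (cases "integrable lborel (\<lambda>y. heat t y u)")
      case True
      then show ?thesis unfolding subordinated_density_eq by (rule integral_scaleR_left[symmetric])
    next
      case False
      have "\<not> integrable lborel (\<lambda>y. heat t y u *\<^sub>R F u)"
      proof
        assume "integrable lborel (\<lambda>y. heat t y u *\<^sub>R F u)"
        from integrable_norm[OF this] show False
          using False heat_nonneg[OF t] by (simp add: F_def)
      qed
      then show ?thesis using False by (simp add: subordinated_density_eq not_integrable_integral_eq)
    qed
  qed
  also have "\<dots> = (\<integral>y. \<integral>u. heat t y u *\<^sub>R F u \<partial>lborel \<partial>lborel)"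
    by (rule lborel_pair.Fubini_integral[OF i])
  also have "\<dots> = (\<integral>y. of_real (m y t * (indicator {0<..} y * exp (- ((real k)\<^sup>2 / 2) * y))) \<partial>lborel)"
  proof (rule Bochner_Integration.integral_cong[OF refl])
    fix y
    show "(\<integral>u. heat t y u *\<^sub>R F u \<partial>lborel) = of_real (m y t * (indicator {0<..} y * exp (- ((real k)\<^sup>2 / 2) * y)))"
    proof (cases "y > 0")
      case True
      have "(\<integral>u. heat t y u *\<^sub>R F u \<partial>lborel) = (\<integral>u. m y t *\<^sub>R (normal_density 0 (sqrt y) u *\<^sub>R F u) \<partial>lborel)"
        using True by (intro Bochner_Integration.integral_cong) (auto simp: heat_eq mult.commute)
      also have "\<dots> = m y t *\<^sub>R of_real (exp (- ((- real k)\<^sup>2 * (sqrt y)\<^sup>2) / 2))"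
        unfolding F_def integral_scaleR_right by (subst normal_density_char) (use True in auto)
      finally show ?thesis using True by (simp add: scaleR_conv_of_real)
    qed (simp add: heat_eq)
  qed
  also have "\<dots> = of_real (\<integral>y. m y t * (indicator {0<..} y * exp (- ((real k)\<^sup>2 / 2) * y)) \<partial>lborel)"
    by (rule integral_complex_of_real)
  also have "(\<integral>y. m y t * (indicator {0<..} y * exp (- ((real k)\<^sup>2 / 2) * y)) \<partial>lborel)
      = expectation (\<lambda>\<omega>. indicator {0<..} (E t \<omega>) * exp (- ((real k)\<^sup>2 / 2) * E t \<omega>))"
    by (rule distributed_integral[OF density[OF t]]) (use density_nonneg[OF t] in auto)
  \<comment> \<open>The cut-off at \<open>y > 0\<close> is harmless, since \<open>E t\<close> is
    almost surely nonnegative and different from 0.\<close>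
  also have "\<dots> = d_coeff M H k t" unfolding d_coeff_def
  proof (rule integral_cong_AE)
    have [measurable]: "E t \<in> borel_measurable M" by (rule E_measurable[OF t])
    show "(\<lambda>\<omega>. indicator {0<..} (E t \<omega>) * exp (- ((real k)\<^sup>2 / 2) * E t \<omega>)) \<in> borel_measurable M"
      "(\<lambda>\<omega>. exp (- ((real k)\<^sup>2 / 2) * E t \<omega>)) \<in> borel_measurable M" by measurable
    show "AE \<omega> in M. indicator {0<..} (E t \<omega>) * exp (- ((real k)\<^sup>2 / 2) * E t \<omega>) = exp (- ((real k)\<^sup>2 / 2) * E t \<omega>)"
      using AE_E_less[of t] AE_E_neq[OF t, of 0] by eventually_elim (simp add: indicator_def)
  qed
  finally show ?thesis unfolding F by (simp add: mode_d_coeff[OF t])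
qed

end

section \<open>The operator on the disk algebra\<close>

locale subordinated_semigroup = inverse_subordinator_density M \<nu> b H m
  for M :: "'a measure" and \<nu> b H m +
  fixes f :: "complex \<Rightarrow> complex" and a :: "nat \<Rightarrow> complex"
  assumes f_disk: "f \<in> disk_algebra"
    and f_sums: "\<And>z. z \<in> ball 0 1 \<Longrightarrow> (\<lambda>k. a k * z ^ k) sums f z"
begin

abbreviation "W \<equiv> (\<lambda>z t. W_op m t f z)"

lemma f_cont: "continuous_on (cball 0 1) f"
  using f_disk by (simp add: disk_algebra_def)

lemma f_bounded: obtains B where "\<And>z. norm z \<le> 1 \<Longrightarrow> norm (f z) \<le> B"
proof -
  have "compact (f ` cball 0 1)" by (intro compact_continuous_image f_cont) auto
  then obtain B where "\<And>x. x \<in> f ` cball 0 1 \<Longrightarrow> norm x \<le> B"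
    using compact_imp_bounded bounded_iff by metis
  then show ?thesis by (intro that[of B]) auto
qed

lemma f_rotate_measurable:
  assumes "norm z \<le> 1"
  shows "(\<lambda>u. f (z * exp (- \<i> * of_real u))) \<in> borel_measurable borel"
  by (intro borel_measurable_continuous_onI continuous_on_compose2[OF f_cont] continuous_intros)
     (use assms in \<open>auto simp: norm_mult\<close>)

text \<open>Rotations preserve the closed disk, on which \<open>f\<close> is bounded. Dominated
  convergence against the integrable density therefore works up to the boundary circle.\<close>

lemma W_continuous:
  assumes t: "t > 0"
  shows "continuous_on (cball 0 1) (\<lambda>z. W z t)"
proof (rule continuous_on_sequentiallyI)
  fix x z assume x: "\<forall>n. x n \<in> cball (0::complex) 1" and z: "z \<in> cball 0 1" and lim: "x \<longlonglongrightarrow> z"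
  obtain B where B: "\<And>z. norm z \<le> 1 \<Longrightarrow> norm (f z) \<le> B" using f_bounded by blast
  note sd = subordinated_density_integrable[OF t]
  show "(\<lambda>n. W (x n) t) \<longlonglongrightarrow> W z t"
    unfolding W_op_def using t
  proof (simp, intro integral_dominated_convergence[where w="\<lambda>u. subordinated_density m u t * B"])
    show "integrable lborel (\<lambda>u. subordinated_density m u t * B)" using sd(1) by auto
    show "AE u in lborel. (\<lambda>n. subordinated_density m u t *\<^sub>R f (x n * exp (- (\<i> * of_real u)))) \<longlonglongrightarrow>
        subordinated_density m u t *\<^sub>R f (z * exp (- (\<i> * of_real u)))"
    proof (rule AE_I2, intro tendsto_intros continuous_on_tendsto_compose[OF f_cont] lim)
      fix u
      show "z * exp (- (\<i> * of_real u)) \<in> cball 0 1" using z by (simp add: norm_mult)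
      show "\<forall>\<^sub>F n in sequentially. x n * exp (- (\<i> * of_real u)) \<in> cball 0 1"
        using x by (simp add: norm_mult)
    qed
    show "AE u in lborel. norm (subordinated_density m u t *\<^sub>R f (x n * exp (- (\<i> * of_real u)))) \<le> subordinated_density m u t * B" for n
    proof (rule AE_I2)
      fix u
      have "norm (f (x n * exp (- (\<i> * of_real u)))) \<le> B" using x by (intro B) (simp add: norm_mult)
      then show "norm (subordinated_density m u t *\<^sub>R f (x n * exp (- (\<i> * of_real u)))) \<le> subordinated_density m u t * B"
        using sd(2)[of u] by (simp add: mult_left_mono)
    qed
    have "(\<lambda>u. subordinated_density m u t *\<^sub>R f (y * exp (- (\<i> * of_real u)))) \<in> borel_measurable lborel" if "norm y \<le> 1" for y
      using borel_measurable_integrable[OF sd(1)] f_rotate_measurable[OF that]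
      by (intro borel_measurable_scaleR) auto
    then show "(\<lambda>u. subordinated_density m u t *\<^sub>R f (z * exp (- (\<i> * of_real u)))) \<in> borel_measurable lborel"
      "(\<lambda>u. subordinated_density m u t *\<^sub>R f (x n * exp (- (\<i> * of_real u)))) \<in> borel_measurable lborel" for n
      using x z by auto
  qed
qed

lemma a_summable:
  assumes "norm z < 1" shows "summable (\<lambda>k. norm (a k * z ^ k))"
proof -
  define r where "r = (1 + norm z) / 2"
  have r: "0 \<le> r" "norm z < r" "r < 1" using assms by (auto simp: r_def field_simps)
  have "norm z < norm (of_real r :: complex)" using r by simp
  moreover have "summable (\<lambda>k. a k * of_real r ^ k)"
    by (rule sums_summable[OF f_sums]) (use r in simp)
  ultimately show ?thesis by (intro powser_insidea)
qed

text \<open>A rotation does not change the norm of \<open>z ^ k\<close>, so the terms are dominated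
  by the absolutely convergent series of \<open>f\<close> times the density, uniformly in the
  angle.\<close>

lemma W_sums:
  assumes t: "t > 0" and z: "norm z < 1"
  shows "(\<lambda>k. a k * z ^ k * of_real (mode k t)) sums W z t"
proof -
  note sd = subordinated_density_integrable[OF t]
  define S where "S k u = subordinated_density m u t *\<^sub>R (a k * (z * exp (- \<i> * of_real u)) ^ k)" for k u
  have nS: "norm (S k u) = norm (a k * z ^ k) * subordinated_density m u t" for k u
    using sd(2)[of u] by (simp add: S_def norm_mult norm_power)
  have Si: "integrable lborel (S k)" for k
  proof (rule Bochner_Integration.integrable_bound)
    show "integrable lborel (\<lambda>u. norm (a k * z ^ k) * subordinated_density m u t)" using sd(1) by auto
    show "S k \<in> borel_measurable lborel"
      using borel_measurable_integrable[OF sd(1)] unfolding S_def by measurable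
  qed (use nS in auto)
  have "(\<lambda>k. \<integral>u. S k u \<partial>lborel) sums (\<integral>u. (\<Sum>k. S k u) \<partial>lborel)"
  proof (rule sums_integral[OF Si])
    show "AE u in lborel. summable (\<lambda>k. norm (S k u))"
      unfolding nS by (intro AE_I2 summable_mult2 a_summable z)
    show "summable (\<lambda>k. \<integral>u. norm (S k u) \<partial>lborel)"
      unfolding nS using a_summable[OF z] by (simp add: summable_mult2)
  qed
  also have "(\<integral>u. (\<Sum>k. S k u) \<partial>lborel) = W z t"
    unfolding W_op_def using t
  proof (simp, intro Bochner_Integration.integral_cong refl)
    fix u
    have "(\<lambda>k. S k u) sums (subordinated_density m u t *\<^sub>R f (z * exp (- \<i> * of_real u)))"
      unfolding S_def by (intro sums_scaleR_right f_sums) (use z in \<open>simp add: norm_mult\<close>)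
    then show "(\<Sum>k. S k u) = subordinated_density m u t *\<^sub>R f (z * exp (- (\<i> * of_real u)))"
      by (simp add: sums_unique[symmetric])
  qed
  also have "(\<lambda>k. \<integral>u. S k u \<partial>lborel) = (\<lambda>k. a k * z ^ k * of_real (mode k t))"
  proof
    fix k
    have "(\<integral>u. S k u \<partial>lborel) = (\<integral>u. (a k * z ^ k) * (subordinated_density m u t *\<^sub>R exp (- \<i> * of_real u) ^ k) \<partial>lborel)"
      by (intro Bochner_Integration.integral_cong) (simp_all add: S_def power_mult_distrib mult_ac)
    also have "\<dots> = (a k * z ^ k) * of_real (mode k t)"
      unfolding integral_mult_right_zero subordinated_density_char[OF t] ..
    finally show "(\<integral>u. S k u \<partial>lborel) = a k * z ^ k * of_real (mode k t)" .
  qed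
  finally show ?thesis .
qed

lemma W_0: "W z 0 = f z" by (simp add: W_op_def)

lemma W_sums':
  assumes t: "t \<ge> 0" and z: "norm z < 1"
  shows "(\<lambda>k. (a k * of_real (mode k t)) * z ^ k) sums W z t"
  using W_sums[OF _ z] f_sums[of z] z t by (cases "t = 0") (auto simp: W_0 mult_ac)

lemma W_disk: assumes "t \<ge> 0" shows "(\<lambda>z. W z t) \<in> disk_algebra"
proof -
  have "(\<lambda>z. W z t) holomorphic_on ball 0 1"
    by (rule power_series_holomorphic[where a="\<lambda>k. a k * of_real (mode k t)"])
       (use W_sums'[OF assms] in auto)
  moreover have "continuous_on (cball 0 1) (\<lambda>z. W z t)"
    using W_continuous[of t] f_cont assms by (cases "t = 0") (auto simp: W_0)
  ultimately show ?thesis by (simp add: disk_algebra_def)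
qed

lemma W_laplace:
  assumes \<theta>: "\<theta> > 0" and z: "norm z < 1"
  shows "set_integrable lborel {0..} (\<lambda>t. exp (- \<theta> * t) *\<^sub>R W z t)"
    and "(\<lambda>k. a k * z ^ k * of_real (d_laplace g k \<theta>)) sums (LINT t:{0..}|lborel. exp (- \<theta> * t) *\<^sub>R W z t)"
proof -
  define S where "S k t = (indicator {0..} t * (exp (- \<theta> * t) * mode k t)) *\<^sub>R (a k * z ^ k)" for k t
  have ml: "integrable lborel (\<lambda>t. indicator {0..} t * (exp (- \<theta> * t) * mode k t))"
    "(\<integral>t. indicator {0..} t * (exp (- \<theta> * t) * mode k t) \<partial>lborel) = d_laplace g k \<theta>" for k
    using mode_laplace[OF \<theta>, of k] by (simp_all add: set_integrable_def set_lebesgue_integral_def)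
  have l1: "integrable lborel (\<lambda>t. indicator {0..} t * (exp (- \<theta> * t) * 1))"
    "(\<integral>t. indicator {0..} t * (exp (- \<theta> * t) * 1) \<partial>lborel) = 1 / \<theta>"
    using laplace_1[OF \<theta>] by (simp_all add: set_integrable_def set_lebesgue_integral_def)
  have Si: "integrable lborel (S k)" for k unfolding S_def using ml(1) by (intro integrable_scaleR_left)
  have nS: "norm (S k t) \<le> norm (a k * z ^ k) * (indicator {0..} t * (exp (- \<theta> * t) * 1))" for k t
    using mode_le_1[of k t] mult_left_mono[OF mode_le_1[of k t], of "exp (- \<theta> * t) * norm (a k * z ^ k)"]
    by (simp add: S_def abs_mult indicator_def mult_ac)
  have sm: "summable (\<lambda>k. norm (S k t))" for t
    by (rule summable_comparison_test'[OF summable_mult2[OF a_summable[OF z]]]) (use nS in simp)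
  have sm2: "summable (\<lambda>k. \<integral>t. norm (S k t) \<partial>lborel)"
  proof (rule summable_comparison_test'[OF summable_mult2[OF a_summable[OF z], of "1 / \<theta>"]])
    fix k
    have "(\<integral>t. norm (S k t) \<partial>lborel) \<le> (\<integral>t. norm (a k * z ^ k) * (indicator {0..} t * (exp (- \<theta> * t) * 1)) \<partial>lborel)"
      by (intro integral_mono integrable_norm Si integrable_mult_right l1 nS)
    also have "\<dots> = norm (a k * z ^ k) * (1 / \<theta>)" using l1(2) by simp
    finally show "norm (\<integral>t. norm (S k t) \<partial>lborel) \<le> norm (a k * z ^ k) * (1 / \<theta>)" by simp
  qed
  have eq: "(\<Sum>k. S k t) = indicator {0..} t *\<^sub>R (exp (- \<theta> * t) *\<^sub>R W z t)" for t
  proof (cases "t \<ge> 0")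
    case True
    have "(\<lambda>k. exp (- \<theta> * t) *\<^sub>R ((a k * of_real (mode k t)) * z ^ k)) sums (exp (- \<theta> * t) *\<^sub>R W z t)"
      by (intro sums_scaleR_right W_sums' True z)
    moreover have "S k t = exp (- \<theta> * t) *\<^sub>R ((a k * of_real (mode k t)) * z ^ k)" for k
      using True by (simp add: S_def scaleR_conv_of_real mult_ac)
    ultimately show ?thesis using True by (simp add: sums_unique[symmetric])
  qed (simp add: S_def)
  have ae: "AE t in lborel. summable (\<lambda>k. norm (S k t))" using sm by simp
  show "set_integrable lborel {0..} (\<lambda>t. exp (- \<theta> * t) *\<^sub>R W z t)"
    using integrable_suminf[OF Si ae sm2] unfolding eq set_integrable_def .
  have "(\<lambda>k. \<integral>t. S k t \<partial>lborel) sums (LINT t:{0..}|lborel. exp (- \<theta> * t) *\<^sub>R W z t)"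
    using sums_integral[OF Si ae sm2] unfolding eq set_lebesgue_integral_def .
  moreover have "(\<integral>t. S k t \<partial>lborel) = a k * z ^ k * of_real (d_laplace g k \<theta>)" for k
  proof -
    have "(\<integral>t. S k t \<partial>lborel) = d_laplace g k \<theta> *\<^sub>R (a k * z ^ k)"
      unfolding S_def by (subst integral_scaleR_left[OF ml(1)]) (simp only: ml(2))
    then show ?thesis by (simp only: scaleR_conv_of_real mult.commute)
  qed
  ultimately show "(\<lambda>k. a k * z ^ k * of_real (d_laplace g k \<theta>)) sums (LINT t:{0..}|lborel. exp (- \<theta> * t) *\<^sub>R W z t)"
    by simp
qed

end

section \<open>The Cauchy problem\<close>

text \<open>The centre is exempt because the Cauchy problem is posed on the punctured disk.
  Continuity gives \<open>F 0 = 0\<close>, and a nonzero coefficient would isolate this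
  zero.\<close>

lemma power_series_eq_0:
  fixes X :: "nat \<Rightarrow> complex"
  assumes X: "\<And>z. norm z < 1 \<Longrightarrow> (\<lambda>k. X k * z ^ k) sums F z"
    and z: "\<And>z. norm z < 1 \<Longrightarrow> z \<noteq> 0 \<Longrightarrow> F z = 0"
  shows "X k = 0"
proof -
  have hol: "F holomorphic_on ball 0 1" by (rule power_series_holomorphic[where a=X]) (use X in auto)
  then have "isCont F 0"
    using holomorphic_on_imp_continuous_on continuous_on_interior[of "ball 0 1" F 0] by auto
  then have "(F \<longlongrightarrow> F 0) (at 0)" by (simp add: isCont_def)
  moreover have "(F \<longlongrightarrow> 0) (at 0)"
    by (rule tendsto_eventually) (auto simp: eventually_at z intro!: exI[of _ 1])
  ultimately have F0: "F 0 = 0" by (rule tendsto_unique[rotated]) simp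
  have X0: "X 0 = 0"
    using sums_unique2[OF X[of 0] powser_sums_zero[of X]] F0 by simp
  show ?thesis
  proof (rule ccontr)
    assume "X k \<noteq> 0"
    then have "k \<noteq> 0" using X0 by metis
    obtain s where s: "0 < s" "\<And>z. z \<in> cball 0 s - {0} \<Longrightarrow> F z \<noteq> 0"
      using powser_0_nonzero[of 1 0 X F k] X F0 \<open>X k \<noteq> 0\<close> \<open>k \<noteq> 0\<close> by auto
    \<comment> \<open>A nonzero point in both the zero-free disk of radius \<open>s\<close> and the
      unit disk.\<close>
    define y where "y = (of_real (min s (1 / 2)) :: complex)"
    have "norm y = min s (1 / 2)" using s(1) by (simp add: y_def)
    moreover have "y \<noteq> 0" using s(1) by (simp add: y_def min_def)
    ultimately show False using s(2)[of y] z[of y] by auto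
  qed
qed

section \<open>From the differential to the integrated equation and back\<close>

lemma memory_integral_eq_vconv: "memory_integral w v = vconv w (\<lambda>s. v s - v 0)"
  by (rule ext) (simp add: memory_integral_def vconv_def)

text \<open>The right-hand side has derivative \<open>h\<close>. For \<open>b = 0\<close> the
  left-hand side is the memory integral alone; otherwise only a sum is known to be differentiable,
  and \<open>U\<close> is treated separately by \<open>volterra_differentiable\<close>.\<close>

lemma gen_derivative_of_integrated:
  fixes U h :: "real \<Rightarrow> complex"
  assumes w: "\<And>T. set_integrable lborel {0..T} w" and U: "continuous_on {0..} U" and h: "continuous_on {0..} h"
    and b: "b \<ge> 0"
    and eq: "\<And>t. t \<ge> 0 \<Longrightarrow> vconv w (\<lambda>s. U s - U 0) t + b *\<^sub>R (U t - U 0) = vconv (\<lambda>_. 1) h t"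
    and t: "t > 0"
  shows "memory_integral w U differentiable (at t)"
    and "b \<noteq> 0 \<Longrightarrow> U differentiable (at t)"
    and "gen_derivative w U t + b *\<^sub>R vector_derivative U (at t) = h t"
proof -
  define v where "v s = U s - U 0" for s
  have vc: "continuous_on {0..} v" unfolding v_def by (intro continuous_intros U)
  have hd: "(vconv (\<lambda>_. 1) h has_vector_derivative h t) (at t)"
    by (rule vconv_1_has_derivative[where T="t + 1"]) (use t in \<open>auto intro: continuous_on_subset[OF h]\<close>)
  have mem: "(memory_integral w U has_vector_derivative h t - b *\<^sub>R D) (at t)"
    if "((\<lambda>s. b *\<^sub>R v s) has_vector_derivative b *\<^sub>R D) (at t)" for D
  proof (rule has_vector_derivative_transform_within_open[where S="{0<..}"])
    show "((\<lambda>s. vconv (\<lambda>_. 1) h s - b *\<^sub>R v s) has_vector_derivative h t - b *\<^sub>R D) (at t)"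
      by (intro has_vector_derivative_diff hd that)
    show "vconv (\<lambda>_. 1) h s - b *\<^sub>R v s = memory_integral w U s" if "s \<in> {0<..}" for s
      using eq[of s] that unfolding memory_integral_eq_vconv v_def by (simp add: algebra_simps)
  qed (use t in auto)
  have "memory_integral w U differentiable (at t) \<and> (b \<noteq> 0 \<longrightarrow> U differentiable (at t)) \<and>
    gen_derivative w U t + b *\<^sub>R vector_derivative U (at t) = h t"
  proof (cases "b = 0")
    case True
    have "(memory_integral w U has_vector_derivative h t) (at t)"
      \<comment> \<open>Any value in place of 0 would do, since \<open>b *\<^sub>R D\<close>
        vanishes.\<close>
      using mem[of 0] True by simp
    then show ?thesis using True
      by (auto simp: gen_derivative_def vector_derivative_at intro: differentiableI_vector)
  next
    case False
    then have "b > 0" using b by simp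
    have "v differentiable (at t)"
      by (rule volterra_differentiable[OF w vc h \<open>b > 0\<close> _ t]) (use eq in \<open>simp add: v_def[abs_def]\<close>)
    then have "(v has_vector_derivative vector_derivative v (at t)) (at t)"
      by (simp add: vector_derivative_works)
    then have v: "(v has_vector_derivative vector_derivative v (at t)) (at t)" .
    have vd: "((\<lambda>s. b *\<^sub>R v s) has_vector_derivative b *\<^sub>R vector_derivative v (at t)) (at t)"
      using has_vector_derivative_scaleR[OF DERIV_const[of b] v] by simp
    have "((\<lambda>s. v s + U 0) has_vector_derivative vector_derivative v (at t) + 0) (at t)"
      by (intro has_vector_derivative_add v has_vector_derivative_const)
    then have Ud: "(U has_vector_derivative vector_derivative v (at t)) (at t)" by (simp add: v_def)
    show ?thesis using mem[OF vd] Ud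
      by (auto simp: gen_derivative_def vector_derivative_at intro: differentiableI_vector)
  qed
  then show "memory_integral w U differentiable (at t)"
    and "b \<noteq> 0 \<Longrightarrow> U differentiable (at t)"
    and "gen_derivative w U t + b *\<^sub>R vector_derivative U (at t) = h t" by auto
qed

text \<open>The equation is known at positive times only; continuity of \<open>y\<close> down to 0
  and \<open>y 0 = 0\<close> fix the constant of integration.\<close>

lemma integrated_of_gen_derivative:
  fixes U h :: "real \<Rightarrow> complex"
  assumes w: "\<And>T. set_integrable lborel {0..T} w" and U: "continuous_on {0..} U" and h: "continuous_on {0..} h"
    and m: "\<And>t. t > 0 \<Longrightarrow> memory_integral w U differentiable (at t)"
    and d: "\<And>t. t > 0 \<Longrightarrow> b \<noteq> 0 \<Longrightarrow> U differentiable (at t)"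
    and eq: "\<And>t. t > 0 \<Longrightarrow> gen_derivative w U t + b *\<^sub>R vector_derivative U (at t) = h t"
    and t: "t \<ge> 0"
  shows "vconv w (\<lambda>s. U s - U 0) t + b *\<^sub>R (U t - U 0) = vconv (\<lambda>_. 1) h t"
proof -
  define y where "y t = memory_integral w U t + b *\<^sub>R (U t - U 0)" for t
  have UT: "continuous_on {0..t} U" and hT: "continuous_on {0..t} h"
    using U h by (auto intro: continuous_on_subset)
  have yc: "continuous_on {0..t} y" unfolding y_def memory_integral_eq_vconv
    by (intro continuous_intros continuous_on_vconv w UT)
  have yd: "(y has_vector_derivative h s) (at s)" if s: "s > 0" for s
  proof -
    have 1: "(memory_integral w U has_vector_derivative gen_derivative w U s) (at s)"
      using m[OF s] unfolding gen_derivative_def by (simp add: vector_derivative_works)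
    \<comment> \<open>For \<open>b = 0\<close> the derivative of \<open>U\<close> may fail to exist,
      but its unspecified value is multiplied by 0.\<close>
    have 2: "((\<lambda>s. b *\<^sub>R (U s - U 0)) has_vector_derivative b *\<^sub>R vector_derivative U (at s)) (at s)"
    proof (cases "b = 0")
      case False
      have "(U has_vector_derivative vector_derivative U (at s)) (at s)"
        using d[OF s False] by (simp add: vector_derivative_works)
      then have "((\<lambda>s. U s - U 0) has_vector_derivative vector_derivative U (at s)) (at s)"
        using has_vector_derivative_diff_const by blast
      from has_vector_derivative_scaleR[OF DERIV_const[of b] this] show ?thesis by simp
    qed simp
    show ?thesis using has_vector_derivative_add[OF 1 2] unfolding y_def[abs_def] eq[OF s] .
  qed
  have "(h has_integral (y t - y 0)) {0..t}"
    by (rule fundamental_theorem_of_calculus_interior[OF t yc]) (use yd in auto)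
  then have "integral {0..t} h = y t - y 0" by (rule integral_unique)
  moreover have "y 0 = 0" by (simp add: y_def memory_integral_eq_vconv)
  ultimately show ?thesis using vconv_1[OF hT] by (simp add: y_def memory_integral_eq_vconv)
qed

section \<open>Taylor coefficients of an arbitrary solution\<close>

definition taylor :: "(complex \<Rightarrow> real \<Rightarrow> complex) \<Rightarrow> nat \<Rightarrow> real \<Rightarrow> complex" where
  "taylor u k t = (deriv ^^ k) (\<lambda>z. u z t) 0 / fact k"

lemma taylor_sums:
  assumes "(\<lambda>z. u z t) holomorphic_on ball 0 1" "norm z < 1"
  shows "(\<lambda>k. taylor u k t * z ^ k) sums u z t"
  using holomorphic_power_series[OF assms(1), of z] assms(2) by (simp add: taylor_def)

text \<open>Cauchy's inequality on a smaller closed disk: joint continuity on compact sets yields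
  the bounds, and joint uniform continuity, applied to the difference of two time slices, yields
  continuity in time.\<close>

lemma taylor_time_power_series:
  assumes hol: "\<And>t. t \<ge> 0 \<Longrightarrow> (\<lambda>z. u z t) holomorphic_on ball 0 1"
    and cont: "continuous_on (ball 0 1 \<times> {0..}) (\<lambda>(z, t). u z t)"
  shows "time_power_series (taylor u)"
proof
  have hc: "(\<lambda>z. u z t) holomorphic_on ball 0 \<rho>" "continuous_on (cball 0 \<rho>) (\<lambda>z. u z t)"
    if "t \<ge> 0" "\<rho> < 1" for t \<rho>
  proof -
    show "(\<lambda>z. u z t) holomorphic_on ball 0 \<rho>"
      using hol[OF that(1)] by (rule holomorphic_on_subset) (use that in auto)
    have "continuous_on (ball 0 1) (\<lambda>z. u z t)" using hol[OF that(1)] by (rule holomorphic_on_imp_continuous_on)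
    then show "continuous_on (cball 0 \<rho>) (\<lambda>z. u z t)" by (rule continuous_on_subset) (use that in auto)
  qed
  have sub: "continuous_on (cball 0 \<rho> \<times> {0..T}) (\<lambda>(z, t). u z t)" if "\<rho> < 1" for \<rho> T
    using cont by (rule continuous_on_subset) (use that in auto)
  have comp: "compact (cball (0::complex) \<rho> \<times> {0..T})" for \<rho> and T :: real by (intro compact_Times) auto
  show "\<exists>B. \<forall>k. \<forall>s\<in>{0..T}. norm (taylor u k s) * \<rho> ^ k \<le> B" if \<rho>: "0 < \<rho>" "\<rho> < 1" for T \<rho>
  proof -
    obtain B where B: "\<And>p. p \<in> cball 0 \<rho> \<times> {0..T} \<Longrightarrow> norm (case p of (z, t) \<Rightarrow> u z t) \<le> B"
      using compact_imp_bounded[OF compact_continuous_image[OF sub[OF \<rho>(2)] comp]]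
      unfolding bounded_iff by blast
    have "norm (taylor u k s) * \<rho> ^ k \<le> B" if "s \<in> {0..T}" for k s
    proof -
      have "norm ((deriv ^^ k) (\<lambda>z. u z s) 0) \<le> fact k * B / \<rho> ^ k"
        by (rule Cauchy_inequality[OF hc \<rho>(1)]) (use that \<rho> B[of "(_, s)"] in auto)
      then show ?thesis using \<rho>(1) by (simp add: taylor_def norm_divide field_simps)
    qed
    then show ?thesis by blast
  qed
  show "continuous_on {0..} (taylor u k)" for k
  proof (rule continuous_on_halfline)
    fix T
    show "continuous_on {0..T} (taylor u k)"
      unfolding continuous_on_iff
    proof (intro ballI allI impI)
      fix s e :: real assume s: "s \<in> {0..T}" and "e > 0"
      \<comment> \<open>Cauchy's inequality at radius \<open>1 / 2\<close> divides by
        \<open>(1 / 2) ^ k\<close>, which leaves \<open>e / 2\<close>.\<close>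
      define e' where "e' = e * (1 / 2) ^ k / 2"
      have "e' > 0" using \<open>e > 0\<close> by (simp add: e'_def)
      define S where "S = cball (0::complex) (1 / 2) \<times> {0..T}"
      define F where "F = (\<lambda>p. u (fst p) (snd p))"
      have "uniformly_continuous_on S F"
        unfolding S_def F_def
        using sub[of "1 / 2" T] comp by (intro compact_uniformly_continuous) (simp_all add: case_prod_beta')
      then obtain d where d: "d > 0" "\<And>p q. p \<in> S \<Longrightarrow> q \<in> S \<Longrightarrow> dist q p < d \<Longrightarrow> dist (F q) (F p) < e'"
        unfolding uniformly_continuous_on_def using \<open>e' > 0\<close> by blast
      show "\<exists>d>0. \<forall>x'\<in>{0..T}. dist x' s < d \<longrightarrow> dist (taylor u k x') (taylor u k s) < e"
      proof (intro exI[of _ d] conjI ballI impI d(1))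
        fix x assume x: "x \<in> {0..T}" "dist x s < d"
        have x0: "x \<ge> 0" and s0: "s \<ge> 0" using x s by auto
        have "(deriv ^^ k) (\<lambda>z. u z x - u z s) 0 = (deriv ^^ k) (\<lambda>z. u z x) 0 - (deriv ^^ k) (\<lambda>z. u z s) 0"
          by (rule higher_deriv_diff[OF hol[OF x0] hol[OF s0]]) auto
        then have eq: "taylor u k x - taylor u k s = (deriv ^^ k) (\<lambda>z. u z x - u z s) 0 / fact k"
          by (simp add: taylor_def diff_divide_distrib)
        have "norm ((deriv ^^ k) (\<lambda>z. u z x - u z s) 0) \<le> fact k * e' / (1 / 2) ^ k"
        proof (rule Cauchy_inequality)
          show "(\<lambda>z. u z x - u z s) holomorphic_on ball 0 (1 / 2)"
            by (intro holomorphic_on_diff hc x0 s0) auto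
          show "continuous_on (cball 0 (1 / 2)) (\<lambda>z. u z x - u z s)"
            by (intro continuous_on_diff hc x0 s0) auto
          fix z :: complex assume "norm (0 - z) = 1 / 2"
          then show "norm (u z x - u z s) \<le> e'"
            using d(2)[of "(z, s)" "(z, x)"] x s by (simp add: S_def F_def dist_Pair_Pair dist_norm)
        qed simp
        then have "norm (taylor u k x - taylor u k s) \<le> e / 2"
          unfolding eq e'_def by (simp add: norm_divide field_simps power_divide)
        then show "dist (taylor u k x) (taylor u k s) < e" using \<open>e > 0\<close> by (simp add: dist_norm)
      qed
    qed
  qed
qed

section \<open>Existence and uniqueness\<close>

context subordinated_semigroup begin

text \<open>The modes are bounded by 1, so the absolutely convergent series of \<open>f\<close> at
  radius \<open>\<rho>\<close> gives a bound that is uniform in time.\<close>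

sublocale series: time_power_series "\<lambda>k s. a k * of_real (mode k s)"
proof
  show "continuous_on {0..} (\<lambda>s. a k * complex_of_real (mode k s))" for k
    by (intro continuous_intros mode_continuous_on)
  fix T \<rho> :: real assume \<rho>: "0 < \<rho>" "\<rho> < 1"
  have sm: "summable (\<lambda>k. norm (a k * of_real \<rho> ^ k))" using \<rho> by (intro a_summable) simp
  have "norm (a k * of_real (mode k s)) * \<rho> ^ k \<le> (\<Sum>k. norm (a k * of_real \<rho> ^ k))" for k s
  proof -
    have "norm (a k * of_real (mode k s)) * \<rho> ^ k = (norm (a k) * \<rho> ^ k) * \<bar>mode k s\<bar>"
      by (simp add: norm_mult)
    also have "\<dots> \<le> (norm (a k) * \<rho> ^ k) * 1" using \<rho> by (intro mult_left_mono mode_le_1) simp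
    also have "\<dots> = (\<Sum>k\<in>{k}. norm (a k * of_real \<rho> ^ k))" using \<rho> by (simp add: norm_mult norm_power)
    also have "\<dots> \<le> (\<Sum>k. norm (a k * of_real \<rho> ^ k))" by (rule sum_le_suminf[OF sm]) auto
    finally show ?thesis .
  qed
  then show "\<exists>B. \<forall>k. \<forall>s\<in>{0..T}. norm (a k * of_real (mode k s)) * \<rho> ^ k \<le> B" by blast
qed

lemma W_eq_val: "t \<ge> 0 \<Longrightarrow> norm z < 1 \<Longrightarrow> W z t = series.val z t"
  using sums_unique2[OF W_sums' series.val_sums] by blast

lemma w_int: "set_integrable lborel {0..T} w" by (rule set_integrable_levy_tail[OF levy])

lemma coefficient_equation:
  assumes t: "t \<ge> 0"
  shows "vconv w (\<lambda>s. a k * of_real (mode k s) - a k * of_real (mode k 0)) t + b *\<^sub>R (a k * of_real (mode k t) - a k * of_real (mode k 0))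
    = - ((real k)\<^sup>2 / 2) *\<^sub>R vconv (\<lambda>_. 1) (\<lambda>s. a k * of_real (mode k s)) t"
proof -
  have L: "bounded_linear (\<lambda>x. a k * of_real x)"
    by (rule bounded_linear_compose[OF bounded_linear_mult_right bounded_linear_of_real])
  have "vconv w (\<lambda>s. a k * of_real (mode k s) - a k * of_real (mode k 0)) t = vconv w (\<lambda>s. a k * of_real (mode k s - 1)) t"
    by (simp add: right_diff_distrib)
  also have "\<dots> = a k * of_real (vconv w (\<lambda>s. mode k s - 1) t)"
    by (rule vconv_linear[OF L w_int]) (intro continuous_intros mode_continuous_on)
  finally have 1: "vconv w (\<lambda>s. a k * of_real (mode k s) - a k * of_real (mode k 0)) t = a k * of_real (vconv w (\<lambda>s. mode k s - 1) t)" .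
  have 2: "vconv (\<lambda>_. 1) (\<lambda>s. a k * of_real (mode k s)) t = a k * of_real (vconv (\<lambda>_. 1) (mode k) t)"
    by (rule vconv_linear[OF L set_integrable_const_1 mode_continuous_on])
  have "a k * of_real (vconv w (\<lambda>s. mode k s - 1) t + b * (mode k t - 1)) = a k * of_real (- ((real k)\<^sup>2 / 2) * vconv (\<lambda>_. 1) (mode k) t)"
    unfolding mode_equation[OF t] ..
  then show ?thesis unfolding 1 2 by (simp add: scaleR_conv_of_real algebra_simps)
qed

lemma W_integrated:
  assumes "t \<ge> 0" "norm z < 1"
  shows "vconv w (\<lambda>s. W z s - W z 0) t + b *\<^sub>R (W z t - W z 0) = vconv (\<lambda>_. 1) (series.half_angular z) t"
proof -
  have "vconv w (\<lambda>s. series.val z s - series.val z 0) t + b *\<^sub>R (series.val z t - series.val z 0) = vconv (\<lambda>_. 1) (series.half_angular z) t"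
    using sums_unique2[OF series.val_equation_sums[OF assms(2,1) w_int, of b, unfolded coefficient_equation[OF assms(1)]]
        series.half_angular_integral_sums[OF assms(2,1)]] .
  moreover have "vconv w (\<lambda>s. W z s - W z 0) t = vconv w (\<lambda>s. series.val z s - series.val z 0) t"
    by (rule vconv_cong) (use W_eq_val assms in auto)
  ultimately show ?thesis using W_eq_val[of t z] W_eq_val[of 0 z] assms by simp
qed

lemma W_time_continuous: "norm z < 1 \<Longrightarrow> continuous_on {0..} (W z)"
  by (rule continuous_on_eq[OF series.val_continuous]) (simp_all add: W_eq_val)

lemma W_solution: "cauchy_solution b w f W"
  unfolding cauchy_solution_def
proof (intro conjI allI impI ballI)
  show "(\<lambda>z. W z t) \<in> disk_algebra" if "0 \<le> t" for t using that by (rule W_disk)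
  show "continuous_on (ball 0 1 \<times> {0..}) (\<lambda>(z, t). W z t)"
    using series.val_continuous2 by (rule continuous_on_eq) (auto simp: W_eq_val)
  show "W z 0 = f z" for z by (rule W_0)
  fix t r \<phi> :: real assume t: "0 < t" and r: "r \<in> {0<..<1}"
  have z: "norm (rcis r \<phi>) < 1" using r by simp
  note D = gen_derivative_of_integrated[OF w_int W_time_continuous[OF z] series.half_angular_continuous[OF z] b_nonneg
      W_integrated[OF _ z] t]
  show "memory_integral w (W (rcis r \<phi>)) differentiable (at t)" by (rule D(1))
  show "W (rcis r \<phi>) differentiable (at t)" if "b \<noteq> 0" by (rule D(2)[OF _ that])
  show "gen_derivative w (W (rcis r \<phi>)) t + b *\<^sub>R vector_derivative (W (rcis r \<phi>)) (at t) =
      (1 / 2) *\<^sub>R angular_derivative2 (\<lambda>z. W z t) r \<phi>"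
    using D(3) series.half_angular_eq[of r t "\<lambda>z. W z t" \<phi>] r t W_eq_val[of t] by simp
qed

text \<open>Expanding \<open>u\<close> in \<open>z\<close> at each fixed time turns the problem into
  one scalar integrated equation per coefficient, to which \<open>mode_unique\<close>
  applies.\<close>

lemma solution_unique:
  assumes u: "cauchy_solution b w f u" and t: "t \<ge> 0" and z: "z \<in> cball 0 1"
  shows "u z t = W z t"
proof -
  have disk: "(\<lambda>z. u z t) holomorphic_on ball 0 1" "continuous_on (cball 0 1) (\<lambda>z. u z t)" if "t \<ge> 0" for t
    using u that unfolding cauchy_solution_def disk_algebra_def by auto
  have cont: "continuous_on (ball 0 1 \<times> {0..}) (\<lambda>(z, t). u z t)"
    using u unfolding cauchy_solution_def by blast
  have init: "u z 0 = f z" if "z \<in> cball 0 1" for z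
    using u that unfolding cauchy_solution_def by blast
  have pde: "memory_integral w (u (rcis r \<phi>)) differentiable (at t)"
      "b \<noteq> 0 \<Longrightarrow> u (rcis r \<phi>) differentiable (at t)"
      "gen_derivative w (u (rcis r \<phi>)) t + b *\<^sub>R vector_derivative (u (rcis r \<phi>)) (at t) =
          (1 / 2) *\<^sub>R angular_derivative2 (\<lambda>z. u z t) r \<phi>"
    if "t > 0" "r \<in> {0<..<1}" for r \<phi> t
    using u that unfolding cauchy_solution_def by blast+
  interpret S: time_power_series "taylor u" by (rule taylor_time_power_series[OF disk(1) cont])
  have uv: "u z t = S.val z t" if "t \<ge> 0" "norm z < 1" for z t
    using sums_unique2[OF taylor_sums[where u=u, OF disk(1)[OF that(1)] that(2)] S.val_sums[OF that(2,1)]] .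
  have uc: "continuous_on {0..} (u z)" if "norm z < 1" for z
    using S.val_continuous[OF that] by (rule continuous_on_eq) (simp add: uv that)
  have u0: "taylor u k 0 = a k" for k
  proof -
    have "(\<lambda>k. (taylor u k 0 - a k) * z ^ k) sums (u z 0 - f z)" if "norm z < 1" for z
      using sums_diff[OF taylor_sums[where u=u and t=0, OF disk(1)[OF order_refl] that] f_sums[of z]] that by (simp add: left_diff_distrib)
    then have "taylor u k 0 - a k = 0"
      by (rule power_series_eq_0) (simp_all add: init)
    then show ?thesis by simp
  qed
  \<comment> \<open>The equation is given on circles of positive radius, so \<open>z = 0\<close> is
    left out here; \<open>power_series_eq_0\<close> allows for the gap when coefficients are
    compared.\<close>
  have int: "vconv w (\<lambda>s. u z s - u z 0) t + b *\<^sub>R (u z t - u z 0) = vconv (\<lambda>_. 1) (S.half_angular z) t"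
    if t: "t \<ge> 0" and z: "norm z < 1" "z \<noteq> 0" for t z
  proof -
    define r where "r = norm z"
    define \<phi> where "\<phi> = Arg z"
    have zr: "z = rcis r \<phi>" unfolding r_def \<phi>_def by (simp add: rcis_cmod_Arg)
    have r: "r \<in> {0<..<1}" using z by (simp add: r_def)
    have h: "S.half_angular z t = (1 / 2) *\<^sub>R angular_derivative2 (\<lambda>z. u z t) r \<phi>" if "t > 0" for t
      unfolding zr using r that by (intro S.half_angular_eq uv) auto
    show ?thesis
    proof (rule integrated_of_gen_derivative[OF w_int uc[OF z(1)] S.half_angular_continuous[OF z(1)] _ _ _ t])
      fix t :: real assume t: "t > 0"
      show "memory_integral w (u z) differentiable (at t)" unfolding zr by (rule pde(1)[OF t r])
      show "u z differentiable (at t)" if "b \<noteq> 0" unfolding zr by (rule pde(2)[OF t r that])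
      show "gen_derivative w (u z) t + b *\<^sub>R vector_derivative (u z) (at t) = S.half_angular z t"
        unfolding h[OF t] by (subst (1 2) zr) (rule pde(3)[OF t r])
    qed
  qed
  have modes: "vconv w (\<lambda>s. taylor u k s - taylor u k 0) t + b *\<^sub>R (taylor u k t - taylor u k 0)
      = - ((real k)\<^sup>2 / 2) *\<^sub>R vconv (\<lambda>_. 1) (taylor u k) t" if t: "t \<ge> 0" for k t
  proof -
    define X where "X k = (vconv w (\<lambda>s. taylor u k s - taylor u k 0) t + b *\<^sub>R (taylor u k t - taylor u k 0))
      - (- ((real k)\<^sup>2 / 2) *\<^sub>R vconv (\<lambda>_. 1) (taylor u k) t)" for k
    define F where "F z = (vconv w (\<lambda>s. S.val z s - S.val z 0) t + b *\<^sub>R (S.val z t - S.val z 0))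
      - vconv (\<lambda>_. 1) (S.half_angular z) t" for z
    have "X k = 0"
    proof (rule power_series_eq_0)
      fix z :: complex assume z: "norm z < 1"
      show "(\<lambda>k. X k * z ^ k) sums F z" unfolding X_def F_def left_diff_distrib
        by (intro sums_diff S.val_equation_sums S.half_angular_integral_sums z t w_int)
      assume "z \<noteq> 0"
      have "vconv w (\<lambda>s. S.val z s - S.val z 0) t = vconv w (\<lambda>s. u z s - u z 0) t"
        by (rule vconv_cong) (use uv z in auto)
      then show "F z = 0" using int[OF t z \<open>z \<noteq> 0\<close>] uv[OF t z] uv[OF order_refl z] by (simp add: F_def)
    qed
    then show ?thesis unfolding X_def by (simp only: right_minus_eq)
  qed
  \<comment> \<open>Both functions start at \<open>a k\<close>, so their difference \<open>c\<close>
    satisfies the integrated equation without an initial term.\<close>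
  have coeff: "taylor u k t = a k * of_real (mode k t)" if t: "t \<ge> 0" for k t
  proof -
    define c where "c s = taylor u k s - a k * of_real (mode k s)" for s
    have cc: "continuous_on {0..} c" unfolding c_def by (intro continuous_intros S.cont mode_continuous_on)
    have sub: "continuous_on {0..s} (taylor u k)" for s using S.cont by (rule continuous_on_subset) auto
    have mc: "continuous_on A (\<lambda>s. a k * of_real (mode k s))" for A by (intro continuous_intros mode_continuous_on)
      have "c t = 0"
    proof (rule mode_unique[OF cc _ t])
      fix s :: real assume s: "s \<ge> 0"
      have "c = (\<lambda>s. (taylor u k s - taylor u k 0) - (a k * of_real (mode k s) - a k * of_real (mode k 0)))"
        by (auto simp: c_def u0)
      then have "vconv w c s = vconv w (\<lambda>s. taylor u k s - taylor u k 0) s - vconv w (\<lambda>s. a k * of_real (mode k s) - a k * of_real (mode k 0)) s"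
        using vconv_diff[OF w_int[of s], of "\<lambda>s. taylor u k s - taylor u k 0" "\<lambda>s. a k * of_real (mode k s) - a k * of_real (mode k 0)"]
        by (simp only:) (simp add: continuous_on_diff sub mc)
      moreover have c1: "vconv (\<lambda>_. 1) c s = vconv (\<lambda>_. 1) (taylor u k) s - vconv (\<lambda>_. 1) (\<lambda>s. a k * of_real (mode k s)) s"
        unfolding c_def[abs_def] by (rule vconv_diff[OF set_integrable_const_1 sub mc])
      moreover have "b *\<^sub>R c s = b *\<^sub>R (taylor u k s - taylor u k 0) - b *\<^sub>R (a k * of_real (mode k s) - a k * of_real (mode k 0))"
        by (simp add: c_def u0 scaleR_diff_right)
      ultimately have "vconv w c s + b *\<^sub>R c s
        = (vconv w (\<lambda>s. taylor u k s - taylor u k 0) s + b *\<^sub>R (taylor u k s - taylor u k 0))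
          - (vconv w (\<lambda>s. a k * of_real (mode k s) - a k * of_real (mode k 0)) s
             + b *\<^sub>R (a k * of_real (mode k s) - a k * of_real (mode k 0)))"
        by (simp only: add_diff_add)
      also have "\<dots> = - ((real k)\<^sup>2 / 2) *\<^sub>R vconv (\<lambda>_. 1) c s"
        unfolding modes[OF s] coefficient_equation[OF s] c1 by (simp only: scaleR_diff_right)
      finally show "vconv w c s + b *\<^sub>R c s = - ((real k)\<^sup>2 / 2) *\<^sub>R vconv (\<lambda>_. 1) c s" .
    qed
    then show ?thesis by (simp add: c_def)
  qed
  have ball: "u y t - W y t = 0" if "y \<in> ball 0 1" for y
  proof -
    have y: "norm y < 1" using that by simp
    have "(\<lambda>k. a k * of_real (mode k t) * y ^ k) sums u y t"
      using taylor_sums[where u=u and t=t, OF disk(1)[OF t] y] unfolding coeff[OF t] .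
    then show ?thesis using sums_unique2[OF W_sums'[OF t y]] by simp
  qed
  \<comment> \<open>Boundary values are determined by continuity from the open disk.\<close>
  have "continuous_on (closure (ball 0 1)) (\<lambda>y. u y t - W y t)"
    using disk(2)[OF t] W_disk[OF t] by (auto simp: disk_algebra_def intro!: continuous_on_diff)
  from continuous_constant_on_closure[OF this ball, of z] z show ?thesis by simp
qed

end

theorem theorem3p1:
  fixes M :: "'a measure" and \<nu> :: "real measure" and b :: real
    and H :: "real \<Rightarrow> 'a \<Rightarrow> real" and m :: "real \<Rightarrow> real \<Rightarrow> real"
    and f :: "complex \<Rightarrow> complex" and a :: "nat \<Rightarrow> complex"
  assumes "prob_space M"
    and "b \<ge> 0"
    and "levy_measure \<nu>"
    and "locally_absolutely_continuous_on {0<..} (levy_tail \<nu>)"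
    and "filterlim (levy_tail \<nu>) at_top (at_right 0)"
    and "subordinator M (bernstein b \<nu>) H"
    and "\<And>s t. t > 0 \<Longrightarrow> m s t \<ge> 0"
    and "\<And>t. t > 0 \<Longrightarrow> distributed M lborel (inverse_subordinator H t) (\<lambda>s. ennreal (m s t))"
    and "f \<in> disk_algebra"
    and "\<And>z. z \<in> ball 0 1 \<Longrightarrow> (\<lambda>k. a k * z ^ k) sums f z"
  shows
    "(\<forall>t>0. W_op m t f \<in> disk_algebra \<and>
        (\<forall>z\<in>ball 0 1. (\<lambda>k. a k * z ^ k * of_real (d_coeff M H k t)) sums W_op m t f z)) \<and>
     (\<forall>\<theta>>0. \<forall>z\<in>ball 0 1.
        set_integrable lborel {0..} (\<lambda>t. exp (- \<theta> * t) *\<^sub>R W_op m t f z) \<and>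
        (\<lambda>k. a k * z ^ k * of_real (d_laplace (bernstein b \<nu>) k \<theta>)) sums
          (LINT t:{0..}|lborel. exp (- \<theta> * t) *\<^sub>R W_op m t f z)) \<and>
     cauchy_solution b (levy_tail \<nu>) f (\<lambda>z t. W_op m t f z) \<and>
     (\<forall>u. cauchy_solution b (levy_tail \<nu>) f u \<longrightarrow>
        (\<forall>t\<ge>0. \<forall>z\<in>cball 0 1. u z t = W_op m t f z))"
proof -
  interpret P: prob_space M by fact
  interpret S: subordinated_semigroup M \<nu> b H m f a
    by unfold_locales (fact assms)+
  have "W_op m t f \<in> disk_algebra" if "t > 0" for t
    using S.W_disk[of t] that by simp
  moreover have "(\<lambda>k. a k * z ^ k * of_real (d_coeff M H k t)) sums W_op m t f z" if "t > 0" "z \<in> ball 0 1" for t z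
    using S.W_sums[OF that(1), of z] that(2) by (simp add: S.mode_d_coeff[OF that(1)])
  moreover have "set_integrable lborel {0..} (\<lambda>t. exp (- \<theta> * t) *\<^sub>R W_op m t f z)"
    "(\<lambda>k. a k * z ^ k * of_real (d_laplace (bernstein b \<nu>) k \<theta>)) sums
          (LINT t:{0..}|lborel. exp (- \<theta> * t) *\<^sub>R W_op m t f z)" if "\<theta> > 0" "z \<in> ball 0 1" for \<theta> z
    using S.W_laplace[OF that(1), of z] that(2) by simp_all
  ultimately show ?thesis using S.W_solution S.solution_unique by blast
qed

end
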